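(* Let $k$ be an infinite field, $R=k[x_1,\ldots,x_m]$, $I\subset R$ a homogeneous ideal, $A=R/I$ and $d=\dim A$. Let $u=\{u_{ij}\mid i=1,\ldots,d,\ j=1,\ldots,m\}$ be $md$ indeterminates and let $Q_u\subset A_u$ be the associated generic minimal reduction of $A$. Then $$r(A)=r_{Q_u}(A_u)=\min\Big\{n\ge 0\ \Big|\ \operatorname{rank}M_{n+1}(u)=\binom{n+m}{m-1}\Big\}.$$
   Context: A standard graded algebra over a field $K$ is a graded ring $B=\bigoplus_{n\ge0}B_n$ with $B_0=K$, generated over $K$ by finitely many elements of $B_1$; elements of $B_1$ are called linear forms. A reduction of $B$ is an ideal $Q$ generated by linear forms such that $Q_n=B_n$ for all large $n$. The reduction number $r_Q(B)$ of $B$ with respect to a reduction $Q$ is the least $n\ge0$ with $Q_{n+1}=B_{n+1}$. A reduction is minimal if it contains no other reduction (over an infinite field: equivalently, it is a reduction generated by $\dim B$ linear forms). The reduction number is $r(B)=\min\{r_Q(B)\mid Q \text{ a minimal reduction of } B\}$. Here $A=R/I$ is a standard graded $k$-algebra (so $I$ is proper). Put $R_u=k(u)[x_1,\ldots,x_m]$, $z_i=\sum_{j=1}^m u_{ij}x_j$ for $i=1,\ldots,d$, $A_u=R_u/IR_u$ (a standard graded $k(u)$-algebra) and $Q_u=(z_1,\ldots,z_d,I)/IR_u$. It is well known that $Q_u$ is a minimal reduction of $A_u$; it is called a generic minimal reduction of $A$. Fix generators $I=(f_1,\ldots,f_v)$ with $f_j$ a form of degree $d_j$. For $n\ge0$,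 $M_n(u)$ is the matrix of coefficients of the elements $z_ig$ ($i=1,\ldots,d$, $g$ a monomial of $R$ of degree $n-1$) and $f_jh$ ($j=1,\ldots,v$, $h$ a monomial of $R$ of degree $n-d_j$), written as linear combinations of the monomials of degree $n$ in $x_1,\ldots,x_m$. Its entries lie in $k[u]$; its rank is taken over $k(u)$. *)

theory Defs
  imports
    "HOL-Library.Poly_Mapping"
    "HOL-Library.Extended_Nat"
    "HOL-Library.Nat_Bijection"
    "HOL-Computational_Algebra.Polynomial_Factorial"
    "HOL-Algebra.QuotRing"
    "Jordan_Normal_Form.DL_Rank"
begin

section \<open>Polynomial rings and rational function fields\<close>

text \<open>
  Multivariate polynomials are finitely supported functions from exponent vectors to
  coefficients, with variables indexed by natural numbers.  The rings of interest, with finitely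
  many variables and with coefficients in a given subring, are carriers inside this type.
\<close>

type_synonym 'a mpol = "(nat \<Rightarrow>\<^sub>0 nat) \<Rightarrow>\<^sub>0 'a"

definition ring_on :: "'a::comm_ring_1 set \<Rightarrow> 'a ring" where
  "ring_on C = \<lparr>carrier = C, mult = (*), one = 1, zero = 0, add = (+)\<rparr>"

definition polys :: "'a::comm_ring_1 set \<Rightarrow> nat set \<Rightarrow> 'a mpol set" where
  "polys C V = {p. (\<forall>e. Poly_Mapping.lookup p e \<in> C) \<and> (\<forall>e\<in>Poly_Mapping.keys p. Poly_Mapping.keys e \<subseteq> V)}"

abbreviation poly_ring :: "'a::comm_ring_1 set \<Rightarrow> nat set \<Rightarrow> 'a mpol ring" where
  "poly_ring C V \<equiv> ring_on (polys C V)"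

definition total_deg :: "(nat \<Rightarrow>\<^sub>0 nat) \<Rightarrow> nat" where
  "total_deg e = (\<Sum>x\<in>Poly_Mapping.keys e. Poly_Mapping.lookup e x)"

definition forms :: "'a::comm_ring_1 set \<Rightarrow> nat set \<Rightarrow> nat \<Rightarrow> 'a mpol set" where
  "forms C V n = {p \<in> polys C V. \<forall>e\<in>Poly_Mapping.keys p. total_deg e = n}"

definition monomial :: "(nat \<Rightarrow>\<^sub>0 nat) \<Rightarrow> 'a::comm_ring_1 mpol" where
  "monomial e = Poly_Mapping.single e 1"

definition var :: "nat \<Rightarrow> 'a::comm_ring_1 mpol" where
  "var x = monomial (Poly_Mapping.single x 1)"

text \<open>
  The indeterminate \<open>u\<^sub>i\<^sub>j\<close> is the variable number \<open>prod_encode (i, j)\<close>.  Here and below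
  \<open>i\<close> runs over \<open>0, \<dots>, d - 1\<close> and \<open>j\<close> over \<open>0, \<dots>, m - 1\<close>.  The field \<open>k(u)\<close> consists of the fractions
  involving only these \<open>d m\<close> indeterminates; the ambient type has further ones.
\<close>

definition uvars :: "nat \<Rightarrow> nat \<Rightarrow> nat set" where
  "uvars d m = prod_encode ` ({..<d} \<times> {..<m})"

definition ratfuns :: "nat \<Rightarrow> nat \<Rightarrow> 'k::field mpol fract set" where
  "ratfuns d m = {Fract p q | p q. p \<in> polys UNIV (uvars d m) \<and> q \<in> polys UNIV (uvars d m) \<and> q \<noteq> 0}"

definition u_ind :: "nat \<Rightarrow> nat \<Rightarrow> 'k::field mpol fract" where
  "u_ind i j = to_fract (var (prod_encode (i, j)))"

definition extend_scalars :: "'k::field mpol \<Rightarrow> 'k mpol fract mpol" where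
  "extend_scalars = Poly_Mapping.map (\<lambda>c. to_fract (Poly_Mapping.single 0 c))"

lemma lookup_extend_scalars:
  "Poly_Mapping.lookup (extend_scalars p) e = to_fract (Poly_Mapping.single 0 (Poly_Mapping.lookup p e))"
  by (simp add: extend_scalars_def Poly_Mapping.map.rep_eq when_def)

section \<open>Krull dimension, reductions and reduction numbers\<close>

text \<open>
  Supremum of the lengths \<open>n\<close> of chains \<open>P\<^sub>0 \<subset> \<dots> \<subset> P\<^sub>n\<close> of prime ideals; only meant for nonzero rings
  (for the zero ring this gives \<open>0\<close>).
\<close>

definition krull_dim :: "('a, 'b) ring_scheme \<Rightarrow> enat" where
  "krull_dim B = Sup {enat n | n.
     \<exists>P. (\<forall>i\<le>n. primeideal (P i) B) \<and> (\<forall>i<n. P i \<subset> P (Suc i))}"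

text \<open>A graded ring is represented by a ring \<open>B\<close> together with the family \<open>G\<close> of its graded pieces.\<close>

definition homogeneous_ideal :: "'a ring \<Rightarrow> (nat \<Rightarrow> 'a set) \<Rightarrow> 'a set \<Rightarrow> bool" where
  "homogeneous_ideal B G I \<longleftrightarrow> ideal I B \<and> I = Idl\<^bsub>B\<^esub> (I \<inter> (\<Union>n. G n))"

definition quot_grading :: "'a ring \<Rightarrow> (nat \<Rightarrow> 'a set) \<Rightarrow> 'a set \<Rightarrow> nat \<Rightarrow> 'a set set" where
  "quot_grading B G I n = (\<lambda>p. I +>\<^bsub>B\<^esub> p) ` G n"

definition is_reduction :: "'a ring \<Rightarrow> (nat \<Rightarrow> 'a set) \<Rightarrow> 'a set \<Rightarrow> bool" where
  "is_reduction B G Q \<longleftrightarrow>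
     (\<exists>L \<subseteq> G 1. Q = Idl\<^bsub>B\<^esub> L) \<and> (\<exists>N. \<forall>n\<ge>N. Q \<inter> G n = G n)"

definition is_minimal_reduction :: "'a ring \<Rightarrow> (nat \<Rightarrow> 'a set) \<Rightarrow> 'a set \<Rightarrow> bool" where
  "is_minimal_reduction B G Q \<longleftrightarrow>
     is_reduction B G Q \<and> (\<forall>Q'. is_reduction B G Q' \<and> Q' \<subseteq> Q \<longrightarrow> Q' = Q)"

definition reduction_number_wrt :: "'a ring \<Rightarrow> (nat \<Rightarrow> 'a set) \<Rightarrow> 'a set \<Rightarrow> nat" where
  "reduction_number_wrt B G Q = (LEAST n. Q \<inter> G (Suc n) = G (Suc n))"

definition reduction_number :: "'a ring \<Rightarrow> (nat \<Rightarrow> 'a set) \<Rightarrow> nat" where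
  "reduction_number B G = Inf {reduction_number_wrt B G Q | Q. is_minimal_reduction B G Q}"

section \<open>The algebras \<open>A\<close> and \<open>A\<^sub>u\<close> and the generic minimal reduction\<close>

definition A_ring :: "nat \<Rightarrow> 'k::field mpol set \<Rightarrow> 'k mpol set ring" where
  "A_ring m I = poly_ring UNIV {..<m} Quot I"

definition A_grading :: "nat \<Rightarrow> 'k::field mpol set \<Rightarrow> nat \<Rightarrow> 'k mpol set set" where
  "A_grading m I = quot_grading (poly_ring UNIV {..<m}) (forms UNIV {..<m}) I"

abbreviation Ru :: "nat \<Rightarrow> nat \<Rightarrow> 'k::field mpol fract mpol ring" where
  "Ru d m \<equiv> poly_ring (ratfuns d m) {..<m}"

definition IRu :: "nat \<Rightarrow> nat \<Rightarrow> 'k::field mpol set \<Rightarrow> 'k mpol fract mpol set" where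
  "IRu d m I = Idl\<^bsub>Ru d m\<^esub> (extend_scalars ` I)"

definition Au_ring :: "nat \<Rightarrow> nat \<Rightarrow> 'k::field mpol set \<Rightarrow> 'k mpol fract mpol set ring" where
  "Au_ring d m I = Ru d m Quot IRu d m I"

definition Au_grading :: "nat \<Rightarrow> nat \<Rightarrow> 'k::field mpol set \<Rightarrow> nat \<Rightarrow> 'k mpol fract mpol set set" where
  "Au_grading d m I = quot_grading (Ru d m) (forms (ratfuns d m) {..<m}) (IRu d m I)"

definition z_form :: "nat \<Rightarrow> nat \<Rightarrow> 'k::field mpol fract mpol" where
  "z_form m i = (\<Sum>j<m. Poly_Mapping.single 0 (u_ind i j) * var j)"

definition Qu :: "nat \<Rightarrow> nat \<Rightarrow> 'k::field mpol set \<Rightarrow> 'k mpol fract mpol set set" where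
  "Qu d m I = (\<lambda>p. IRu d m I +>\<^bsub>Ru d m\<^esub> p) ` (Idl\<^bsub>Ru d m\<^esub> (z_form m ` {..<d} \<union> extend_scalars ` I))"

section \<open>The matrices \<open>M\<^sub>n(u)\<close> and their rank\<close>

text \<open>The degree is an integer, so that there are no monomials of degree \<open>n - d\<^sub>j < 0\<close>.\<close>

definition monomials :: "nat \<Rightarrow> int \<Rightarrow> (nat \<Rightarrow>\<^sub>0 nat) list" where
  "monomials m n = sorted_list_of_set {e. Poly_Mapping.keys e \<subseteq> {..<m} \<and> int (total_deg e) = n}"

definition M_gens ::
  "nat \<Rightarrow> nat \<Rightarrow> nat \<Rightarrow> (nat \<Rightarrow> 'k::field mpol) \<Rightarrow> (nat \<Rightarrow> nat) \<Rightarrow> nat \<Rightarrow> 'k mpol fract mpol list" where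
  "M_gens d m v f dg n =
     [z_form m i * monomial g. i \<leftarrow> [0..<d], g \<leftarrow> monomials m (int n - 1)] @
     [extend_scalars (f j) * monomial h. j \<leftarrow> [0..<v], h \<leftarrow> monomials m (int n - int (dg j))]"

text \<open>Rows are indexed by the monomials of degree \<open>n\<close>, columns by the generators.\<close>

definition M_mat ::
  "nat \<Rightarrow> nat \<Rightarrow> nat \<Rightarrow> (nat \<Rightarrow> 'k::field mpol) \<Rightarrow> (nat \<Rightarrow> nat) \<Rightarrow> nat \<Rightarrow> 'k mpol fract mat" where
  "M_mat d m v f dg n = mat (length (monomials m (int n))) (length (M_gens d m v f dg n))
     (\<lambda>(r, c). Poly_Mapping.lookup (M_gens d m v f dg n ! c) (monomials m (int n) ! r))"

text \<open>
  Rank over a subfield \<open>C\<close> containing the entries: the dimension of the \<open>C\<close>-span of the columns.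
  The library's \<open>rank\<close> is the case where \<open>C\<close> is the whole type.
\<close>

definition vec_module_on :: "'a::comm_ring_1 set \<Rightarrow> nat \<Rightarrow> ('a, 'a vec) module" where
  "vec_module_on C n = \<lparr>carrier = {w \<in> carrier_vec n. \<forall>i<n. w $ i \<in> C},
     mult = undefined, one = undefined, zero = 0\<^sub>v n, add = (+), smult = (\<cdot>\<^sub>v)\<rparr>"

definition rank_over :: "'a::field set \<Rightarrow> 'a mat \<Rightarrow> nat" where
  "rank_over C X = (let V = vec_module_on C (dim_row X) in
     vectorspace.dim (ring_on C)
       (V\<lparr>carrier := LinearCombinations.module.span (ring_on C) V (set (cols X))\<rparr>))"

lemma rank_over_UNIV: "rank_over UNIV X = vec_space.rank (dim_row X) X"
proof -
  have "vec_module_on UNIV n = (module_vec TYPE('a) n)" for n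
    by (simp add: vec_module_on_def module_vec_def)
  then show ?thesis
    by (simp add: rank_over_def vec_space.rank_def ring_on_def Let_def)
qed

end

theory Submission
  imports Defs
begin

text \<open>
  Full rank of \<open>M\<^sub>n(u)\<close> says that \<open>(z\<^sub>1, \<dots>, z\<^sub>d, I)\<close> contains all forms of degree \<open>n\<close> over \<open>k(u)\<close>.  If the
  forms of degree \<open>n\<close> lie in \<open>(y\<^sub>1, \<dots>, y\<^sub>d, I)\<close> for some linear forms \<open>y\<^sub>i\<close> over \<open>k\<close>, then replacing \<open>y\<^sub>i\<close>
  by \<open>z\<^sub>i\<close> in the relations that express the monomials yields elements of \<open>(z, I)\<close> whose coefficient
  matrix specialises to the identity, so that it is invertible over \<open>k(u)\<close>.  Conversely, relations
  over \<open>k(u)\<close> can be specialised at every point where a common denominator does not vanish.  Hence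
  \<open>r\<^sub>Q(A)\<close> for the generic \<open>Q\<close> is the minimum over all reductions generated by \<open>d\<close> linear forms.

  These are the minimal reductions.  If \<open>s\<close> linear forms generate a reduction, then the forms
  of degree at most \<open>n\<close> span a space of dimension \<open>O(n\<^sup>s)\<close> in \<open>A\<close>, while a chain of primes of length \<open>l\<close>
  gives \<open>l\<close> elements that are algebraically independent in \<open>A\<close>; so \<open>d \<le> s\<close>.  On the other hand, a
  homogeneous ideal that is maximal among those over which no \<open>s\<close> linear forms generate a reduction is
  prime, because a general member of the pencil through two families that work for \<open>P + (a)\<close> and
  \<open>P + (b)\<close> works for both, hence for \<open>P\<close> if \<open>ab \<in> P\<close>.  By induction, if no \<open>d\<close> linear forms of a given
  reduction generate a reduction, then there is a chain of primes of length \<open>d + 1\<close>.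
\<close>

section \<open>Polynomials as finitely supported functions\<close>

text \<open>Three obstacles shape the proof. Both k[u] and k(u) are proper subsets of the types they
  live in. Ideals, primes, spans and ranks are therefore taken relative to a carrier; determinants
  and adjugates are computed in the ambient ring, and their entries are then checked to stay in the
  carrier. A fraction cannot be evaluated at every point. Relations between k(u) and k are therefore
  moved through k[u][x], which maps injectively to k(u)[x] and, for each point, to k[x]. Minimality
  compares a reduction with the reductions inside it. For that reason the linear forms of the prime
  chain argument come from a prescribed space \<open>L\<close>, later the linear forms of the given
  reduction, and not from all linear forms. Both transfers between k and k(u) keep the degree
  \<open>n\<close> fixed. This makes the reduction numbers agree exactly. A statement "all forms of
  degree \<open>n\<close> lie in the ideal" concerns only the finitely many monomials of degree
  \<open>n\<close>; this finiteness supplies the square matrices, the common denominators and the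
  chain condition in the use of Zorn's lemma.\<close>

abbreviation "lookup \<equiv> Poly_Mapping.lookup"
abbreviation "keys \<equiv> Poly_Mapping.keys"
abbreviation "single \<equiv> Poly_Mapping.single"

text \<open>Common source of \<open>mapcoeff\<close> and \<open>eval_mpol\<close>: additivity and
  multiplicativity need only be checked on single terms. The condition \<open>h e 0 = 0\<close> in
  the lemmas below is there because keys can disappear in sums.\<close>

definition linext :: "('e \<Rightarrow> 'a \<Rightarrow> 'b) \<Rightarrow> ('e \<Rightarrow>\<^sub>0 'a::zero) \<Rightarrow> 'b::comm_monoid_add" where
  "linext h p = (\<Sum>e\<in>keys p. h e (lookup p e))"

lemma linext_zero [simp]: "linext h 0 = 0"
  by (simp add: linext_def)

lemma linext_single: "h e 0 = 0 \<Longrightarrow> linext h (single e c) = h e c"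
  by (simp add: linext_def)

lemma linext_add:
  assumes "\<And>e. h e 0 = 0" "\<And>e x y. h e (x + y) = h e x + h e y"
  shows "linext h (p + q) = linext h p + linext h q"
  unfolding linext_def using assms by (rule setsum_keys_plus_distrib)

lemma linext_sum:
  assumes "\<And>e. h e 0 = 0" "\<And>e x y. h e (x + y) = h e x + h e y"
  shows "linext h (\<Sum>i\<in>A. p i) = (\<Sum>i\<in>A. linext h (p i))"
  by (induction A rule: infinite_finite_induct) (simp_all add: linext_add[OF assms])

lemma sum_single_lookup: "(\<Sum>e\<in>keys p. single e (lookup p e)) = p"
  by (rule poly_mapping_eqI)
    (auto simp: lookup_sum lookup_single when_def in_keys_iff sum.delta[OF finite_keys])

lemma mult_eq_sum_single:
  fixes p q :: "'e::monoid_add \<Rightarrow>\<^sub>0 'a::semiring_0"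
  shows "p * q = (\<Sum>a\<in>keys p. \<Sum>b\<in>keys q. single (a + b) (lookup p a * lookup q b))"
proof -
  have "p * q = (\<Sum>a\<in>keys p. single a (lookup p a)) * (\<Sum>b\<in>keys q. single b (lookup q b))"
    by (simp only: sum_single_lookup)
  then show ?thesis by (simp add: sum_product mult_single)
qed

lemma linext_mult:
  fixes p q :: "'e::monoid_add \<Rightarrow>\<^sub>0 'a::semiring_0" and h :: "'e \<Rightarrow> 'a \<Rightarrow> 'b::comm_ring_1"
  assumes "\<And>e. h e 0 = 0" "\<And>e x y. h e (x + y) = h e x + h e y"
    and "\<And>e e' x y. h (e + e') (x * y) = h e x * h e' y"
  shows "linext h (p * q) = linext h p * linext h q"
proof -
  have "linext h (p * q) = (\<Sum>a\<in>keys p. \<Sum>b\<in>keys q. h (a + b) (lookup p a * lookup q b))"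
    unfolding mult_eq_sum_single by (simp add: linext_sum[OF assms(1,2)] linext_single assms(1))
  also have "\<dots> = linext h p * linext h q"
    by (simp add: linext_def assms(3) sum_product)
  finally show ?thesis .
qed

lemma total_deg_superset: "finite X \<Longrightarrow> keys e \<subseteq> X \<Longrightarrow> total_deg e = (\<Sum>x\<in>X. lookup e x)"
  unfolding total_deg_def by (intro sum.mono_neutral_left) (auto simp: in_keys_iff)

lemma keys_add_nat: "keys (a + b) = keys a \<union> keys (b :: 'x \<Rightarrow>\<^sub>0 nat)"
  by (auto simp: in_keys_iff lookup_add)

lemma total_deg_add: "total_deg (a + b) = total_deg a + total_deg b"
  using total_deg_superset[of "keys a \<union> keys b" "a + b"] total_deg_superset[of "keys a \<union> keys b" a]
    total_deg_superset[of "keys a \<union> keys b" b]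
  by (simp add: keys_add_nat lookup_add sum.distrib)

lemma total_deg_zero [simp]: "total_deg 0 = 0"
  by (simp add: total_deg_def)

lemma total_deg_single [simp]: "total_deg (single x c) = c"
  by (simp add: total_deg_def)

lemma total_deg_eq_0_iff: "total_deg e = 0 \<longleftrightarrow> e = 0"
proof
  assume "total_deg e = 0"
  then have "lookup e x = 0" for x
    by (cases "x \<in> keys e") (simp_all add: total_deg_def in_keys_iff)
  then show "e = 0" by (intro poly_mapping_eqI) simp
qed simp

definition mapcoeff :: "('a \<Rightarrow> 'b) \<Rightarrow> ('e \<Rightarrow>\<^sub>0 'a::zero) \<Rightarrow> ('e \<Rightarrow>\<^sub>0 'b::comm_monoid_add)" where
  "mapcoeff \<phi> = linext (\<lambda>e c. single e (\<phi> c))"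

lemma lookup_mapcoeff: "\<phi> 0 = 0 \<Longrightarrow> lookup (mapcoeff \<phi> p) e = \<phi> (lookup p e)"
  by (auto simp: mapcoeff_def linext_def lookup_sum lookup_single when_def in_keys_iff
      sum.delta[OF finite_keys])

lemma mapcoeff_single: "\<phi> 0 = 0 \<Longrightarrow> mapcoeff \<phi> (single e c) = single e (\<phi> c)"
  by (simp add: mapcoeff_def linext_single)

lemma mapcoeff_hom:
  assumes "comm_ring_hom \<phi>"
  shows "comm_ring_hom (mapcoeff \<phi> :: ('e::comm_monoid_add \<Rightarrow>\<^sub>0 'a::comm_ring_1) \<Rightarrow> ('e \<Rightarrow>\<^sub>0 'b::comm_ring_1))"
proof -
  interpret comm_ring_hom \<phi> by fact
  show ?thesis
  proof
    show "mapcoeff \<phi> (p + q) = mapcoeff \<phi> p + mapcoeff \<phi> q" for p q :: "'e \<Rightarrow>\<^sub>0 'a"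
      unfolding mapcoeff_def by (rule linext_add) (simp_all add: hom_add single_add)
    show "mapcoeff \<phi> (p * q) = mapcoeff \<phi> p * mapcoeff \<phi> q" for p q :: "'e \<Rightarrow>\<^sub>0 'a"
      unfolding mapcoeff_def by (rule linext_mult) (simp_all add: hom_add single_add hom_mult mult_single)
    show "mapcoeff \<phi> (1 :: 'e \<Rightarrow>\<^sub>0 'a) = 1"
      using mapcoeff_single[of \<phi> 0 1] by simp
  qed (simp add: mapcoeff_def)
qed

lemma extend_scalars_eq: "extend_scalars = mapcoeff (\<lambda>c. to_fract (single 0 c))"
  by (rule ext, rule poly_mapping_eqI) (simp add: lookup_extend_scalars lookup_mapcoeff)

lemma to_fract_const_hom:
  "comm_ring_hom (\<lambda>c. to_fract (single 0 c) :: 'k::field mpol fract)"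
  by unfold_locales (simp_all add: single_add mult_single flip: to_fract_mult)

interpretation extend_scalars: comm_ring_hom "extend_scalars :: 'k::field mpol \<Rightarrow> _"
  unfolding extend_scalars_eq by (rule mapcoeff_hom[OF to_fract_const_hom])

definition eval_mpol :: "(nat \<Rightarrow> 'a) \<Rightarrow> 'a::comm_ring_1 mpol \<Rightarrow> 'a" where
  "eval_mpol a = linext (\<lambda>e c. c * (\<Prod>x\<in>keys e. a x ^ lookup e x))"

lemma prod_power_superset:
  assumes "finite X" "keys e \<subseteq> X"
  shows "(\<Prod>x\<in>X. a x ^ lookup e x) = (\<Prod>x\<in>keys e. (a x :: 'a::comm_ring_1) ^ lookup e x)"
  using assms by (intro prod.mono_neutral_right) (auto simp: in_keys_iff)

lemma prod_power_add:
  "(\<Prod>x\<in>keys (e + e'). (a x :: 'a::comm_ring_1) ^ lookup (e + e') x)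
     = (\<Prod>x\<in>keys e. a x ^ lookup e x) * (\<Prod>x\<in>keys e'. a x ^ lookup e' x)"
  using prod_power_superset[of "keys e \<union> keys e'" e a] prod_power_superset[of "keys e \<union> keys e'" e' a]
  by (simp add: keys_add_nat lookup_add power_add prod.distrib)

lemma eval_mpol_hom: "comm_ring_hom (eval_mpol a :: 'a::comm_ring_1 mpol \<Rightarrow> 'a)"
proof
  show "eval_mpol a (p + q) = eval_mpol a p + eval_mpol a q" for p q
    unfolding eval_mpol_def by (rule linext_add) (simp_all add: distrib_right)
  show "eval_mpol a (p * q) = eval_mpol a p * eval_mpol a q" for p q
    unfolding eval_mpol_def by (rule linext_mult) (simp_all add: distrib_right prod_power_add mult_ac)
  show "eval_mpol a 1 = 1"
    unfolding eval_mpol_def single_one[symmetric] by (subst linext_single) simp_all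
qed (simp add: eval_mpol_def)

lemma eval_mpol_single: "eval_mpol a (single e c) = c * (\<Prod>x\<in>keys e. a x ^ lookup e x)"
  by (simp add: eval_mpol_def linext_single)

lemma eval_mpol_var: "eval_mpol a (var x) = (a x :: 'a::comm_ring_1)"
  by (simp add: var_def monomial_def eval_mpol_single)

section \<open>Subrings and the ideals they carry\<close>

text \<open>A carrier inside a ring type, with the arithmetic of the type. It will be k, k[u], k(u),
  and polynomials over each of them.\<close>

locale csubring =
  fixes C :: "'a::comm_ring_1 set"
  assumes zero [simp]: "0 \<in> C" and one [simp]: "1 \<in> C"
    and add [intro]: "x \<in> C \<Longrightarrow> y \<in> C \<Longrightarrow> x + y \<in> C"
    and mult [intro]: "x \<in> C \<Longrightarrow> y \<in> C \<Longrightarrow> x * y \<in> C"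
    and uminus [intro]: "x \<in> C \<Longrightarrow> - x \<in> C"
begin

lemma sum [intro]: "(\<And>i. i \<in> A \<Longrightarrow> f i \<in> C) \<Longrightarrow> sum f A \<in> C"
  by (induction A rule: infinite_finite_induct) (auto intro: add)

lemma prod [intro]: "(\<And>i. i \<in> A \<Longrightarrow> f i \<in> C) \<Longrightarrow> prod f A \<in> C"
  by (induction A rule: infinite_finite_induct) (auto intro: mult)

lemma power [intro]: "x \<in> C \<Longrightarrow> x ^ n \<in> C"
  by (induction n) (auto intro: mult)

lemma cring: "cring (ring_on C)"
proof (rule cringI)
  show "abelian_group (ring_on C)"
    by (rule abelian_groupI) (auto simp: ring_on_def add.assoc add.commute intro!: bexI[of _ "- x" for x])
  show "comm_monoid (ring_on C)"
    by (rule comm_monoidI) (auto simp: ring_on_def mult.assoc mult.commute)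
qed (auto simp: ring_on_def distrib_right)

abbreviation is_ideal :: "'a set \<Rightarrow> bool" where
  "is_ideal J \<equiv> ideal J (ring_on C)"

abbreviation is_prime :: "'a set \<Rightarrow> bool" where
  "is_prime J \<equiv> primeideal J (ring_on C)"

lemma minus_ring_on: "x \<in> C \<Longrightarrow> \<ominus>\<^bsub>ring_on C\<^esub> x = - x"
proof -
  interpret cring "ring_on C" by (rule cring)
  assume "x \<in> C"
  then show ?thesis
    by (intro minus_equality) (auto simp: ring_on_def)
qed

text \<open>Translates library ideals into plain arithmetic. Closure under negation is
  multiplication by \<open>-1\<close>, which lies in \<open>C\<close>.\<close>

lemma ideal_iff:
  "is_ideal J \<longleftrightarrow> J \<subseteq> C \<and> 0 \<in> J \<and> (\<forall>x\<in>J. \<forall>y\<in>J. x + y \<in> J) \<and> (\<forall>r\<in>C. \<forall>x\<in>J. r * x \<in> J)"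
proof
  assume "is_ideal J"
  then interpret ideal J "ring_on C" .
  show "J \<subseteq> C \<and> 0 \<in> J \<and> (\<forall>x\<in>J. \<forall>y\<in>J. x + y \<in> J) \<and> (\<forall>r\<in>C. \<forall>x\<in>J. r * x \<in> J)"
    using a_subset additive_subgroup.zero_closed[OF is_additive_subgroup]
      additive_subgroup.a_closed[OF is_additive_subgroup] I_l_closed by (auto simp: ring_on_def)
next
  assume *: "J \<subseteq> C \<and> 0 \<in> J \<and> (\<forall>x\<in>J. \<forall>y\<in>J. x + y \<in> J) \<and> (\<forall>r\<in>C. \<forall>x\<in>J. r * x \<in> J)"
  interpret cring "ring_on C" by (rule cring)
  have neg: "\<ominus>\<^bsub>ring_on C\<^esub> x \<in> J" if "x \<in> J" for x
  proof -
    have "(-1) * x \<in> J" using * that uminus[OF one] by blast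
    then show ?thesis using minus_ring_on[of x] * that by auto
  qed
  show "is_ideal J"
  proof (rule idealI)
    show "subgroup J (add_monoid (ring_on C))"
    proof (rule add.subgroupI)
      show "\<ominus>\<^bsub>ring_on C\<^esub> a \<in> J" if "a \<in> J" for a using neg that .
    qed (use * in \<open>auto simp: ring_on_def\<close>)
      show "a \<otimes>\<^bsub>ring_on C\<^esub> x \<in> J" if "a \<in> J" "x \<in> carrier (ring_on C)" for a x
    proof -
      have "x * a \<in> J" using * that by (auto simp: ring_on_def)
      then show ?thesis by (simp add: ring_on_def mult.commute)
    qed
  qed (use * ring_axioms in \<open>auto simp: ring_on_def\<close>)
qed

abbreviation Gen :: "'a set \<Rightarrow> 'a set" where
  "Gen S \<equiv> Idl\<^bsub>ring_on C\<^esub> S"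

context
  fixes J assumes J: "is_ideal J"
begin

lemma ideal_zero: "0 \<in> J" and ideal_add: "x \<in> J \<Longrightarrow> y \<in> J \<Longrightarrow> x + y \<in> J"
  and ideal_mult: "r \<in> C \<Longrightarrow> x \<in> J \<Longrightarrow> r * x \<in> J"
  and ideal_sub: "J \<subseteq> C"
  using J unfolding ideal_iff by auto

lemma ideal_uminus: "x \<in> J \<Longrightarrow> - x \<in> J"
  using ideal_mult[of "-1" x] uminus[OF one] by simp

lemma ideal_minus: "x \<in> J \<Longrightarrow> y \<in> J \<Longrightarrow> x - y \<in> J"
  using ideal_add[of x "- y"] ideal_uminus[of y] by simp

lemma ideal_sum: "(\<And>i. i \<in> A \<Longrightarrow> f i \<in> J) \<Longrightarrow> sum f A \<in> J"
  by (induction A rule: infinite_finite_induct) (auto intro: ideal_add ideal_zero)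

lemma ideal_add_cancel: "y \<in> J \<Longrightarrow> x + y \<in> J \<longleftrightarrow> x \<in> J"
  using ideal_add[of x y] ideal_minus[of "x + y" y] by auto

end

lemma Gen_ideal: "S \<subseteq> C \<Longrightarrow> is_ideal (Gen S)"
proof -
  interpret cring "ring_on C" by (rule cring)
  show "S \<subseteq> C \<Longrightarrow> is_ideal (Gen S)" by (rule genideal_ideal) (simp add: ring_on_def)
qed

lemma Gen_self: "S \<subseteq> C \<Longrightarrow> S \<subseteq> Gen S"
proof -
  interpret cring "ring_on C" by (rule cring)
  show "S \<subseteq> C \<Longrightarrow> S \<subseteq> Gen S" by (rule genideal_self) (simp add: ring_on_def)
qed

lemma Gen_minimal: "is_ideal J \<Longrightarrow> S \<subseteq> J \<Longrightarrow> Gen S \<subseteq> J"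
proof -
  interpret cring "ring_on C" by (rule cring)
  show "is_ideal J \<Longrightarrow> S \<subseteq> J \<Longrightarrow> Gen S \<subseteq> J" by (rule genideal_minimal)
qed

lemma Gen_mono: "T \<subseteq> C \<Longrightarrow> S \<subseteq> Gen T \<Longrightarrow> Gen S \<subseteq> Gen T"
  by (rule Gen_minimal[OF Gen_ideal])

text \<open>The right-hand side is itself an ideal that contains the generators. Only the finitely
  many \<open>y i\<close> receive explicit coefficients; the ideal \<open>H\<close> absorbs its
  own.\<close>

lemma Gen_family:
  fixes s :: nat
  assumes "\<And>i. i < s \<Longrightarrow> y i \<in> C" "is_ideal H"
  shows "Gen (y ` {..<s} \<union> H) = {(\<Sum>i<s. g i * y i) + h | g h. (\<forall>i<s. g i \<in> C) \<and> h \<in> H}" (is "_ = ?J")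
proof
  have HC: "H \<subseteq> C" by (rule ideal_sub[OF assms(2)])
  have "is_ideal ?J"
    unfolding ideal_iff
  proof (intro conjI ballI)
    show "?J \<subseteq> C" using assms HC by (auto intro!: add sum mult)
    show "0 \<in> ?J" using ideal_zero[OF assms(2)]
      by (auto intro!: exI[of _ "\<lambda>_. 0"] exI[of _ 0])
    fix a assume "a \<in> ?J"
    then obtain g h where a: "a = (\<Sum>i<s. g i * y i) + h" "\<forall>i<s. g i \<in> C" "h \<in> H" by auto
    {
      fix b assume "b \<in> ?J"
      then obtain g' h' where b: "b = (\<Sum>i<s. g' i * y i) + h'" "\<forall>i<s. g' i \<in> C" "h' \<in> H" by auto
      have "a + b = (\<Sum>i<s. (g i + g' i) * y i) + (h + h')"
        by (simp add: a(1) b(1) distrib_right sum.distrib)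
      then show "a + b \<in> ?J" using a(2,3) b(2,3) ideal_add[OF assms(2)]
        by (intro CollectI exI[of _ "\<lambda>i. g i + g' i"] exI[of _ "h + h'"]) auto
    }
    fix r assume r: "r \<in> C"
    have "r * a = (\<Sum>i<s. (r * g i) * y i) + r * h"
      by (simp add: a(1) distrib_left sum_distrib_left mult.assoc)
    then show "r * a \<in> ?J" using a(2,3) r ideal_mult[OF assms(2)]
      by (intro CollectI exI[of _ "\<lambda>i. r * g i"] exI[of _ "r * h"]) auto
  qed
  moreover have "y ` {..<s} \<union> H \<subseteq> ?J"
  proof
    fix x assume "x \<in> y ` {..<s} \<union> H"
    then show "x \<in> ?J"
    proof
      assume "x \<in> y ` {..<s}"
      then obtain i where i: "i < s" "x = y i" by auto
      have "(\<Sum>j<s. (if j = i then 1 else 0) * y j) = (\<Sum>j\<in>{..<s}. if j = i then y j else 0)"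
        by (rule sum.cong) auto
      also have "\<dots> = y i" using i by (subst sum.delta) auto
      finally have "(\<Sum>j<s. (if j = i then 1 else 0) * y j) = y i" .
      then show ?thesis using i ideal_zero[OF assms(2)]
        by (intro CollectI exI[of _ "\<lambda>j. if j = i then 1 else 0"] exI[of _ 0]) auto
    qed (auto intro!: exI[of _ "\<lambda>_. 0"])
  qed
  ultimately show "Gen (y ` {..<s} \<union> H) \<subseteq> ?J" by (rule Gen_minimal)
  have sub: "y ` {..<s} \<union> H \<subseteq> C" using assms HC by auto
  show "?J \<subseteq> Gen (y ` {..<s} \<union> H)"
  proof
    fix a assume "a \<in> ?J"
    then obtain g h where a: "a = (\<Sum>i<s. g i * y i) + h" "\<forall>i<s. g i \<in> C" "h \<in> H" by auto
    show "a \<in> Gen (y ` {..<s} \<union> H)"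
      unfolding a(1) using a(2,3) Gen_self[OF sub]
      by (intro ideal_add[OF Gen_ideal[OF sub]] ideal_sum[OF Gen_ideal[OF sub]] ideal_mult[OF Gen_ideal[OF sub]]) auto
  qed
qed

lemma Gen_insert:
  assumes "a \<in> C" "is_ideal H"
  shows "Gen (insert a H) = {g * a + h | g h. g \<in> C \<and> h \<in> H}"
proof -
  have "insert a H = (\<lambda>_. a) ` {..<1::nat} \<union> H" by auto
  then have "Gen (insert a H) = {(\<Sum>i<1. g i * a) + h | g h. (\<forall>i<(1::nat). g i \<in> C) \<and> h \<in> H}"
    using Gen_family[of 1 "\<lambda>_. a" H] assms by simp
  also have "\<dots> = {g * a + h | g h. g \<in> C \<and> h \<in> H}"
  proof (intro subset_antisym subsetI)
    fix x assume "x \<in> {g * a + h | g h. g \<in> C \<and> h \<in> H}"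
    then obtain g h where "x = g * a + h" "g \<in> C" "h \<in> H" by auto
    then show "x \<in> {(\<Sum>i<1. g i * a) + h | g h. (\<forall>i<(1::nat). g i \<in> C) \<and> h \<in> H}"
      by (intro CollectI exI[of _ "\<lambda>_. g"] exI[of _ h]) simp
  qed auto
  finally show ?thesis .
qed

end

section \<open>Homogeneous components\<close>

lemma keys_minus: "keys (- p) = keys (p :: 'e \<Rightarrow>\<^sub>0 'a::ab_group_add)"
  by (auto simp: in_keys_iff)

lemma (in csubring) polys_csubring: "csubring (polys C V)"
proof
  show "0 \<in> polys C V" "1 \<in> polys C V"
    by (auto simp: polys_def lookup_one when_def)
  fix p q assume p: "p \<in> polys C V" and q: "q \<in> polys C V"
  show "p + q \<in> polys C V"
    using p q by (auto simp: polys_def lookup_add) (metis Poly_Mapping.keys_add UnE subsetD)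
  show "- p \<in> polys C V"
    using p by (auto simp: polys_def keys_minus)
  show "p * q \<in> polys C V"
  proof -
    have "lookup (p * q) e \<in> C" for e
      unfolding mult_eq_sum_single[of p q] lookup_sum
      using p q by (intro sum) (auto simp: polys_def lookup_single when_def)
    moreover have "keys e \<subseteq> V" if e: "e \<in> keys (p * q)" for e
    proof -
      obtain a b where "e = a + b" "a \<in> keys p" "b \<in> keys q"
        using subsetD[OF Poly_Mapping.keys_mult e] by auto
      then show ?thesis using p q by (simp add: polys_def keys_add_nat)
    qed
    ultimately show ?thesis by (simp add: polys_def)
  qed
qed

definition mons :: "nat set \<Rightarrow> nat \<Rightarrow> (nat \<Rightarrow>\<^sub>0 nat) set" where
  "mons V n = {e. keys e \<subseteq> V \<and> total_deg e = n}"

lemma forms_polys: "forms C V n \<subseteq> polys C V"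
  by (auto simp: forms_def)

lemma forms_lookup: "p \<in> forms C V n \<longleftrightarrow> (\<forall>e. lookup p e \<in> C) \<and> keys p \<subseteq> mons V n"
  by (auto simp: forms_def polys_def mons_def)

lemma monomial_form: "0 \<in> C \<Longrightarrow> 1 \<in> C \<Longrightarrow> e \<in> mons V n \<Longrightarrow> monomial e \<in> forms C V n"
  by (auto simp: forms_lookup monomial_def lookup_single when_def)

lemma monomial_add: "monomial (a + b) = monomial a * monomial b"
  by (simp add: monomial_def mult_single)

lemma mons_single: "x \<in> V \<Longrightarrow> single x 1 \<in> mons V 1"
  by (simp add: mons_def)

lemma var_form: "0 \<in> C \<Longrightarrow> 1 \<in> C \<Longrightarrow> x \<in> V \<Longrightarrow> var x \<in> forms C V 1"
  unfolding var_def by (rule monomial_form[OF _ _ mons_single])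

lemma mons_add: "a \<in> mons V i \<Longrightarrow> b \<in> mons V j \<Longrightarrow> a + b \<in> mons V (i + j)"
  by (simp add: mons_def keys_add_nat total_deg_add)

lemma mons_Suc:
  assumes "e \<in> mons V (Suc n)"
  obtains x e' where "x \<in> V" "e' \<in> mons V n" "e = single x 1 + e'"
proof -
  have "e \<noteq> 0" using assms by (auto simp: mons_def)
  then obtain x where x: "x \<in> keys e"
    by (metis Poly_Mapping.keys_eq_empty all_not_in_conv)
  define e' where "e' = e - single x 1"
  have e: "e = single x 1 + e'"
    by (rule poly_mapping_eqI) (use x in \<open>auto simp: e'_def lookup_add lookup_minus lookup_single when_def in_keys_iff\<close>)
  have "keys e' \<subseteq> V" using assms by (auto simp: e mons_def keys_add_nat)
  moreover have "total_deg e' = n" using assms by (simp add: e mons_def total_deg_add)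
  ultimately show ?thesis using x e assms that[of x e'] by (auto simp: mons_def)
qed

lemma mons_split:
  assumes "e \<in> mons V (i + j)"
  obtains a b where "a \<in> mons V i" "b \<in> mons V j" "e = a + b"
  using assms
proof (induction i arbitrary: e thesis)
  case 0
  show ?case by (rule 0(1)[of 0 e]) (use 0(2) in \<open>auto simp: mons_def\<close>)
next
  case (Suc i)
  obtain x e' where x: "x \<in> V" "e' \<in> mons V (i + j)" "e = single x 1 + e'"
    using mons_Suc[of e V "i + j"] Suc.prems(2) by auto
  obtain a b where "a \<in> mons V i" "b \<in> mons V j" "e' = a + b"
    using Suc.IH[OF _ x(2)] by blast
  then show ?case using Suc.prems(1)[of "single x 1 + a" b] mons_add[OF mons_single[OF x(1)]] x(3)
    by (auto simp: add.assoc)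
qed

text \<open>Exponent vectors correspond to lists of length \<open>m\<close> with sum
  \<open>n\<close>, which are counted by stars and bars.\<close>

lemma card_mons:
  assumes "1 \<le> m"
  shows "finite (mons {..<m} n)" "card (mons {..<m} n) = (n + m - 1) choose n"
proof -
  let ?L = "{l :: nat list. length l = m \<and> sum_list l = n}"
  let ?f = "\<lambda>e. map (lookup e) [0..<m]"
  have deg: "total_deg e = (\<Sum>x<m. lookup e x)" if "keys e \<subseteq> {..<m}" for e
    using total_deg_superset[of "{..<m}" e] that by simp
  have bij: "bij_betw ?f (mons {..<m} n) ?L"
  proof (rule bij_betwI[of _ _ _ "\<lambda>l. \<Sum>x<m. single x (l ! x)"])
    show "?f \<in> mons {..<m} n \<rightarrow> ?L"
      using deg by (auto simp: mons_def interv_sum_list_conv_sum_set_nat atLeast0LessThan)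
    have lk: "lookup (\<Sum>x<m. single x (l x)) y = (if y < m then l y else 0)" for l :: "nat \<Rightarrow> nat" and y
      by (auto simp: lookup_sum lookup_single when_def)
    show "(\<lambda>l. \<Sum>x<m. single x (l ! x)) \<in> ?L \<rightarrow> mons {..<m} n"
    proof
      fix l assume l: "l \<in> ?L"
      have k: "keys (\<Sum>x<m. single x (l ! x)) \<subseteq> {..<m}"
        by (auto simp: in_keys_iff lk split: if_splits)
      have "total_deg (\<Sum>x<m. single x (l ! x)) = (\<Sum>x<m. l ! x)"
        by (subst deg[OF k]) (simp add: lk)
      also have "\<dots> = n" using l by (auto simp: sum_list_sum_nth atLeast0LessThan)
      finally show "(\<Sum>x<m. single x (l ! x)) \<in> mons {..<m} n" using k by (simp add: mons_def)
    qed
    show "(\<Sum>x<m. single x (?f e ! x)) = e" if "e \<in> mons {..<m} n" for e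
      by (rule poly_mapping_eqI) (use that in \<open>auto simp: lk mons_def in_keys_iff\<close>)
    show "?f (\<Sum>x<m. single x (l ! x)) = l" if "l \<in> ?L" for l
      using that lk[of "(!) l"] by (auto intro!: nth_equalityI)
  qed
  have "card ?L = (n + m - 1) choose n" by (rule card_length_sum_list)
  then show "card (mons {..<m} n) = (n + m - 1) choose n" using bij_betw_same_card[OF bij] by simp
  \<comment> \<open>Since \<open>1 \<le> m\<close>, the binomial coefficient is positive, and a set
    of positive cardinality is finite.\<close>
  then show "finite (mons {..<m} n)"
    by (intro card_ge_0_finite) (use assms in simp)
qed

context csubring begin

lemma forms_zero [simp]: "0 \<in> forms C V n"
  by (simp add: forms_lookup)

lemma forms_add: "p \<in> forms C V n \<Longrightarrow> q \<in> forms C V n \<Longrightarrow> p + q \<in> forms C V n"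
  using Poly_Mapping.keys_add[of p q] by (auto simp: forms_lookup lookup_add)

lemma forms_sum: "(\<And>i. i \<in> A \<Longrightarrow> f i \<in> forms C V n) \<Longrightarrow> sum f A \<in> forms C V n"
  by (induction A rule: infinite_finite_induct) (auto intro: forms_add)

lemma forms_mult:
  assumes "p \<in> forms C V i" "q \<in> forms C V j"
  shows "p * q \<in> forms C V (i + j)"
proof -
  have "p * q \<in> polys C V"
    using assms forms_polys csubring.mult[OF polys_csubring] by blast
  moreover have "total_deg e = i + j" if "e \<in> keys (p * q)" for e
    using Poly_Mapping.keys_mult[of p q] that assms by (auto simp: forms_def total_deg_add)
  ultimately show ?thesis by (simp add: forms_def)
qed

lemma const_form: "c \<in> C \<Longrightarrow> single 0 c \<in> forms C V 0"
  by (auto simp: forms_lookup mons_def lookup_single when_def)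

lemma const_poly: "c \<in> C \<Longrightarrow> single 0 c \<in> polys C V"
  using const_form forms_polys by blast

lemma forms_scale: "c \<in> C \<Longrightarrow> p \<in> forms C V n \<Longrightarrow> single 0 c * p \<in> forms C V n"
  using forms_mult[OF const_form, of c p V n] by simp

end

lemma form_eq_sum_monomials:
  "p = (\<Sum>e\<in>keys p. single 0 (lookup p e) * monomial e)" for p :: "'a::comm_ring_1 mpol"
  by (simp add: monomial_def mult_single sum_single_lookup)

text \<open>The homogeneous component of degree \<open>n\<close>.\<close>

definition hc :: "nat \<Rightarrow> 'a::comm_ring_1 mpol \<Rightarrow> 'a mpol" where
  "hc n p = Poly_Mapping.mapp (\<lambda>e c. c when total_deg e = n) p"

lemma lookup_hc: "lookup (hc n p) e = (lookup p e when total_deg e = n)"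
  by (auto simp: hc_def lookup_mapp when_def in_keys_iff)

lemma keys_hc: "keys (hc n p) = {e \<in> keys p. total_deg e = n}"
  by (auto simp: in_keys_iff lookup_hc)

lemma hc_zero [simp]: "hc n 0 = 0"
  by (rule poly_mapping_eqI) (simp add: lookup_hc)

lemma hc_add: "hc n (p + q) = hc n p + hc n q"
  by (rule poly_mapping_eqI) (simp add: lookup_hc lookup_add when_def)

lemma hc_sum: "hc n (sum f A) = (\<Sum>i\<in>A. hc n (f i))"
  by (induction A rule: infinite_finite_induct) (simp_all add: hc_add)

lemma hc_form: "p \<in> forms C V k \<Longrightarrow> hc n p = (if n = k then p else 0)"
  by (intro poly_mapping_eqI) (auto simp: lookup_hc when_def forms_lookup mons_def in_keys_iff)

lemma (in csubring) hc_in_forms: "p \<in> polys C V \<Longrightarrow> hc n p \<in> forms C V n"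
  by (auto simp: forms_lookup lookup_hc keys_hc when_def polys_def mons_def)

lemma hc_in_forms_UNIV: "hc n p \<in> forms UNIV UNIV n"
  by (auto simp: forms_lookup keys_hc mons_def)

text \<open>The sum of the degrees of all terms bounds each of them. The claim holds for every
  larger cut-off so that it can be combined with a second bound by taking a maximum.\<close>

lemma sum_hc: "\<exists>N. \<forall>M\<ge>N. p = (\<Sum>n\<le>M. hc n p)"
proof (intro exI allI impI)
  fix M assume M: "(\<Sum>e\<in>keys p. total_deg e) \<le> M"
  have deg: "total_deg e \<le> M" if "e \<in> keys p" for e
    using member_le_sum[OF that, of total_deg] M by simp
  show "p = (\<Sum>n\<le>M. hc n p)"
    by (rule poly_mapping_eqI)
      (use deg in \<open>fastforce simp: lookup_sum lookup_hc when_def in_keys_iff\<close>)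
qed

lemma UNIV_csubring: "csubring UNIV"
  by unfold_locales auto

lemma hc_mult_form:
  assumes y: "y \<in> forms C V \<delta>"
  shows "hc n (y * g) = (if \<delta> \<le> n then y * hc (n - \<delta>) g else 0)"
proof -
  obtain N where N: "\<And>M. M \<ge> N \<Longrightarrow> g = (\<Sum>j\<le>M. hc j g)" using sum_hc by blast
  have y': "y \<in> forms UNIV UNIV \<delta>" using y by (auto simp: forms_lookup mons_def)
  have f: "y * hc j g \<in> forms UNIV UNIV (\<delta> + j)" for j
    by (rule csubring.forms_mult[OF UNIV_csubring y' hc_in_forms_UNIV])
  have "y * g = (\<Sum>j\<le>max N n. y * hc j g)"
    by (subst N[of "max N n"]) (simp_all add: sum_distrib_left)
  then have "hc n (y * g) = (\<Sum>j\<le>max N n. if n = \<delta> + j then y * hc j g else 0)"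
    by (simp add: hc_sum hc_form[OF f])
  also have "\<dots> = (if \<delta> \<le> n then y * hc (n - \<delta>) g else 0)"
  proof (cases "\<delta> \<le> n")
    case True
    then have "(\<Sum>j\<le>max N n. if n = \<delta> + j then y * hc j g else 0)
        = (\<Sum>j\<in>{..max N n}. if j = n - \<delta> then y * hc j g else 0)"
      by (intro sum.cong) auto
    also have "\<dots> = y * hc (n - \<delta>) g" by (subst sum.delta) auto
    finally show ?thesis using True by simp
  next
    case False
    then show ?thesis by (auto intro!: sum.neutral)
  qed
  finally show ?thesis .
qed

lemma hc_mult: "hc n (p * q) = (\<Sum>i\<le>n. hc i p * hc (n - i) q)"
proof -
  obtain N where N: "\<And>M. M \<ge> N \<Longrightarrow> p = (\<Sum>j\<le>M. hc j p)" using sum_hc by blast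
  have "p * q = (\<Sum>j\<le>max N n. hc j p * q)"
    by (subst N[of "max N n"]) (simp_all add: sum_distrib_right)
  then have "hc n (p * q) = (\<Sum>j\<le>max N n. if j \<le> n then hc j p * hc (n - j) q else 0)"
    by (simp add: hc_sum hc_mult_form[OF hc_in_forms_UNIV])
  also have "\<dots> = (\<Sum>j\<le>n. hc j p * hc (n - j) q)"
    by (rule sum.mono_neutral_cong_right) auto
  finally show ?thesis .
qed

text \<open>Homogeneity without reference to generators. In this form it passes directly to unions
  of chains and to components of relations.\<close>

definition hc_closed :: "'a::comm_ring_1 mpol set \<Rightarrow> bool" where
  "hc_closed J \<longleftrightarrow> (\<forall>p\<in>J. \<forall>n. hc n p \<in> J)"

locale poly_csubring = csubring C for C :: "'a::comm_ring_1 set" +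
  fixes V :: "nat set"
begin

sublocale R: csubring "polys C V" by (rule polys_csubring)

lemma form_poly: "p \<in> forms C V n \<Longrightarrow> p \<in> polys C V"
  using forms_polys by blast

lemma hc_poly: "p \<in> polys C V \<Longrightarrow> hc n p \<in> polys C V"
  using hc_in_forms form_poly by blast

text \<open>A form is a combination of monomials of its degree, so an inclusion of a whole graded
  piece becomes finitely many memberships.\<close>

lemma forms_subset_iff:
  assumes "R.is_ideal J"
  shows "forms C V n \<subseteq> J \<longleftrightarrow> (\<forall>e\<in>mons V n. monomial e \<in> J)"
proof
  assume *: "\<forall>e\<in>mons V n. monomial e \<in> J"
  show "forms C V n \<subseteq> J"
  proof
    fix p assume p: "p \<in> forms C V n"
    have "(\<Sum>e\<in>keys p. single 0 (lookup p e) * monomial e) \<in> J"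
      using p * by (intro R.ideal_sum[OF assms] R.ideal_mult[OF assms] const_poly) (auto simp: forms_lookup)
    then show "p \<in> J" using form_eq_sum_monomials[of p] by simp
  qed
qed (meson monomial_form one subsetD zero)

text \<open>A monomial of higher degree is a multiple of one of degree \<open>n\<close>. Hence one
  degree suffices to certify "for all large degrees".\<close>

lemma forms_subset_add:
  assumes J: "R.is_ideal J" and n: "forms C V n \<subseteq> J" "n \<le> k"
  shows "forms C V k \<subseteq> J"
  unfolding forms_subset_iff[OF J]
proof
  fix e assume "e \<in> mons V k"
  then obtain a b where ab: "a \<in> mons V (k - n)" "b \<in> mons V n" "e = a + b"
    using n(2) mons_split[of e V "k - n" n] by auto
  have "monomial a \<in> polys C V" using ab(1) by (intro form_poly[OF monomial_form]) auto
  moreover have "monomial b \<in> J" using ab(2) n(1) forms_subset_iff[OF J] by blast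
  ultimately show "monomial e \<in> J"
    unfolding ab(3) monomial_add by (rule R.ideal_mult[OF J])
qed

text \<open>The polynomials all of whose components lie in the generated ideal form an ideal, and it
  contains \<open>T\<close>.\<close>

lemma hc_closed_Gen:
  assumes T: "T \<subseteq> polys C V" and "\<And>t n. t \<in> T \<Longrightarrow> hc n t \<in> R.Gen T"
  shows "hc_closed (R.Gen T)"
proof -
  let ?J = "{p \<in> polys C V. \<forall>n. hc n p \<in> R.Gen T}"
  have G: "R.is_ideal (R.Gen T)" by (rule R.Gen_ideal[OF T])
  have "R.is_ideal ?J"
    unfolding R.ideal_iff
    by (auto simp: hc_add hc_mult R.ideal_zero[OF G] intro!: R.ideal_add[OF G] R.ideal_sum[OF G]
        R.ideal_mult[OF G] hc_poly)
  moreover have "T \<subseteq> ?J" using assms by auto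
  ultimately have "R.Gen T \<subseteq> ?J" by (rule R.Gen_minimal)
  then show ?thesis by (auto simp: hc_closed_def)
qed

lemma hc_closed_Gen_forms:
  assumes T: "T \<subseteq> polys C V" and "\<And>t. t \<in> T \<Longrightarrow> (\<exists>n. t \<in> forms C V n) \<or> (\<forall>n. hc n t \<in> R.Gen T)"
  shows "hc_closed (R.Gen T)"
proof (rule hc_closed_Gen[OF T])
  fix t n assume t: "t \<in> T"
  show "hc n t \<in> R.Gen T"
    using assms(2)[OF t] R.Gen_self[OF T] t R.ideal_zero[OF R.Gen_ideal[OF T]]
    by (auto simp: hc_form)
qed

lemma hc_closed_Gen_Un:
  assumes "R.is_ideal H" "hc_closed H" "\<And>t. t \<in> T \<Longrightarrow> \<exists>n. t \<in> forms C V n"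
  shows "hc_closed (R.Gen (T \<union> H))"
proof (rule hc_closed_Gen_forms)
  show sub: "T \<union> H \<subseteq> polys C V" using assms(3) form_poly R.ideal_sub[OF assms(1)] by blast
  fix t assume "t \<in> T \<union> H"
  then show "(\<exists>n. t \<in> forms C V n) \<or> (\<forall>n. hc n t \<in> R.Gen (T \<union> H))"
    using assms(2,3) R.Gen_self[OF sub] by (auto simp: hc_closed_def)
qed

lemma homogeneous_ideal_hc_closed:
  assumes "homogeneous_ideal (poly_ring C V) (forms C V) J"
  shows "hc_closed J"
proof -
  let ?T = "J \<inter> (\<Union>n. forms C V n)"
  have "J = R.Gen ?T" using assms by (simp add: homogeneous_ideal_def)
  moreover have "hc_closed (R.Gen ?T)"
    by (rule hc_closed_Gen_forms) (auto intro: form_poly)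
  ultimately show ?thesis by simp
qed

text \<open>Take the component of degree \<open>n\<close> of any representation. The case
  distinction keeps natural subtraction honest: a generator of degree above \<open>n\<close>
  contributes nothing.\<close>

lemma Gen_form_decomp:
  fixes s :: nat
  assumes y: "\<And>i. i < s \<Longrightarrow> y i \<in> forms C V (\<delta> i)"
    and H: "R.is_ideal H" "hc_closed H"
    and p: "p \<in> R.Gen (y ` {..<s} \<union> H)" "p \<in> forms C V n"
  obtains g h where "\<And>i. i < s \<Longrightarrow> g i \<in> (if \<delta> i \<le> n then forms C V (n - \<delta> i) else {0})"
    "h \<in> H" "h \<in> forms C V n" "p = (\<Sum>i<s. g i * y i) + h"
proof -
  have "R.Gen (y ` {..<s} \<union> H) = {(\<Sum>i<s. g i * y i) + h | g h. (\<forall>i<s. g i \<in> polys C V) \<and> h \<in> H}"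
    using y form_poly by (intro R.Gen_family H(1)) blast
  then obtain g h where gh: "p = (\<Sum>i<s. g i * y i) + h" "\<And>i. i < s \<Longrightarrow> g i \<in> polys C V" "h \<in> H"
    using p(1) by auto
  have "p = hc n p" using hc_form[OF p(2)] by simp
  also have "\<dots> = (\<Sum>i<s. hc n (y i * g i)) + hc n h"
    by (simp add: gh(1) hc_add hc_sum mult.commute)
  also have "\<dots> = (\<Sum>i<s. (if \<delta> i \<le> n then hc (n - \<delta> i) (g i) else 0) * y i) + hc n h"
  proof -
    have "hc n (y i * g i) = (if \<delta> i \<le> n then hc (n - \<delta> i) (g i) else 0) * y i" if "i < s" for i
      unfolding hc_mult_form[OF y[OF that]] by (simp add: mult.commute)
    then show ?thesis by simp
  qed
  finally have eq: "p = (\<Sum>i<s. (if \<delta> i \<le> n then hc (n - \<delta> i) (g i) else 0) * y i) + hc n h" .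
  have hp: "h \<in> polys C V" using R.ideal_sub[OF H(1)] gh(3) by blast
  show thesis
  proof (rule that[OF _ _ _ eq])
    show "hc n h \<in> H" using H(2) gh(3) by (simp add: hc_closed_def)
  qed (auto simp: hc_in_forms gh(2) hp)
qed

text \<open>If neither factor lies in \<open>J\<close>, let \<open>i0\<close> and \<open>j0\<close>
  be the lowest degrees whose components are outside \<open>J\<close>. The component of the product
  in degree \<open>i0 + j0\<close> is the product of these two components plus terms that have a
  factor in \<open>J\<close>, which contradicts the assumption on forms.\<close>

lemma mult_mem_prime_of_forms:
  assumes J: "R.is_ideal J" "hc_closed J"
    and "\<And>i j a b. a \<in> forms C V i \<Longrightarrow> b \<in> forms C V j \<Longrightarrow> a * b \<in> J \<Longrightarrow> a \<in> J \<or> b \<in> J"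
    and ab: "a \<in> polys C V" "b \<in> polys C V" "a * b \<in> J"
  shows "a \<in> J \<or> b \<in> J"
proof (rule ccontr)
  assume not: "\<not> (a \<in> J \<or> b \<in> J)"
  have ex: "\<exists>i. hc i c \<notin> J" if "c \<notin> J" for c
  proof (rule ccontr)
    assume "\<not> ?thesis"
    moreover obtain N where "c = (\<Sum>n\<le>N. hc n c)" using sum_hc[of c] by blast
    ultimately show False using R.ideal_sum[OF J(1), of "{..N}" "\<lambda>n. hc n c"] that by auto
  qed
  define i0 where "i0 = (LEAST i. hc i a \<notin> J)"
  define j0 where "j0 = (LEAST i. hc i b \<notin> J)"
  have i0: "hc i0 a \<notin> J"
    unfolding i0_def using not by (intro LeastI_ex[of "\<lambda>i. hc i a \<notin> J"] ex) blast
  have i0_less: "hc i a \<in> J" if "i < i0" for i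
    using not_less_Least that unfolding i0_def by blast
  have j0: "hc j0 b \<notin> J"
    unfolding j0_def using not by (intro LeastI_ex[of "\<lambda>i. hc i b \<notin> J"] ex) blast
  have j0_less: "hc i b \<in> J" if "i < j0" for i
    using not_less_Least that unfolding j0_def by blast
  have "hc (i0 + j0) (a * b) \<in> J" using J(2) ab(3) by (simp add: hc_closed_def)
  moreover have "hc (i0 + j0) (a * b)
      = hc i0 a * hc j0 b + (\<Sum>i\<in>{..i0+j0}-{i0}. hc i a * hc (i0 + j0 - i) b)"
    unfolding hc_mult by (subst sum.remove[of _ i0]) auto
  moreover have "(\<Sum>i\<in>{..i0+j0}-{i0}. hc i a * hc (i0 + j0 - i) b) \<in> J"
  proof (rule R.ideal_sum[OF J(1)])
    fix i assume i: "i \<in> {..i0+j0}-{i0}"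
    show "hc i a * hc (i0 + j0 - i) b \<in> J"
    proof (cases "i < i0")
      case True
      have "hc (i0 + j0 - i) b * hc i a \<in> J"
        using R.ideal_mult[OF J(1) hc_poly[OF ab(2)] i0_less[OF True]] .
      then show ?thesis by (simp add: mult.commute)
    next
      case False
      then have "i0 + j0 - i < j0" using i by auto
      then show ?thesis using R.ideal_mult[OF J(1) hc_poly[OF ab(1)] j0_less] by blast
    qed
  qed
  ultimately have "hc i0 a * hc j0 b \<in> J" by (simp add: R.ideal_add_cancel[OF J(1)])
  then show False using assms(3)[OF hc_in_forms[OF ab(1)] hc_in_forms[OF ab(2)]] i0 j0 by blast
qed

end

lemma (in csubring) Gen_familyI:
  fixes s :: nat
  assumes y: "\<And>i. i < s \<Longrightarrow> y i \<in> C" and H: "is_ideal H"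
    and gh: "\<And>i. i < s \<Longrightarrow> g i \<in> C" "h \<in> H"
  shows "(\<Sum>i<s. g i * y i) + h \<in> Gen (y ` {..<s} \<union> H)"
  by (subst Gen_family[OF _ H]) (use y gh in blast)+

lemma (in csubring) Gen_familyD:
  fixes s :: nat
  assumes y: "\<And>i. i < s \<Longrightarrow> y i \<in> C" and H: "is_ideal H" and x: "x \<in> Gen (y ` {..<s} \<union> H)"
  shows "\<exists>h\<in>H. \<exists>g. (\<forall>i<s. g i \<in> C) \<and> x = (\<Sum>i<s. g i * y i) + h"
proof -
  have eq: "Gen (y ` {..<s} \<union> H) = {(\<Sum>i<s. g i * y i) + h | g h. (\<forall>i<s. g i \<in> C) \<and> h \<in> H}"
    by (rule Gen_family[OF y H])
  show ?thesis using x unfolding eq by blast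
qed

section \<open>Cramer's rule and generic spanning\<close>

lemma (in csubring) det_mem:
  assumes "A \<in> carrier_mat n n" "\<And>i j. i < n \<Longrightarrow> j < n \<Longrightarrow> A $$ (i, j) \<in> C"
  shows "det A \<in> C"
  unfolding det_def using assms uminus[OF one]
  by (auto simp: sign_def permutes_in_image intro!: sum mult prod)

lemma (in csubring) adj_mat_mem:
  assumes A: "A \<in> carrier_mat n n" "\<And>i j. i < n \<Longrightarrow> j < n \<Longrightarrow> A $$ (i, j) \<in> C"
    and ij: "i < n" "j < n"
  shows "adj_mat A $$ (i, j) \<in> C"
proof -
  have "det (mat_delete A j i) \<in> C"
    by (rule det_mem[of _ "n - 1"]) (use A ij in \<open>auto simp: mat_delete_def\<close>)
  moreover have "(- 1) ^ (j + i) \<in> C" using power[OF uminus[OF one]] .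
  ultimately show ?thesis
    using A(1) ij by (auto simp: adj_mat_def cofactor_def)
qed

text \<open>Here \<open>q\<close> is the determinant and \<open>Y\<close> the adjugate, so no
  division takes place and both stay in \<open>C\<close>. The hypothesis says that
  \<open>\<phi>\<close> sends the matrix to the identity, hence \<open>\<phi> q = 1\<close>; in
  particular \<open>q\<close> is nonzero as soon as \<open>1\<close> is nonzero in the
  target.\<close>

lemma (in csubring) cramer_specialization:
  fixes N :: "'e \<Rightarrow> 'e \<Rightarrow> 'a" and \<phi> :: "'a \<Rightarrow> 'b::comm_ring_1"
  assumes \<phi>: "comm_ring_hom \<phi>" and E: "finite E"
    and N: "\<And>i j. i \<in> E \<Longrightarrow> j \<in> E \<Longrightarrow> N i j \<in> C"
    and \<phi>N: "\<And>i j. i \<in> E \<Longrightarrow> j \<in> E \<Longrightarrow> \<phi> (N i j) = (if i = j then 1 else 0)"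
  obtains q Y where "q \<in> C" "\<phi> q = 1" "\<And>i j. i \<in> E \<Longrightarrow> j \<in> E \<Longrightarrow> Y i j \<in> C"
    "\<And>i k. i \<in> E \<Longrightarrow> k \<in> E \<Longrightarrow> (\<Sum>j\<in>E. Y i j * N j k) = (if i = k then q else 0)"
proof -
  interpret \<phi>: comm_ring_hom \<phi> by fact
  \<comment> \<open>Matrices are indexed by numbers, whereas \<open>E\<close> will be a set of
    monomials; \<open>f\<close> and \<open>g\<close> translate between the two.\<close>
  define n where "n = card E"
  obtain f where f: "bij_betw f {0..<n} E"
    using ex_bij_betw_nat_finite[OF E] n_def by blast
  define g where "g = the_inv_into {0..<n} f"
  have g: "g e < n" "f (g e) = e" if "e \<in> E" for e
    using that f_the_inv_into_f_bij_betw[OF f] bij_betwE[OF bij_betw_the_inv_into[OF f]]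
    by (auto simp: g_def)
  have fE: "f i \<in> E" if "i < n" for i using f that by (auto simp: bij_betw_def)
  have inj: "f i = f j \<longleftrightarrow> i = j" if "i < n" "j < n" for i j
    using f that by (auto simp: bij_betw_def inj_on_def)
  have gf: "g (f j) = j" if "j < n" for j
    using inj[of "g (f j)" j] g[OF fE[OF that]] that by simp
  define A where "A = mat n n (\<lambda>(i, j). N (f i) (f j))"
  have A: "A \<in> carrier_mat n n" by (simp add: A_def)
  have AC: "A $$ (i, j) \<in> C" if "i < n" "j < n" for i j
    using that N fE by (simp add: A_def)
  have "map_mat \<phi> A = 1\<^sub>m n"
    by (rule eq_matI) (auto simp: A_def \<phi>N fE inj)
  then have det: "\<phi> (det A) = 1" using \<phi>.hom_det[of A] by simp
  show thesis
  proof (rule that[of "det A" "\<lambda>i j. adj_mat A $$ (g i, g j)"])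
    show "det A \<in> C" by (rule det_mem[OF A AC])
    show "adj_mat A $$ (g i, g j) \<in> C" if "i \<in> E" "j \<in> E" for i j
      by (rule adj_mat_mem[OF A AC]) (use g that in auto)
    fix i k assume ik: "i \<in> E" "k \<in> E"
    have "(\<Sum>j\<in>E. adj_mat A $$ (g i, g j) * N j k) = (\<Sum>j\<in>{0..<n}. adj_mat A $$ (g i, g (f j)) * N (f j) k)"
      by (rule sum.reindex_bij_betw[OF f, symmetric])
    also have "\<dots> = (\<Sum>j\<in>{0..<n}. adj_mat A $$ (g i, j) * A $$ (j, g k))"
      using g ik gf by (intro sum.cong) (auto simp: A_def)
    also have "\<dots> = (adj_mat A * A) $$ (g i, g k)"
      using A adj_mat(1)[OF A] g ik by (auto simp: scalar_prod_def intro!: sum.cong)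
    also have "\<dots> = (if i = k then det A else 0)"
      using g ik by (subst adj_mat(3)[OF A]) (auto, metis)
    finally show "(\<Sum>j\<in>E. adj_mat A $$ (g i, g j) * N j k) = (if i = k then det A else 0)" .
  qed (rule det)
qed

lemma lookup_const_mult: "lookup (single 0 c * p) e = c * lookup p (e :: nat \<Rightarrow>\<^sub>0 nat)"
  for c :: "'a::comm_ring_1"
  by (simp add: mult_map_scale_conv_mult[symmetric] Poly_Mapping.map.rep_eq when_def)

lemma (in poly_csubring) Gen_linear_decomp:
  fixes s :: nat
  assumes y: "\<And>i. i < s \<Longrightarrow> y i \<in> forms C V 1"
    and H: "R.is_ideal H" "hc_closed H"
    and p: "p \<in> R.Gen (y ` {..<s} \<union> H)" "p \<in> forms C V n"
  shows "\<exists>g h. (\<forall>i<s. g i \<in> (if 1 \<le> n then forms C V (n - 1) else {0})) \<and>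
    h \<in> H \<and> h \<in> forms C V n \<and> p = (\<Sum>i<s. g i * y i) + h"
proof -
  show ?thesis
  proof (rule Gen_form_decomp[where \<delta> = "\<lambda>_. 1", OF y H p])
    fix g h
    assume "\<And>i. i < s \<Longrightarrow> g i \<in> (if 1 \<le> n then forms C V (n - 1) else {0})"
      and "h \<in> H" "h \<in> forms C V n" "p = (\<Sum>i<s. g i * y i) + h"
    then show ?thesis by (intro exI[of _ g] exI[of _ h]) simp
  qed
qed

lemma (in poly_csubring) Gen_linear_choice:
  fixes s :: nat
  assumes y: "\<And>i. i < s \<Longrightarrow> y i \<in> forms C V 1"
    and H: "R.is_ideal H" "hc_closed H"
    and n: "forms C V n \<subseteq> R.Gen (y ` {..<s} \<union> H)"
  obtains g h where "\<forall>e\<in>mons V n. (\<forall>i<s. g e i \<in> (if 1 \<le> n then forms C V (n - 1) else {0})) \<and>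
    h e \<in> H \<and> h e \<in> forms C V n \<and> monomial e = (\<Sum>i<s. g e i * y i) + h e"
proof -
  have "\<forall>e\<in>mons V n. \<exists>g h. (\<forall>i<s. g i \<in> (if 1 \<le> n then forms C V (n - 1) else {0})) \<and>
    h \<in> H \<and> h \<in> forms C V n \<and> monomial e = (\<Sum>i<s. g i * y i) + h"
  proof
    fix e assume "e \<in> mons V n"
    then have f: "monomial e \<in> forms C V n" by (intro monomial_form) auto
    show "\<exists>g h. (\<forall>i<s. g i \<in> (if 1 \<le> n then forms C V (n - 1) else {0})) \<and>
      h \<in> H \<and> h \<in> forms C V n \<and> monomial e = (\<Sum>i<s. g i * y i) + h"
      by (rule Gen_linear_decomp[OF y H subsetD[OF n f] f])
  qed
  from bchoice[OF this] obtain g where "\<forall>e\<in>mons V n. \<exists>h.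
    (\<forall>i<s. g e i \<in> (if 1 \<le> n then forms C V (n - 1) else {0})) \<and>
    h \<in> H \<and> h \<in> forms C V n \<and> monomial e = (\<Sum>i<s. g e i * y i) + h" ..
  from bchoice[OF this] show thesis using that by blast
qed

text \<open>Multiplying the elements \<open>w\<close> by \<open>Y\<close> produces \<open>q\<close>
  times each monomial, inside \<open>J\<close>; then \<open>r\<close> cancels \<open>q\<close>.
  Coefficients of \<open>w\<close> outside \<open>mons V n\<close> vanish, so the square matrix sees
  all of them. Used over k along a line of families and over k(u) for the generic forms.\<close>

lemma (in poly_csubring) monomial_mem_of_inverse:
  assumes J: "R.is_ideal J"
    and w: "\<And>e. e \<in> mons V n \<Longrightarrow> w e \<in> J" "\<And>e. e \<in> mons V n \<Longrightarrow> w e \<in> forms C V n"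
    and Y: "\<And>i j. i \<in> mons V n \<Longrightarrow> j \<in> mons V n \<Longrightarrow> Y i j \<in> C"
    and YN: "\<And>i k. i \<in> mons V n \<Longrightarrow> k \<in> mons V n \<Longrightarrow>
        (\<Sum>j\<in>mons V n. Y i j * lookup (w j) k) = (if i = k then q else 0)"
    and q: "r \<in> C" "r * q = 1"
  shows "forms C V n \<subseteq> J"
  unfolding forms_subset_iff[OF J]
proof
  fix e assume e: "e \<in> mons V n"
  let ?p = "\<Sum>j\<in>mons V n. single 0 (Y e j) * w j"
  have p: "?p \<in> J" using w Y e by (intro R.ideal_sum[OF J] R.ideal_mult[OF J] const_poly) auto
  have "?p = single 0 q * monomial e"
  proof (rule poly_mapping_eqI)
    fix k
    have lk: "lookup ?p k = (\<Sum>j\<in>mons V n. Y e j * lookup (w j) k)"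
      by (simp add: lookup_sum lookup_const_mult)
    show "lookup ?p k = lookup (single 0 q * monomial e) k"
    proof (cases "k \<in> mons V n")
      case True
      then show ?thesis unfolding lk using YN[OF e True]
        by (simp add: lookup_const_mult monomial_def lookup_single when_def)
    next
      case False
      then have "lookup (w j) k = 0" if "j \<in> mons V n" for j
        using w(2)[OF that] by (auto simp: forms_lookup in_keys_iff)
      then show ?thesis unfolding lk using False e
        by (auto simp: lookup_const_mult monomial_def lookup_single when_def)
    qed
  qed
  then have "single 0 q * monomial e \<in> J" using p by simp
  then have "single 0 r * (single 0 q * monomial e) \<in> J"
    by (rule R.ideal_mult[OF J const_poly[OF q(1)]])
  moreover have "single 0 r * (single 0 q * monomial e) = monomial e"
    by (simp add: monomial_def mult_single mult.assoc[symmetric] q(2))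
  ultimately show "monomial e \<in> J" by simp
qed

locale inf_field_poly =
  fixes ty :: "'k::field itself" and m :: nat
  assumes inf: "infinite (UNIV :: 'k set)" and m1: "1 \<le> m"
begin

sublocale poly_csubring "UNIV :: 'k set" "{..<m}"
  by (rule poly_csubring.intro) (rule UNIV_csubring)

abbreviation "RR \<equiv> polys (UNIV :: 'k set) {..<m}"
abbreviation "lforms \<equiv> forms (UNIV :: 'k set) {..<m}"

lemma lforms_family_poly: "(\<And>i. i < s \<Longrightarrow> y i \<in> lforms n) \<Longrightarrow> y ` {..<s::nat} \<subseteq> RR"
  using form_poly by blast

lemma Gen_family_ideal:
  assumes "\<And>i. i < (s::nat) \<Longrightarrow> y i \<in> lforms n" "R.is_ideal H"
  shows "R.is_ideal (R.Gen (y ` {..<s} \<union> H))"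
  using lforms_family_poly[OF assms(1)] R.ideal_sub[OF assms(2)] by (intro R.Gen_ideal) auto

text \<open>
  Along the line the coefficient matrix of the deformed relations is \<open>1 + \<tau>B\<close>, whose determinant is a
  polynomial in \<open>\<tau>\<close> with value \<open>1\<close> at \<open>0\<close>.
\<close>

lemma finite_bad_line:
  fixes s :: nat
  assumes y: "\<And>i. i < s \<Longrightarrow> y i \<in> lforms 1" and b: "\<And>i. i < s \<Longrightarrow> b i \<in> lforms 1"
    and H: "R.is_ideal H" "hc_closed H"
    and n: "lforms n \<subseteq> R.Gen (y ` {..<s} \<union> H)"
  shows "finite {\<tau>. \<not> lforms n \<subseteq> R.Gen ((\<lambda>i. y i + single 0 \<tau> * b i) ` {..<s} \<union> H)}"
proof -
  let ?E = "mons {..<m} n"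
  obtain g h where gh: "\<forall>e\<in>?E. (\<forall>i<s. g e i \<in> (if 1 \<le> n then lforms (n - 1) else {0})) \<and>
      h e \<in> H \<and> h e \<in> lforms n \<and> monomial e = (\<Sum>i<s. g e i * y i) + h e"
    by (rule Gen_linear_choice[OF y H n])
  have g: "g e i \<in> (if 1 \<le> n then lforms (n - 1) else {0})" if "e \<in> ?E" "i < s" for e i
    using gh that by blast
  have h: "h e \<in> H" and eq: "monomial e = (\<Sum>i<s. g e i * y i) + h e" if "e \<in> ?E" for e
    using gh that by blast+
  define c where "c e = (\<Sum>i<s. g e i * b i)" for e
  have c: "c e \<in> lforms n" if "e \<in> ?E" for e
    unfolding c_def
  proof (rule forms_sum)
    fix i assume "i \<in> {..<s}"
    then show "g e i * b i \<in> lforms n"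
      using g[OF that, of i] forms_mult[of "g e i" "{..<m}" "n - 1" "b i" 1] b[of i]
      by (auto split: if_splits)
  qed
  define w where "w \<tau> e = monomial e + single 0 \<tau> * c e" for \<tau> e
  define N where "N i j = [: if i = j then 1 else 0, lookup (c i) j :]" for i j
  have lw: "lookup (w \<tau> i) j = poly (N i j) \<tau>" for \<tau> i j
    by (simp add: w_def N_def lookup_add lookup_const_mult monomial_def lookup_single when_def)
  interpret P: csubring "UNIV :: 'k poly set" by (rule UNIV_csubring)
  have hom: "comm_ring_hom (\<lambda>p::'k poly. poly p 0)" by unfold_locales auto
  obtain q Y where q: "poly q 0 = 1"
    and Y: "\<And>i k. i \<in> ?E \<Longrightarrow> k \<in> ?E \<Longrightarrow> (\<Sum>j\<in>?E. Y i j * N j k) = (if i = k then q else 0)"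
    by (rule P.cramer_specialization[OF hom card_mons(1)[OF m1, of n], of N]) (auto simp: N_def)
  have "lforms n \<subseteq> R.Gen ((\<lambda>i. y i + single 0 \<tau> * b i) ` {..<s} \<union> H)" (is "_ \<subseteq> ?J")
    if \<tau>: "poly q \<tau> \<noteq> 0" for \<tau>
  proof -
    have yb: "y i + single 0 \<tau> * b i \<in> lforms 1" if "i < s" for i
      using y[OF that] b[OF that] by (intro forms_add forms_scale) auto
    have J: "R.is_ideal ?J"
      by (rule Gen_family_ideal[OF yb H(1)])
    show ?thesis
    proof (rule monomial_mem_of_inverse[OF J, where w = "w \<tau>" and q = "poly q \<tau>"
          and r = "inverse (poly q \<tau>)" and Y = "\<lambda>i j. poly (Y i j) \<tau>"])
      fix e assume e: "e \<in> ?E"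
      show "w \<tau> e \<in> lforms n"
        unfolding w_def using c e by (intro forms_add forms_scale monomial_form) auto
      have "w \<tau> e = (\<Sum>i<s. g e i * (y i + single 0 \<tau> * b i)) + h e"
        unfolding w_def c_def eq[OF e] by (simp add: sum_distrib_left distrib_left sum.distrib algebra_simps)
      also have "\<dots> \<in> ?J"
      proof (rule R.Gen_familyI[OF form_poly[OF yb] H(1)])
        fix i assume "i < s"
        then show "g e i \<in> RR" using g[OF e, of i] form_poly by (auto split: if_splits)
      qed (use h e in auto)
      finally show "w \<tau> e \<in> ?J" .
    next
      fix i k assume ik: "i \<in> ?E" "k \<in> ?E"
      have "(\<Sum>j\<in>?E. poly (Y i j) \<tau> * lookup (w \<tau> j) k) = poly (\<Sum>j\<in>?E. Y i j * N j k) \<tau>"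
        by (simp add: lw poly_sum)
      then show "(\<Sum>j\<in>?E. poly (Y i j) \<tau> * lookup (w \<tau> j) k) = (if i = k then poly q \<tau> else 0)"
        using Y[OF ik] by simp
    qed (use \<tau> in auto)
  qed
  then have "{\<tau>. \<not> lforms n \<subseteq> R.Gen ((\<lambda>i. y i + single 0 \<tau> * b i) ` {..<s} \<union> H)} \<subseteq> {\<tau>. poly q \<tau> = 0}"
    by auto
  moreover have "q \<noteq> 0" using q by auto
  ultimately show ?thesis using poly_roots_finite finite_subset by blast
qed

end

section \<open>Prime chains from the failure of generic reductions\<close>

lemma (in csubring) primeideal_iff:
  "is_prime J \<longleftrightarrow> is_ideal J \<and> J \<noteq> C \<and>
     (\<forall>a\<in>C. \<forall>b\<in>C. a * b \<in> J \<longrightarrow> a \<in> J \<or> b \<in> J)"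
proof
  assume "is_prime J"
  then interpret primeideal J "ring_on C" .
  show "is_ideal J \<and> J \<noteq> C \<and> (\<forall>a\<in>C. \<forall>b\<in>C. a * b \<in> J \<longrightarrow> a \<in> J \<or> b \<in> J)"
    using I_notcarr I_prime is_ideal by (auto simp: ring_on_def)
next
  assume "is_ideal J \<and> J \<noteq> C \<and> (\<forall>a\<in>C. \<forall>b\<in>C. a * b \<in> J \<longrightarrow> a \<in> J \<or> b \<in> J)"
  then show "is_prime J"
    by (intro primeidealI cring) (auto simp: ring_on_def)
qed

context inf_field_poly begin

lemma forms0_subset_iff:
  assumes "R.is_ideal J"
  shows "lforms 0 \<subseteq> J \<longleftrightarrow> 1 \<in> J"
proof -
  have "mons {..<m} 0 = {0}" by (auto simp: mons_def total_deg_eq_0_iff)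
  then show ?thesis by (simp add: forms_subset_iff[OF assms] monomial_def)
qed

text \<open>The polynomials with zero constant term form a prime ideal. It contains every proper
  homogeneous ideal, because the constant term of a member is a component of it, and a nonzero
  constant is a unit.\<close>

lemma ex_prime_over_homogeneous:
  assumes J: "R.is_ideal J" "hc_closed J" "1 \<notin> J"
  shows "\<exists>P. R.is_prime P \<and> J \<subseteq> P"
proof -
  let ?M = "{p \<in> RR. lookup p 0 = 0}"
  have mult0: "lookup (p * q) 0 = lookup p 0 * lookup q 0" for p q :: "'k mpol"
  proof -
    have c: "hc 0 r = single 0 (lookup r 0)" for r :: "'k mpol"
      by (rule poly_mapping_eqI) (auto simp: lookup_hc lookup_single when_def total_deg_eq_0_iff)
    have "hc 0 (p * q) = hc 0 p * hc 0 q" by (simp add: hc_mult)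
    then have "lookup (hc 0 (p * q)) 0 = lookup (hc 0 p * hc 0 q) 0" by simp
    then show ?thesis by (simp add: c mult_single)
  qed
  have "R.is_ideal ?M"
    unfolding R.ideal_iff by (auto simp: lookup_add mult0)
  moreover have "?M \<noteq> RR"
  proof -
    have "1 \<notin> ?M" by simp
    then show ?thesis using R.one by blast
  qed
  ultimately have "R.is_prime ?M"
    unfolding R.primeideal_iff by (auto simp: mult0)
  moreover have "J \<subseteq> ?M"
  proof
    fix p assume p: "p \<in> J"
    have "lookup p 0 = 0"
    proof (rule ccontr)
      assume nz: "lookup p 0 \<noteq> 0"
      have "hc 0 p = single 0 (lookup p 0)"
        by (rule poly_mapping_eqI) (auto simp: lookup_hc lookup_single when_def total_deg_eq_0_iff)
      then have "single 0 (lookup p 0) \<in> J" using J(2) p by (metis hc_closed_def)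
      then have "single 0 (inverse (lookup p 0)) * single 0 (lookup p 0) \<in> J"
        by (intro R.ideal_mult[OF J(1) const_poly]) auto
      then show False using J(3) nz by (simp add: mult_single)
    qed
    then show "p \<in> ?M" using R.ideal_sub[OF J(1)] p by auto
  qed
  ultimately show ?thesis by blast
qed

text \<open>Reordering the generators exhibits \<open>a\<close> as the only one added to
  \<open>(S, H)\<close>, so that members have the shape \<open>g * a + h\<close>.\<close>

lemma Gen_insert_Un:
  assumes "a \<in> RR" "H \<subseteq> RR" "S \<subseteq> RR"
  shows "R.Gen (S \<union> R.Gen (insert a H)) = R.Gen (insert a (R.Gen (S \<union> H)))"
proof
  have i: "insert a H \<subseteq> RR" "S \<union> H \<subseteq> RR" using assms by auto
  have g: "R.Gen (insert a H) \<subseteq> RR" "R.Gen (S \<union> H) \<subseteq> RR"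
    using R.ideal_sub R.Gen_ideal i by auto
  have s1: "insert a (R.Gen (S \<union> H)) \<subseteq> RR" and s2: "S \<union> R.Gen (insert a H) \<subseteq> RR"
    using g assms by auto
  note self = R.Gen_self[OF i(1)] R.Gen_self[OF i(2)] R.Gen_self[OF s1] R.Gen_self[OF s2]
  have "R.Gen (insert a H) \<subseteq> R.Gen (insert a (R.Gen (S \<union> H)))"
    by (rule R.Gen_mono[OF s1]) (use self in auto)
  then show "R.Gen (S \<union> R.Gen (insert a H)) \<subseteq> R.Gen (insert a (R.Gen (S \<union> H)))"
    by (intro R.Gen_mono[OF s1]) (use self in auto)
  have "R.Gen (S \<union> H) \<subseteq> R.Gen (S \<union> R.Gen (insert a H))"
    by (rule R.Gen_mono[OF s2]) (use self in auto)
  then show "R.Gen (insert a (R.Gen (S \<union> H))) \<subseteq> R.Gen (S \<union> R.Gen (insert a H))"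
    by (intro R.Gen_mono[OF s2]) (use self in auto)
qed

section \<open>Families of linear forms from a prescribed space\<close>

context
  fixes L :: "'k mpol set"
  assumes L: "L \<subseteq> lforms 1" "0 \<in> L" "\<And>y b \<tau>. y \<in> L \<Longrightarrow> b \<in> L \<Longrightarrow> y + single 0 \<tau> * b \<in> L"
begin

text \<open>Modulo \<open>J\<close>, some \<open>s\<close> members of \<open>L\<close> generate a
  reduction.\<close>

definition good :: "'k mpol set \<Rightarrow> nat \<Rightarrow> bool" where
  "good J s \<longleftrightarrow> (\<exists>y n. (\<forall>i<s. y i \<in> L) \<and> lforms n \<subseteq> R.Gen (y ` {..<s} \<union> J))"

text \<open>Indexed by the length of the prime chain to be produced: length \<open>Suc s\<close>
  needs the failure of \<open>s\<close> linear forms, and length 0 needs only a proper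
  ideal.\<close>

fun bad :: "'k mpol set \<Rightarrow> nat \<Rightarrow> bool" where
  "bad J 0 \<longleftrightarrow> 1 \<notin> J"
| "bad J (Suc s) \<longleftrightarrow> \<not> good J s"

lemma L_family: "\<forall>i<s. y i \<in> L \<Longrightarrow> i < s \<Longrightarrow> y i \<in> lforms 1"
  using L(1) by blast

lemma L_poly: "\<forall>i<(s::nat). y i \<in> L \<Longrightarrow> y ` {..<s} \<subseteq> RR"
  by (rule lforms_family_poly[of _ _ 1]) (rule L_family)

lemma good_of_subset:
  assumes P: "R.is_ideal P" and n: "lforms n \<subseteq> P"
  shows "good P s"
proof -
  have y: "\<forall>i<s. (\<lambda>_::nat. 0) i \<in> L" using L(2) by blast
  have "(\<lambda>_. 0) ` {..<s} \<union> P \<subseteq> RR" by (rule Un_least[OF L_poly[OF y] R.ideal_sub[OF P]])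
  then have "(\<lambda>_. 0) ` {..<s} \<union> P \<subseteq> R.Gen ((\<lambda>_. 0) ` {..<s} \<union> P)" by (rule R.Gen_self)
  then have "lforms n \<subseteq> R.Gen ((\<lambda>_. 0) ` {..<s} \<union> P)" using n by blast
  then show ?thesis unfolding good_def using y by (intro exI[of _ "\<lambda>_. 0"] exI[of _ n]) blast
qed

text \<open>The form \<open>y0\<close> becomes the last member of the family. Read contrapositively:
  if \<open>P\<close> fails for \<open>Suc s\<close>, then \<open>P\<close> together with one linear
  form of \<open>L\<close> fails for \<open>s\<close>.\<close>

lemma good_insert:
  assumes "good (R.Gen (insert y0 P)) s" "y0 \<in> L" "P \<subseteq> RR"
  shows "good P (Suc s)"
proof -
  obtain y n where y: "\<forall>i<s. y i \<in> L" "lforms n \<subseteq> R.Gen (y ` {..<s} \<union> R.Gen (insert y0 P))"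
    using assms(1) by (auto simp: good_def)
  let ?y = "y(s := y0)"
  have y': "\<forall>i<Suc s. ?y i \<in> L" using y(1) assms(2) by (auto simp: less_Suc_eq)
  have sub: "?y ` {..<Suc s} \<union> P \<subseteq> RR" using L_poly[OF y'] assms(3) by auto
  have "y ` {..<s} \<subseteq> ?y ` {..<Suc s}" by (auto simp: image_iff)
  moreover have "y0 \<in> ?y ` {..<Suc s}" by (auto simp: image_iff)
  ultimately have "R.Gen (y ` {..<s} \<union> R.Gen (insert y0 P)) \<subseteq> R.Gen (?y ` {..<Suc s} \<union> P)"
    using R.Gen_self[OF sub] R.Gen_mono[OF sub, of "insert y0 P"]
    by (intro R.Gen_mono[OF sub]) auto
  then show ?thesis using y(2) y' unfolding good_def by blast
qed

text \<open>A family on the pencil that works for both enlarged ideals writes each monomial of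
  degree \<open>n\<close> as a multiple of \<open>a\<close> and also as a multiple of
  \<open>b\<close>, modulo \<open>K = (z, P)\<close>. Multiplying two such expressions leaves only
  \<open>a * b\<close> and terms of \<open>K\<close>.\<close>

lemma good_of_two:
  assumes P: "R.is_ideal P" "hc_closed P"
    and a: "a \<in> lforms i" "good (R.Gen (insert a P)) s"
    and b: "b \<in> lforms j" "good (R.Gen (insert b P)) s"
    and ab: "a * b \<in> P"
  shows "good P s"
proof -
  note PR = R.ideal_sub[OF P(1)]
  have aR: "a \<in> RR" and bR: "b \<in> RR" using form_poly[OF a(1)] form_poly[OF b(1)] by auto
  have Ga: "R.is_ideal (R.Gen (insert a P))" "R.is_ideal (R.Gen (insert b P))"
    using aR bR PR by (auto intro!: R.Gen_ideal)
  have Gh: "hc_closed (R.Gen (insert a P))" "hc_closed (R.Gen (insert b P))"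
    using hc_closed_Gen_Un[OF P, of "{a}"] hc_closed_Gen_Un[OF P, of "{b}"] a(1) b(1) by auto
  obtain y n1 where y: "\<forall>i<s. y i \<in> L" "lforms n1 \<subseteq> R.Gen (y ` {..<s} \<union> R.Gen (insert a P))"
    using a(2) by (auto simp: good_def)
  obtain y' n2 where y': "\<forall>i<s. y' i \<in> L" "lforms n2 \<subseteq> R.Gen (y' ` {..<s} \<union> R.Gen (insert b P))"
    using b(2) by (auto simp: good_def)
  define n where "n = max n1 n2"
  have "ideal (R.Gen (y ` {..<s} \<union> R.Gen (insert a P))) (ring_on RR)"
    by (rule Gen_family_ideal[OF L_family[OF y(1)] Ga(1)])
  then have n1: "lforms n \<subseteq> R.Gen (y ` {..<s} \<union> R.Gen (insert a P))"
    by (rule forms_subset_add[OF _ y(2)]) (simp add: n_def)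
  have "ideal (R.Gen (y' ` {..<s} \<union> R.Gen (insert b P))) (ring_on RR)"
    by (rule Gen_family_ideal[OF L_family[OF y'(1)] Ga(2)])
  then have n2: "lforms n \<subseteq> R.Gen (y' ` {..<s} \<union> R.Gen (insert b P))"
    by (rule forms_subset_add[OF _ y'(2)]) (simp add: n_def)
  have neg: "- x \<in> L" if "x \<in> L" for x
    using L(3)[OF L(2) that, of "-1"] by (simp add: single_uminus)
  have dif: "x - z \<in> L" if "x \<in> L" "z \<in> L" for x z
    using L(3)[OF that(1) neg[OF that(2)], of 1] by simp
  define B1 where "B1 = {\<tau>. \<not> lforms n \<subseteq> R.Gen ((\<lambda>i. y i + single 0 \<tau> * (y' i - y i)) ` {..<s} \<union> R.Gen (insert a P))}"
  define B2 where "B2 = {\<tau>. \<not> lforms n \<subseteq> R.Gen ((\<lambda>i. y' i + single 0 \<tau> * (y i - y' i)) ` {..<s} \<union> R.Gen (insert b P))}"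
  have "finite B1" unfolding B1_def
    by (rule finite_bad_line[OF _ _ Ga(1) Gh(1) n1]) (use y(1) y'(1) L(1) dif in blast)+
  moreover have "finite B2" unfolding B2_def
    by (rule finite_bad_line[OF _ _ Ga(2) Gh(2) n2]) (use y(1) y'(1) L(1) dif in blast)+
  then have "finite ((\<lambda>\<tau>. 1 - \<tau>) ` B2)" by simp
  ultimately obtain \<tau> where \<tau>: "\<tau> \<notin> B1" "\<tau> \<notin> (\<lambda>\<tau>. 1 - \<tau>) ` B2"
    using ex_new_if_finite[OF inf, of "B1 \<union> (\<lambda>\<tau>. 1 - \<tau>) ` B2"] by auto
  have "1 - \<tau> \<notin> B2" using \<tau>(2) by (auto simp: image_iff)
  define z where "z i = y i + single 0 \<tau> * (y' i - y i)" for i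
  \<comment> \<open>The same member of the pencil, seen from its other end; this is why
    \<open>1 - \<tau>\<close> has to avoid \<open>B2\<close>.\<close>
  have z': "z i = y' i + single 0 (1 - \<tau>) * (y i - y' i)" for i
    unfolding z_def by (simp add: single_diff algebra_simps)
  have zL: "\<forall>i<s. z i \<in> L" using y(1) y'(1) L(3) dif by (simp add: z_def)
  define K where "K = R.Gen (z ` {..<s} \<union> P)"
  have zP: "z ` {..<s} \<union> P \<subseteq> RR" using L_poly[OF zL] PR by auto
  have K: "R.is_ideal K" unfolding K_def by (rule R.Gen_ideal[OF zP])
  have "P \<subseteq> K" unfolding K_def using R.Gen_self[OF zP] by auto
  have ga: "lforms n \<subseteq> {g * a + h | g h. g \<in> RR \<and> h \<in> K}"
  proof -
    have "(\<lambda>i. y i + single 0 \<tau> * (y' i - y i)) = z" by (simp add: z_def fun_eq_iff)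
    moreover have "lforms n \<subseteq> R.Gen ((\<lambda>i. y i + single 0 \<tau> * (y' i - y i)) ` {..<s} \<union> R.Gen (insert a P))"
      using \<tau>(1) by (simp add: B1_def)
    ultimately have "lforms n \<subseteq> R.Gen (z ` {..<s} \<union> R.Gen (insert a P))" by (simp only:)
    then show ?thesis
      unfolding Gen_insert_Un[OF aR PR L_poly[OF zL]] K_def[symmetric] R.Gen_insert[OF aR K] .
  qed
  have gb: "lforms n \<subseteq> {g * b + h | g h. g \<in> RR \<and> h \<in> K}"
  proof -
    have "(\<lambda>i. y' i + single 0 (1 - \<tau>) * (y i - y' i)) = z" by (simp add: z' fun_eq_iff)
    moreover have "lforms n \<subseteq> R.Gen ((\<lambda>i. y' i + single 0 (1 - \<tau>) * (y i - y' i)) ` {..<s} \<union> R.Gen (insert b P))"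
      using \<open>1 - \<tau> \<notin> B2\<close> unfolding B2_def by blast
    ultimately have "lforms n \<subseteq> R.Gen (z ` {..<s} \<union> R.Gen (insert b P))" by (simp only:)
    then show ?thesis
      unfolding Gen_insert_Un[OF bR PR L_poly[OF zL]] K_def[symmetric] R.Gen_insert[OF bR K] .
  qed
  \<comment> \<open>The degree doubles because a monomial is split into two halves of degree
    \<open>n\<close>, one expanded through \<open>a\<close> and the other through
    \<open>b\<close>.\<close>
  have "lforms (n + n) \<subseteq> K"
    unfolding forms_subset_iff[OF K]
  proof
    fix e assume "e \<in> mons {..<m} (n + n)"
    then obtain e1 e2 where e: "e1 \<in> mons {..<m} n" "e2 \<in> mons {..<m} n" "e = e1 + e2"
      by (rule mons_split)
    have "monomial e1 \<in> lforms n" "monomial e2 \<in> lforms n" using e by (auto intro: monomial_form)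
    then obtain g h g' h' where gh: "monomial e1 = g * a + h" "g \<in> RR" "h \<in> K"
      "monomial e2 = g' * b + h'" "g' \<in> RR" "h' \<in> K" using ga gb by blast
    have "monomial e = (g * g') * (a * b) + ((g' * b + h') * h + (g * a) * h')"
      unfolding e(3) monomial_add gh(1,4) by (simp add: algebra_simps)
    also have "\<dots> \<in> K"
    proof (intro R.ideal_add[OF K])
      have "g * g' \<in> RR" "a * b \<in> K" using gh ab \<open>P \<subseteq> K\<close> by auto
      then show "(g * g') * (a * b) \<in> K" by (rule R.ideal_mult[OF K])
      have "g' * b + h' \<in> RR" using gh bR R.ideal_sub[OF K] by (intro R.add R.mult) auto
      then show "(g' * b + h') * h \<in> K" using gh(3) by (rule R.ideal_mult[OF K])
      have "g * a \<in> RR" using gh aR by auto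
      then show "(g * a) * h' \<in> K" using gh(6) by (rule R.ideal_mult[OF K])
    qed
    finally show "monomial e \<in> K" .
  qed
  then show ?thesis unfolding good_def K_def using zL by blast
qed

text \<open>Zorn's lemma applies because being \<open>good\<close> is a finite condition: it needs
  one relation for each monomial of degree \<open>n\<close>. The finitely many terms
  \<open>h e\<close> from the union of a nonempty chain already lie in a single member, which would
  then be \<open>good\<close> as well.\<close>

lemma ex_maximal_not_good:
  assumes J: "R.is_ideal J" "hc_closed J" "\<not> good J s"
  obtains P where "R.is_ideal P" "hc_closed P" "\<not> good P s" "J \<subseteq> P"
    "\<And>P'. R.is_ideal P' \<Longrightarrow> hc_closed P' \<Longrightarrow> P \<subset> P' \<Longrightarrow> good P' s"
proof -
  define A where "A = {P. R.is_ideal P \<and> hc_closed P \<and> \<not> good P s \<and> J \<subseteq> P}"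
  have "\<exists>M\<in>A. \<forall>X\<in>A. M \<subseteq> X \<longrightarrow> X = M"
  proof (rule subset_Zorn_nonempty)
    show "A \<noteq> {}" using J by (auto simp: A_def)
    fix D assume D: "D \<noteq> {}" "subset.chain A D"
    have DA: "D \<subseteq> A" using D(2) by (simp add: subset.chain_def)
    have pair: "\<exists>P\<in>D. x \<in> P \<and> y \<in> P" if xy: "x \<in> \<Union>D" "y \<in> \<Union>D" for x y
      using finite_subset_Union_chain[of "{x, y}" D A] xy D by auto
    have U: "R.is_ideal (\<Union>D)"
      unfolding R.ideal_iff
    proof (intro conjI ballI)
      show "\<Union>D \<subseteq> RR" using DA R.ideal_sub by (fastforce simp: A_def)
      obtain P0 where "P0 \<in> D" using D(1) by blast
      then show "0 \<in> \<Union>D" using DA R.ideal_zero by (auto simp: A_def)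
      show "x + y \<in> \<Union>D" if "x \<in> \<Union>D" "y \<in> \<Union>D" for x y
        using pair[OF that] DA R.ideal_add by (auto simp: A_def) blast
      show "r * x \<in> \<Union>D" if r: "r \<in> RR" and x: "x \<in> \<Union>D" for r x
      proof -
        obtain P where "P \<in> D" "x \<in> P" using x by blast
        then show ?thesis using DA R.ideal_mult[OF _ r] unfolding A_def by blast
      qed
    qed
    have h: "hc_closed (\<Union>D)" using DA unfolding hc_closed_def A_def by blast
    have "\<not> good (\<Union>D) s"
    proof
      assume "good (\<Union>D) s"
      then obtain y n where y: "\<forall>i<s. y i \<in> L" and n: "lforms n \<subseteq> R.Gen (y ` {..<s} \<union> \<Union>D)"
        by (auto simp: good_def)
      let ?E = "mons {..<m} n"
      have yR: "\<And>i. i < s \<Longrightarrow> y i \<in> RR" using L_poly[OF y] by auto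
      have "\<forall>e\<in>?E. \<exists>h\<in>\<Union>D. \<exists>g. (\<forall>i<s. g i \<in> RR) \<and> monomial e = (\<Sum>i<s. g i * y i) + h"
      proof
        fix e assume "e \<in> ?E"
        then have eD: "monomial e \<in> R.Gen (y ` {..<s} \<union> \<Union>D)" using n monomial_form[of UNIV e] by blast
        show "\<exists>h\<in>\<Union>D. \<exists>g. (\<forall>i<s. g i \<in> RR) \<and> monomial e = (\<Sum>i<s. g i * y i) + h"
          by (rule R.Gen_familyD[OF _ U eD]) (rule yR)
      qed
      from bchoice[OF this[unfolded Bex_def]] obtain h where h': "\<forall>e\<in>?E. h e \<in> \<Union>D \<and>
          (\<exists>g. (\<forall>i<s. g i \<in> RR) \<and> monomial e = (\<Sum>i<s. g i * y i) + h e)" ..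
      have h: "h e \<in> \<Union>D" "\<exists>g. (\<forall>i<s. g i \<in> RR) \<and> monomial e = (\<Sum>i<s. g i * y i) + h e" if "e \<in> ?E" for e
        using h' that by blast+
      obtain P where P: "P \<in> D" "h ` ?E \<subseteq> P"
        using finite_subset_Union_chain[of "h ` ?E" D A] h(1) D card_mons(1)[OF m1] by blast
      have iP: "R.is_ideal P" "\<not> good P s" using P(1) DA by (auto simp: A_def)
      have G: "R.is_ideal (R.Gen (y ` {..<s} \<union> P))"
        by (rule Gen_family_ideal[OF L_family[OF y] iP(1)])
      have "lforms n \<subseteq> R.Gen (y ` {..<s} \<union> P)"
        unfolding forms_subset_iff[OF G]
      proof
        fix e assume e: "e \<in> ?E"
        then have hP: "h e \<in> P" using P(2) by auto
        obtain g where g: "\<forall>i<s. g i \<in> RR" "monomial e = (\<Sum>i<s. g i * y i) + h e"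
          using h(2)[OF e] by blast
        show "monomial e \<in> R.Gen (y ` {..<s} \<union> P)"
          unfolding g(2) by (rule R.Gen_familyI[OF yR iP(1)]) (use g hP in auto)
      qed
      then show False using iP(2) y unfolding good_def by blast
    qed
    moreover have "J \<subseteq> \<Union>D" using D(1) DA by (fastforce simp: A_def)
    ultimately show "\<Union>D \<in> A" using U h by (simp add: A_def)
  qed
  then obtain P where P: "P \<in> A" "\<And>X. X \<in> A \<Longrightarrow> P \<subseteq> X \<Longrightarrow> X = P" by blast
  show thesis
  proof (rule that[of P])
    show "good P' s" if "R.is_ideal P'" "hc_closed P'" "P \<subset> P'" for P'
      using P(1) P(2)[of P'] that by (auto simp: A_def)
  qed (use P(1) in \<open>auto simp: A_def\<close>)
qed

lemma maximal_not_good_prime: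
  assumes P: "R.is_ideal P" "hc_closed P" "\<not> good P s"
    and max: "\<And>P'. R.is_ideal P' \<Longrightarrow> hc_closed P' \<Longrightarrow> P \<subset> P' \<Longrightarrow> good P' s"
  shows "R.is_prime P"
  unfolding R.primeideal_iff
proof (intro conjI ballI impI)
  show "P \<noteq> RR"
  proof
    assume "P = RR"
    then have "lforms 0 \<subseteq> P" by (simp add: forms_polys)
    then show False using P(3) good_of_subset[OF P(1)] by blast
  qed
  fix a b assume ab: "a \<in> RR" "b \<in> RR" "a * b \<in> P"
  show "a \<in> P \<or> b \<in> P"
  \<comment> \<open>Testing primality on forms suffices, and adjoining a form keeps the ideal
    homogeneous, so maximality applies to the enlarged ideals.\<close>
  proof (rule mult_mem_prime_of_forms[OF P(1,2) _ ab])
    fix i j a b assume f: "a \<in> lforms i" "b \<in> lforms j" "a * b \<in> P"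
    have g: "good (R.Gen (insert c P)) s" if c: "c \<in> lforms k" "c \<notin> P" for c k
    proof (rule max)
      have cP: "insert c P \<subseteq> RR" using form_poly[OF c(1)] R.ideal_sub[OF P(1)] by auto
      show "R.is_ideal (R.Gen (insert c P))" by (rule R.Gen_ideal[OF cP])
      show "hc_closed (R.Gen (insert c P))" using hc_closed_Gen_Un[OF P(1,2), of "{c}"] c(1) by auto
      show "P \<subset> R.Gen (insert c P)" using R.Gen_self[OF cP] c(2) by auto
    qed
    show "a \<in> P \<or> b \<in> P"
    proof (rule ccontr)
      assume "\<not> ?thesis"
      then show False using good_of_two[OF P(1,2) f(1) g[OF f(1)] f(2) g[OF f(2)] f(3)] P(3) by blast
    qed
  qed
qed (fact P(1))

text \<open>The lowest prime is a maximal ideal \<open>P\<close> above \<open>J\<close> over which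
  \<open>s\<close> forms fail. Not all of \<open>L\<close> lies in \<open>P\<close>, since otherwise
  \<open>P\<close> would contain the ideal generated by \<open>L\<close> and \<open>I\<close>, hence
  all forms of degree \<open>N\<close>. A form \<open>y\<close> of \<open>L\<close> outside
  \<open>P\<close> gives an ideal \<open>(y, P)\<close> that is \<open>bad\<close> one step lower,
  and primes above it contain \<open>P\<close> strictly.\<close>

lemma bad_prime_chain:
  assumes I: "I \<subseteq> RR" "lforms N \<subseteq> R.Gen (L \<union> I)"
    and "R.is_ideal J" "hc_closed J" "I \<subseteq> J" "bad J s"
  shows "\<exists>P. (\<forall>i\<le>s. R.is_prime (P i)) \<and> (\<forall>i<s. P i \<subset> P (Suc i)) \<and> J \<subseteq> P 0"
  using assms(3-)
proof (induction s arbitrary: J)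
  case 0
  then obtain P where "R.is_prime P" "J \<subseteq> P"
    using ex_prime_over_homogeneous[of J] by auto
  then show ?case by (intro exI[of _ "\<lambda>_. P"]) auto
next
  case (Suc s)
  then have "\<not> good J s" by simp
  then obtain P where P: "R.is_ideal P" "hc_closed P" "\<not> good P s" "J \<subseteq> P"
    and max: "\<And>P'. R.is_ideal P' \<Longrightarrow> hc_closed P' \<Longrightarrow> P \<subset> P' \<Longrightarrow> good P' s"
    using ex_maximal_not_good[OF Suc.prems(1,2)] by metis
  have prime: "R.is_prime P" by (rule maximal_not_good_prime[OF P(1-3) max])
  note PR = R.ideal_sub[OF P(1)]
  have ng0: "\<not> lforms n \<subseteq> P" for n
  proof
    assume "lforms n \<subseteq> P"
    then show False using P(3) good_of_subset[OF P(1)] by blast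
  qed
  have "\<not> L \<subseteq> P"
  proof
    assume "L \<subseteq> P"
    then have "R.Gen (L \<union> I) \<subseteq> P" using P(4) Suc.prems(3) by (intro R.Gen_minimal[OF P(1)]) auto
    then show False using I(2) ng0[of N] by auto
  qed
  then obtain y where y: "y \<in> L" "y \<notin> P" by auto
  have y1: "y \<in> lforms 1" using y(1) L(1) by auto
  have yP: "insert y P \<subseteq> RR" using form_poly[OF y1] PR by auto
  let ?J = "R.Gen (insert y P)"
  have J: "R.is_ideal ?J" by (rule R.Gen_ideal[OF yP])
  have hJ: "hc_closed ?J" using hc_closed_Gen_Un[OF P(1,2), of "{y}"] y1 by auto
  have PJ: "insert y P \<subseteq> ?J" using R.Gen_self[OF yP] .
  have "bad ?J s"
  proof (cases s)
    case 0
    \<comment> \<open>Adjoining a form of degree 1 does not change the part of degree 0, and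
      \<open>P\<close> does not contain 1.\<close>
    have "1 \<notin> ?J"
    proof
      assume one: "1 \<in> ?J"
      have eq: "insert y P = (\<lambda>_. y) ` {..<1::nat} \<union> P" by auto
      have one0: "(1 :: 'k mpol) \<in> lforms 0"
        using const_form[of 1 "{..<m}"] by simp
      obtain g h where "\<And>i. i < (1::nat) \<Longrightarrow> g i \<in> (if 1 \<le> (0::nat) then lforms (0 - 1) else {0})"
        "h \<in> P" "h \<in> lforms 0" "1 = (\<Sum>i<1. g i * y) + h"
        by (rule Gen_form_decomp[of 1 "\<lambda>_. y" "\<lambda>_. 1" P 1 0]) (use y1 P one one0 eq in auto)
      then have "1 \<in> P" by simp
      then show False using ng0[of 0] forms0_subset_iff[OF P(1)] by auto
    qed
    then show ?thesis using 0 by simp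
  next
    case (Suc s1)
    then show ?thesis using good_insert[of y P s1] y(1) PR P(3) by auto
  qed
  then obtain Q where Q: "\<forall>i\<le>s. R.is_prime (Q i)" "\<forall>i<s. Q i \<subset> Q (Suc i)" "?J \<subseteq> Q 0"
    using Suc.IH[OF J hJ] PJ P(4) Suc.prems(3) by (meson insert_subset subset_trans)
  define Q' where "Q' i = (case i of 0 \<Rightarrow> P | Suc j \<Rightarrow> Q j)" for i
  have "P \<subset> Q 0" using Q(3) PJ y(2) by auto
  then have "(\<forall>i\<le>Suc s. R.is_prime (Q' i)) \<and> (\<forall>i<Suc s. Q' i \<subset> Q' (Suc i)) \<and> J \<subseteq> Q' 0"
    using Q(1,2) prime P(4) by (auto simp: Q'_def split: nat.split)
  then show ?case by blast
qed

lemma ex_generic_reduction: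
  assumes I: "R.is_ideal I" "hc_closed I" "lforms N \<subseteq> R.Gen (L \<union> I)"
    and dim: "\<And>P. \<forall>i\<le>Suc d. R.is_prime (P i) \<Longrightarrow> \<forall>i<Suc d. P i \<subset> P (Suc i) \<Longrightarrow> \<not> I \<subseteq> P 0"
  shows "\<exists>y n. (\<forall>i<d. y i \<in> L) \<and> lforms n \<subseteq> R.Gen (y ` {..<d} \<union> I)"
proof -
  have "\<not> bad I (Suc d)"
    using bad_prime_chain[OF R.ideal_sub[OF I(1)] I(3) I(1,2), of "Suc d"] dim by blast
  then show ?thesis by (simp add: good_def)
qed

end

end

section \<open>Linear algebra modulo a subspace\<close>

context vector_space begin

text \<open>The projection along a complement of \<open>I\<close> replaces the quotient map, so that
  statements modulo \<open>I\<close> stay within the same space. A basis \<open>C\<close> of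
  \<open>I\<close> is extended to a basis \<open>B\<close> of the space; the map kills
  \<open>C\<close> and fixes \<open>B - C\<close>.\<close>

lemma ex_linear_kernel:
  assumes I: "subspace I"
  shows "\<exists>\<pi>. Vector_Spaces.linear scale scale \<pi> \<and> (\<forall>x. \<pi> x = 0 \<longleftrightarrow> x \<in> I)"
proof -
  obtain C where C: "C \<subseteq> I" "independent C" "I \<subseteq> span C"
    by (rule maximal_independent_subset)
  obtain B where B: "C \<subseteq> B" "independent B" "UNIV \<subseteq> span B"
    by (rule maximal_independent_subset_extend[OF subset_UNIV C(2)])
  interpret vp: vector_space_pair scale scale by unfold_locales
  from vp.linear_independent_extend[OF B(2), of "\<lambda>x. if x \<in> C then 0 else x"]
  obtain g where g: "Vector_Spaces.linear scale scale g" "\<forall>x\<in>B. g x = (if x \<in> C then 0 else x)"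
    by (elim exE conjE)
  interpret g: Vector_Spaces.linear scale scale g by (rule g(1))
  have "C \<subseteq> {x. g x = 0}" using B(1) g(2) by auto
  then have "span C \<subseteq> {x. g x = 0}" by (rule span_minimal) (rule g.subspace_kernel)
  then have gC: "g x = 0" if "x \<in> span C" for x using that by auto
  have "B - C \<subseteq> {x. g x = x}" using g(2) by auto
  moreover have "subspace {x. g x = x}"
    by (rule subspaceI) (auto simp: g.zero g.add g.scale)
  ultimately have "span (B - C) \<subseteq> {x. g x = x}" by (rule span_minimal)
  then have gD: "g x = x" if "x \<in> span (B - C)" for x using that by auto
  have "g x = 0 \<longleftrightarrow> x \<in> I" for x
  proof
    assume "x \<in> I" then show "g x = 0" using C(3) gC by blast
  next
    assume x: "g x = 0"
    have "C \<union> (B - C) = B" using B(1) by auto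
    then have "x \<in> span (C \<union> (B - C))" using B(3) by auto
    then obtain a b where ab: "x = a + b" "a \<in> span C" "b \<in> span (B - C)"
      unfolding span_Un by blast
    have "b = 0" using x ab gC[OF ab(2)] gD[OF ab(3)] by (simp add: g.add)
    then show "x \<in> I" using ab span_minimal[OF C(1) I] by auto
  qed
  then show ?thesis using g(1) by blast
qed

context
  fixes I \<pi>
  assumes I: "subspace I" and \<pi>: "Vector_Spaces.linear scale scale \<pi>" and ker: "\<And>x. \<pi> x = 0 \<longleftrightarrow> x \<in> I"
begin

interpretation \<pi>: Vector_Spaces.linear scale scale \<pi> by (rule \<pi>)

lemma image_in_span_iff: "\<pi> x \<in> span (\<pi> ` X) \<longleftrightarrow> x \<in> span (X \<union> I)"
proof
  assume "\<pi> x \<in> span (\<pi> ` X)"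
  then obtain y where y: "y \<in> span X" "\<pi> x = \<pi> y" unfolding \<pi>.span_image by blast
  then have "x - y \<in> span I" using ker[of "x - y"] span_base by (simp add: \<pi>.diff)
  moreover have "x = y + (x - y)" by simp
  ultimately show "x \<in> span (X \<union> I)" unfolding span_Un using y(1) by blast
next
  assume "x \<in> span (X \<union> I)"
  then obtain y z where yz: "x = y + z" "y \<in> span X" "z \<in> span I" unfolding span_Un by blast
  then have "\<pi> z = 0" using ker I by (simp add: span_eq_iff[THEN iffD2])
  then show "\<pi> x \<in> span (\<pi> ` X)" unfolding \<pi>.span_image yz(1) using yz(2) by (simp add: \<pi>.add)
qed

lemma family_card_le_mod':
  assumes "finite B" "finite S" "\<And>b. b \<in> B \<Longrightarrow> v b \<in> span (S \<union> I)"
    and ind: "\<And>c. (\<Sum>b\<in>B. c b *s v b) \<in> I \<Longrightarrow> \<forall>b\<in>B. c b = 0"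
  shows "card B \<le> card S"
proof -
  have inj: "inj_on (\<lambda>b. \<pi> (v b)) B"
  proof (rule inj_onI, rule ccontr)
    fix b b' assume b: "b \<in> B" "b' \<in> B" "\<pi> (v b) = \<pi> (v b')" "b \<noteq> b'"
    \<comment> \<open>Two indices with the same image would give the relation with coefficients 1
      and -1, which is excluded.\<close>
    let ?c = "\<lambda>x. if x = b then 1 else if x = b' then -1 else 0"
    have "(\<Sum>x\<in>B. ?c x *s v x) = (\<Sum>x\<in>{b, b'}. ?c x *s v x)"
      using b assms(1) by (intro sum.mono_neutral_right) auto
    also have "\<dots> = v b - v b'" using b(4) by simp
    finally have "(\<Sum>x\<in>B. ?c x *s v x) \<in> I" using ker[of "v b - v b'"] b(3) by (simp add: \<pi>.diff)
    from ind[OF this] show False using b(1) by auto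
  qed
  let ?T = "(\<lambda>b. \<pi> (v b)) ` B"
  have "independent ?T"
  proof (rule independent_if_scalars_zero)
    fix c x assume z: "(\<Sum>x\<in>?T. c x *s x) = 0" and x: "x \<in> ?T"
    have "\<pi> (\<Sum>b\<in>B. c (\<pi> (v b)) *s v b) = (\<Sum>x\<in>?T. c x *s x)"
      by (simp add: sum.reindex[OF inj] \<pi>.sum \<pi>.scale)
    then have "(\<Sum>b\<in>B. c (\<pi> (v b)) *s v b) \<in> I" using z ker by simp
    from ind[OF this] show "c x = 0" using x by auto
  qed (use assms(1) in simp)
  moreover have "?T \<subseteq> span (\<pi> ` S)" using assms(3) image_in_span_iff by auto
  ultimately have "card ?T \<le> card (\<pi> ` S)"
    using independent_span_bound[of "\<pi> ` S" ?T] assms(2) by simp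
  also have "\<dots> \<le> card S" by (rule card_image_le[OF assms(2)])
  finally show ?thesis by (simp add: card_image[OF inj])
qed

text \<open>A maximal independent subset of the image of \<open>L\<close> is lifted to
  \<open>L\<close>. If it has as many elements as \<open>Y\<close>, an element of \<open>Y\<close>
  outside its span would extend it to an independent set too large for the span of \<open>Y\<close>.
  The last clause is what later forces two reductions to coincide.\<close>

lemma ex_basis_mod':
  assumes Y: "finite Y" and L: "L \<subseteq> span (Y \<union> I)"
  shows "\<exists>B\<subseteq>L. finite B \<and> card B \<le> card Y \<and> L \<subseteq> span (B \<union> I) \<and> (card B = card Y \<longrightarrow> Y \<subseteq> span (B \<union> I))"
proof -
  have LY: "\<pi> ` L \<subseteq> span (\<pi> ` Y)" using L image_in_span_iff by auto
  obtain B' where B': "B' \<subseteq> \<pi> ` L" "independent B'" "\<pi> ` L \<subseteq> span B'"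
    by (rule maximal_independent_subset)
  have fin: "finite B'" "card B' \<le> card (\<pi> ` Y)"
    using independent_span_bound[of "\<pi> ` Y" B'] Y B' LY by auto
  have "\<forall>b\<in>B'. \<exists>l. l \<in> L \<and> \<pi> l = b" using B'(1) by auto
  from bchoice[OF this] obtain g where g: "\<forall>b\<in>B'. g b \<in> L \<and> \<pi> (g b) = b" ..
  let ?B = "g ` B'"
  have im: "\<pi> ` ?B = B'" using g by force
  have inj: "inj_on g B'" using g by (intro inj_on_inverseI[of _ \<pi>]) blast
  have cY: "card (\<pi> ` Y) \<le> card Y" by (rule card_image_le[OF Y])
  have "L \<subseteq> span (?B \<union> I)"
  proof
    fix x assume "x \<in> L"
    then have "\<pi> x \<in> span (\<pi> ` ?B)" unfolding im using B'(3) by blast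
    then show "x \<in> span (?B \<union> I)" by (simp only: image_in_span_iff)
  qed
  moreover have "Y \<subseteq> span (?B \<union> I)" if c: "card ?B = card Y"
  proof
    fix y assume y: "y \<in> Y"
    have "\<pi> y \<in> span B'"
    proof (rule ccontr)
      assume n: "\<pi> y \<notin> span B'"
      then have "independent (insert (\<pi> y) B')" using B'(2) by (rule independent_insertI)
      moreover have "insert (\<pi> y) B' \<subseteq> span (\<pi> ` Y)" using y B'(1) LY span_base by auto
      ultimately have "card (insert (\<pi> y) B') \<le> card (\<pi> ` Y)"
        using independent_span_bound[of "\<pi> ` Y"] Y by blast
      moreover have "\<pi> y \<notin> B'" using n span_base by blast
      ultimately show False using fin c cY card_image[OF inj] by simp
    qed
    then have "\<pi> y \<in> span (\<pi> ` ?B)" unfolding im .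
    then show "y \<in> span (?B \<union> I)" by (simp only: image_in_span_iff)
  qed
  ultimately show ?thesis using g fin cY card_image[OF inj] by (intro exI[of _ ?B]) auto
qed

end

lemma family_card_le_mod:
  assumes "subspace I" "finite B" "finite S" "\<And>b. b \<in> B \<Longrightarrow> v b \<in> span (S \<union> I)"
    and "\<And>c. (\<Sum>b\<in>B. c b *s v b) \<in> I \<Longrightarrow> \<forall>b\<in>B. c b = 0"
  shows "card B \<le> card S"
proof -
  obtain \<pi> where \<pi>: "Vector_Spaces.linear scale scale \<pi>" "\<forall>x. \<pi> x = 0 \<longleftrightarrow> x \<in> I"
    using ex_linear_kernel[OF assms(1)] by blast
  show ?thesis
  proof (rule family_card_le_mod'[OF assms(1) \<pi>(1) spec[OF \<pi>(2)] assms(2,3)])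
    show "v b \<in> span (S \<union> I)" if "b \<in> B" for b by (rule assms(4)[OF that])
    show "\<forall>b\<in>B. c b = 0" if "(\<Sum>b\<in>B. c b *s v b) \<in> I" for c by (rule assms(5)[OF that])
  qed
qed

lemma ex_basis_mod:
  assumes "subspace I" "finite Y" "L \<subseteq> span (Y \<union> I)"
  shows "\<exists>B\<subseteq>L. finite B \<and> card B \<le> card Y \<and> L \<subseteq> span (B \<union> I) \<and> (card B = card Y \<longrightarrow> Y \<subseteq> span (B \<union> I))"
proof -
  obtain \<pi> where \<pi>: "Vector_Spaces.linear scale scale \<pi>" "\<forall>x. \<pi> x = 0 \<longleftrightarrow> x \<in> I"
    using ex_linear_kernel[OF assms(1)] by blast
  show ?thesis by (rule ex_basis_mod'[OF assms(1) \<pi>(1) spec[OF \<pi>(2)] assms(2,3)])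
qed

end

section \<open>The length of a chain of primes is at most the size of a reduction\<close>

interpretation mpol: vector_space "\<lambda>c (p :: 'k::field mpol). single 0 c * p"
  by unfold_locales (simp_all add: distrib_left distrib_right single_add mult_single mult.assoc[symmetric])

text \<open>A monomial in \<open>f 0\<close>, \<open>f 1\<close>, ... with exponents given by a
  list. The recursion peels off \<open>f 0\<close>, matching the removal of the lowest prime of a
  chain.\<close>

primrec monval :: "(nat \<Rightarrow> 'a::comm_ring_1) \<Rightarrow> nat list \<Rightarrow> 'a" where
  "monval f [] = 1"
| "monval f (a # \<alpha>) = f 0 ^ a * monval (f \<circ> Suc) \<alpha>"

text \<open>Exponents are bounded one by one and not in total, so that the count is exactly a
  power.\<close>

definition box :: "nat \<Rightarrow> nat \<Rightarrow> nat list set" where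
  "box l N = {\<alpha>. set \<alpha> \<subseteq> {..N} \<and> length \<alpha> = l}"

lemma finite_box: "finite (box l N)" and card_box: "card (box l N) = Suc N ^ l"
  unfolding box_def by (rule finite_lists_length_eq, simp) (subst card_lists_length_eq, simp_all)

lemma box_0: "box 0 N = {[]}"
  by (auto simp: box_def)

lemma box_Suc: "box (Suc l) N = (\<lambda>(a, \<alpha>). a # \<alpha>) ` ({..N} \<times> box l N)"
proof (intro subset_antisym subsetI)
  fix \<alpha> assume \<alpha>: "\<alpha> \<in> box (Suc l) N"
  then obtain a \<beta> where "\<alpha> = a # \<beta>" by (cases \<alpha>) (auto simp: box_def)
  with \<alpha> show "\<alpha> \<in> (\<lambda>(a, \<alpha>). a # \<alpha>) ` ({..N} \<times> box l N)"
    by (intro image_eqI[of _ _ "(a, \<beta>)"]) (auto simp: box_def)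
qed (auto simp: box_def)

lemma sum_box_Suc: "(\<Sum>\<alpha>\<in>box (Suc l) N. g \<alpha>) = (\<Sum>a\<le>N. \<Sum>\<alpha>\<in>box l N. g (a # \<alpha>))"
proof -
  have "inj_on (\<lambda>(a, \<alpha>). a # \<alpha>) ({..N} \<times> box l N)" by (auto simp: inj_on_def)
  then show ?thesis
    unfolding box_Suc by (simp add: sum.reindex sum.cartesian_product split_def comp_def)
qed

lemma monval_list_update:
  "i < length \<alpha> \<Longrightarrow> monval f (\<alpha>[i := Suc (\<alpha> ! i)]) = f i * monval f \<alpha>"
proof (induction \<alpha> arbitrary: f i)
  case (Cons a \<alpha>)
  show ?case
  proof (cases i)
    case (Suc j)
    then show ?thesis using Cons.IH[of j "f \<circ> Suc"] Cons.prems
      by (simp add: mult.left_commute comp_def)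
  qed (simp add: mult.assoc)
qed simp

lemma monval_replicate_0: "monval f (replicate s 0) = 1"
  by (induction s arbitrary: f) simp_all

lemma (in csubring) monval_mem: "(\<And>i. i < length \<alpha> \<Longrightarrow> f i \<in> C) \<Longrightarrow> monval f \<alpha> \<in> C"
proof (induction \<alpha> arbitrary: f)
  case (Cons a \<alpha>)
  have "monval (f \<circ> Suc) \<alpha> \<in> C" by (rule Cons.IH) (use Cons.prems in auto)
  moreover have "f 0 ^ a \<in> C" by (rule power) (use Cons.prems[of 0] in simp)
  ultimately show ?case by (simp add: mult)
qed simp

context inf_field_poly begin

lemma ideal_subspace:
  assumes J: "R.is_ideal J"
  shows "mpol.subspace J"
proof (rule mpol.subspaceI)
  show "0 \<in> J" by (rule R.ideal_zero[OF J])
  show "x + y \<in> J" if "x \<in> J" "y \<in> J" for x y by (rule R.ideal_add[OF J that])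
  show "single 0 c * x \<in> J" if "x \<in> J" for c x
    by (rule R.ideal_mult[OF J const_poly[OF UNIV_I] that])
qed

lemma ideal_span: "R.is_ideal J \<Longrightarrow> S \<subseteq> J \<Longrightarrow> mpol.span S \<subseteq> J"
  by (rule mpol.span_minimal[OF _ ideal_subspace])

text \<open>
  A relation modulo \<open>P 0\<close>, divided by the largest possible power of \<open>f 0 \<notin> P 0\<close>, becomes modulo \<open>P 1\<close> a
  relation between the remaining \<open>f i\<close>, since \<open>f 0 \<in> P 1\<close>.
\<close>

lemma chain_monomials_independent:
  assumes "\<And>i. i \<le> l \<Longrightarrow> R.is_prime (P i)" "\<And>i. i < l \<Longrightarrow> P i \<subseteq> P (Suc i)"
    and "\<And>i. i < l \<Longrightarrow> f i \<in> P (Suc i)" "\<And>i. i < l \<Longrightarrow> f i \<notin> P i"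
    and "(\<Sum>\<alpha>\<in>box l N. single 0 (c \<alpha>) * monval f \<alpha>) \<in> P 0"
  shows "\<forall>\<alpha>\<in>box l N. c \<alpha> = 0"
  using assms
proof (induction l arbitrary: P f c)
  case 0
  have P0: "R.is_ideal (P 0)" "P 0 \<noteq> RR" using 0(1)[of 0] unfolding R.primeideal_iff by auto
  have c: "single 0 (c []) \<in> P 0" using 0(5) by (simp add: box_0)
  have "c [] = 0"
  proof (rule ccontr)
    assume "c [] \<noteq> 0"
    then have "(1 :: 'k mpol) = single 0 (inverse (c [])) * single 0 (c [])" by (simp add: mult_single)
    also have "\<dots> \<in> P 0" using c by (intro R.ideal_mult[OF P0(1)] const_poly) auto
    finally have "1 \<in> P 0" .
    then have "RR \<subseteq> P 0" using R.ideal_mult[OF P0(1), of _ 1] by auto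
    then show False using R.ideal_sub[OF P0(1)] P0(2) by auto
  qed
  then show ?case by (simp add: box_0)
next
  case (Suc l)
  have prime: "R.is_ideal (P i)" "\<And>a b. a \<in> RR \<Longrightarrow> b \<in> RR \<Longrightarrow> a * b \<in> P i \<Longrightarrow> a \<in> P i \<or> b \<in> P i"
    and pne: "P i \<noteq> RR" if "i \<le> Suc l" for i
    using Suc.prems(1)[OF that] unfolding R.primeideal_iff by blast+
  have f: "f i \<in> RR" if "i < Suc l" for i
    using Suc.prems(3)[OF that] R.ideal_sub[OF prime(1)[of "Suc i"]] that by auto
  have f0: "f 0 \<notin> P 0" using Suc.prems(4)[of 0] by simp
  define G where "G a = (\<Sum>\<alpha>\<in>box l N. single 0 (c (a # \<alpha>)) * monval (f \<circ> Suc) \<alpha>)" for a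
  have G: "G a \<in> RR" for a
    unfolding G_def by (intro R.sum R.mult const_poly R.monval_mem) (auto simp: box_def intro!: f)
  have sum: "(\<Sum>\<alpha>\<in>box (Suc l) N. single 0 (c \<alpha>) * monval f \<alpha>) = (\<Sum>a\<le>N. f 0 ^ a * G a)"
    unfolding sum_box_Suc G_def by (simp add: sum_distrib_left mult_ac)
  have "b \<le> N \<longrightarrow> (\<forall>\<alpha>\<in>box l N. c (b # \<alpha>) = 0)" for b
  proof (induction b rule: less_induct)
    case (less b)
    show ?case
    proof
      assume b: "b \<le> N"
      have Ga: "G a = 0" if "a < b" for a using less.IH[OF that] that b unfolding G_def by simp
      let ?T = "\<Sum>a\<in>{Suc b..N}. f 0 ^ (a - b) * G a"
      have "(\<Sum>a\<le>N. f 0 ^ a * G a) = (\<Sum>a\<in>{b..N}. f 0 ^ a * G a)"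
        using Ga by (intro sum.mono_neutral_right) auto
      also have "\<dots> = (\<Sum>a\<in>{b..N}. f 0 ^ b * (f 0 ^ (a - b) * G a))"
      proof (rule sum.cong)
        fix a assume "a \<in> {b..N}"
        then have "f 0 ^ a = f 0 ^ b * f 0 ^ (a - b)" by (simp flip: power_add)
        then show "f 0 ^ a * G a = f 0 ^ b * (f 0 ^ (a - b) * G a)" by (simp add: mult.assoc)
      qed simp
      also have "\<dots> = f 0 ^ b * (\<Sum>a\<in>{b..N}. f 0 ^ (a - b) * G a)" by (simp add: sum_distrib_left)
      also have "(\<Sum>a\<in>{b..N}. f 0 ^ (a - b) * G a) = G b + ?T"
        using b by (subst sum.atLeast_Suc_atMost) auto
      finally have "f 0 ^ b * (G b + ?T) \<in> P 0" using Suc.prems(5) sum by simp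
      moreover have "f 0 ^ b \<notin> P 0"
      proof (induction b)
        case 0
        show ?case
        proof
          assume "f 0 ^ 0 \<in> P 0"
          then have "RR \<subseteq> P 0" using R.ideal_mult[OF prime(1)[of 0], of _ 1] by auto
          then show False using R.ideal_sub[OF prime(1)[of 0]] pne[of 0] by auto
        qed
      next
        case (Suc b)
        then show ?case using prime(2)[of 0 "f 0" "f 0 ^ b"] f[of 0] f0
          by auto
      qed
      moreover have "G b + ?T \<in> RR" using f[of 0] G by (intro R.add R.sum R.mult R.power) auto
      ultimately have "G b + ?T \<in> P 0"
        using prime(2)[of 0 "f 0 ^ b" "G b + ?T"] f[of 0] by auto
      then have s: "G b + ?T \<in> P 1" using Suc.prems(2)[of 0] by auto
      have P1: "R.is_ideal (P 1)" using prime(1)[of 1] by simp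
      have "?T \<in> P 1"
      proof (rule R.ideal_sum[OF P1])
        fix a assume "a \<in> {Suc b..N}"
        then have "a - b = Suc (a - Suc b)" by auto
        then have "f 0 ^ (a - b) * G a = (f 0 ^ (a - Suc b) * G a) * f 0"
          by (simp only: power_Suc mult_ac)
        also have "\<dots> \<in> P 1" using Suc.prems(3)[of 0] f[of 0] G by (intro R.ideal_mult[OF P1]) auto
        finally show "f 0 ^ (a - b) * G a \<in> P 1" .
      qed
      then have "G b \<in> P 1" using s R.ideal_add_cancel[OF P1] by blast
      \<comment> \<open>\<open>G b\<close> is a relation for the shifted chain, which starts at
        \<open>P 1\<close>, and the shifted elements.\<close>
      then show "\<forall>\<alpha>\<in>box l N. c (b # \<alpha>) = 0"
        unfolding G_def
        by (intro Suc.IH[of "P \<circ> Suc" "f \<circ> Suc" "\<lambda>\<alpha>. c (b # \<alpha>)"]) (use Suc.prems(1-4) in \<open>auto simp: comp_def\<close>)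
    qed
  qed
  then show ?case by (auto simp: box_Suc)
qed

definition deg_le :: "nat \<Rightarrow> 'k mpol set" where
  "deg_le n = {p \<in> RR. \<forall>e\<in>keys p. total_deg e \<le> n}"

lemma deg_le_mult: "p \<in> deg_le a \<Longrightarrow> q \<in> deg_le b \<Longrightarrow> p * q \<in> deg_le (a + b)"
proof -
  assume p: "p \<in> deg_le a" and q: "q \<in> deg_le b"
  have "total_deg e \<le> a + b" if e: "e \<in> keys (p * q)" for e
  proof -
    obtain x y where "e = x + y" "x \<in> keys p" "y \<in> keys q"
      using subsetD[OF Poly_Mapping.keys_mult e] by auto
    then show ?thesis using p q by (auto simp: deg_le_def total_deg_add intro!: add_mono)
  qed
  then show ?thesis using p q by (auto simp: deg_le_def)
qed

lemma deg_le_mono: "a \<le> b \<Longrightarrow> deg_le a \<subseteq> deg_le b"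
  by (auto simp: deg_le_def)

lemma one_deg_le: "1 \<in> deg_le 0"
  by (simp add: deg_le_def)

lemma deg_le_power: "p \<in> deg_le a \<Longrightarrow> p ^ n \<in> deg_le (n * a)"
  by (induction n) (auto simp: one_deg_le intro: deg_le_mult)

lemma monval_deg_le:
  "(\<And>i. i < length \<alpha> \<Longrightarrow> f i \<in> deg_le D) \<Longrightarrow> set \<alpha> \<subseteq> {..N} \<Longrightarrow> monval f \<alpha> \<in> deg_le (length \<alpha> * (N * D))"
proof (induction \<alpha> arbitrary: f)
  case (Cons a \<alpha>)
  have "monval (f \<circ> Suc) \<alpha> \<in> deg_le (length \<alpha> * (N * D))"
    by (rule Cons.IH) (use Cons.prems in auto)
  moreover have "f 0 ^ a \<in> deg_le (N * D)"
    using deg_le_power[of "f 0" D a] Cons.prems deg_le_mono[of "a * D" "N * D"] by auto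
  ultimately have "f 0 ^ a * monval (f \<circ> Suc) \<alpha> \<in> deg_le (N * D + length \<alpha> * (N * D))"
    by (intro deg_le_mult)
  then show ?case by simp
qed (simp add: one_deg_le)

section \<open>Growth of the quotient by \<open>I\<close> under a reduction with \<open>s\<close>
  generators\<close>

context
  fixes I :: "'k mpol set" and y :: "nat \<Rightarrow> 'k mpol" and s n0 :: nat
  assumes I: "R.is_ideal I" "hc_closed I" and y: "\<And>i. i < s \<Longrightarrow> y i \<in> lforms 1"
    and n0: "lforms n0 \<subseteq> R.Gen (y ` {..<s} \<union> I)"
begin

text \<open>Modulo \<open>I\<close>, the ring is generated as a module over k[y] by the monomials of
  degree below \<open>n0\<close>. This is the truncation of that generating set to exponents at most
  \<open>n\<close>, and its size grows like the power \<open>s\<close> of \<open>n\<close>.\<close>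

definition spanning :: "nat \<Rightarrow> 'k mpol set" where
  "spanning n = (\<lambda>(\<beta>, e). monval y \<beta> * monomial e) ` (box s n \<times> (\<Union>j<n0. mons {..<m} j))"

lemma spanning_mono: "a \<le> b \<Longrightarrow> spanning a \<subseteq> spanning b"
  unfolding spanning_def by (intro image_mono Sigma_mono) (auto simp: box_def)

lemma finite_spanning: "finite (spanning n)"
  unfolding spanning_def by (intro finite_imageI finite_cartesian_product finite_box finite_UN_I card_mons m1) auto

lemma card_spanning: "card (spanning n) \<le> Suc n ^ s * card (\<Union>j<n0. mons {..<m} j)"
  unfolding spanning_def
  by (rule order.trans[OF card_image_le])
    (auto simp: card_cartesian_product card_box finite_box card_mons[OF m1])

text \<open>In degrees below \<open>n0\<close> all exponents of the \<open>y i\<close> are 0. From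
  \<open>n0\<close> on, a form is a combination of the \<open>y i\<close> modulo \<open>I\<close>
  whose coefficients have degree one less, so induction applies to these.\<close>

lemma lform_in_span: "p \<in> lforms n \<Longrightarrow> p \<in> mpol.span (spanning n \<union> I)"
proof (induction n arbitrary: p rule: less_induct)
  case (less n)
  show ?case
  proof (cases "n < n0")
    case True
    have "monomial e \<in> spanning n" if "e \<in> mons {..<m} n" for e
      unfolding spanning_def
      by (rule image_eqI[of _ _ "(replicate s 0, e)"])
        (use True that in \<open>auto simp: monval_replicate_0 box_def\<close>)
    then have "(\<Sum>e\<in>keys p. single 0 (lookup p e) * monomial e) \<in> mpol.span (spanning n \<union> I)"
      using less.prems by (intro mpol.span_sum mpol.span_scale mpol.span_base) (auto simp: forms_lookup)
    then show ?thesis using form_eq_sum_monomials[of p] by simp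
  next
    case False
    have "R.is_ideal (R.Gen (y ` {..<s} \<union> I))" by (rule Gen_family_ideal[OF y I(1)])
    then have "lforms n \<subseteq> R.Gen (y ` {..<s} \<union> I)" using False by (intro forms_subset_add[OF _ n0]) auto
    then have "p \<in> R.Gen (y ` {..<s} \<union> I)" using less.prems by auto
    from Gen_linear_decomp[OF y I this less.prems] obtain g h
      where g: "\<forall>i<s. g i \<in> (if 1 \<le> n then lforms (n - 1) else {0})" and h: "h \<in> I"
        and p: "p = (\<Sum>i<s. g i * y i) + h" by blast
    have "g i * y i \<in> mpol.span (spanning n \<union> I)" if i: "i < s" for i
    proof (cases "1 \<le> n")
      case True
      then have "g i \<in> mpol.span (spanning (n - 1) \<union> I)" using g i by (intro less.IH) auto
      moreover have "mpol.span (spanning (n - 1) \<union> I) \<subseteq> {x. x * y i \<in> mpol.span (spanning n \<union> I)}"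
      proof (rule mpol.span_minimal)
        show "mpol.subspace {x. x * y i \<in> mpol.span (spanning n \<union> I)}"
          by (rule mpol.subspaceI)
            (auto simp: distrib_right mult.assoc intro: mpol.span_zero mpol.span_add mpol.span_scale)
        show "spanning (n - 1) \<union> I \<subseteq> {x. x * y i \<in> mpol.span (spanning n \<union> I)}"
        proof
          fix x assume "x \<in> spanning (n - 1) \<union> I"
          then show "x \<in> {x. x * y i \<in> mpol.span (spanning n \<union> I)}"
          proof
            assume "x \<in> spanning (n - 1)"
            then obtain \<beta> e where b: "\<beta> \<in> box s (n - 1)" "e \<in> (\<Union>j<n0. mons {..<m} j)"
              "x = monval y \<beta> * monomial e" unfolding spanning_def by auto
            \<comment> \<open>Multiplication by \<open>y i\<close> raises one exponent by 1, from at
              most \<open>n - 1\<close> to at most \<open>n\<close>.\<close>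
            have "x * y i = monval y (\<beta>[i := Suc (\<beta> ! i)]) * monomial e"
              using b i monval_list_update[of i \<beta> y] by (simp add: box_def mult_ac)
            moreover have "\<beta>[i := Suc (\<beta> ! i)] \<in> box s n"
            proof -
              have "set (\<beta>[i := Suc (\<beta> ! i)]) \<subseteq> insert (Suc (\<beta> ! i)) (set \<beta>)" by (rule set_update_subset_insert)
              moreover have "\<beta> ! i \<in> set \<beta>" using b(1) i by (auto simp: box_def)
              ultimately show ?thesis using b(1) True by (fastforce simp: box_def)
            qed
            ultimately have "x * y i \<in> spanning n" using b(2) unfolding spanning_def by force
            then show ?thesis by (auto intro: mpol.span_base)
          next
            assume "x \<in> I"
            then have "y i * x \<in> I" using y[OF i] form_poly by (intro R.ideal_mult[OF I(1)]) auto
            then have "x * y i \<in> I" by (simp only: mult.commute)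
            then show ?thesis by (auto intro: mpol.span_base)
          qed
        qed
      qed
      ultimately show ?thesis by auto
    next
      case False
      then show ?thesis using g i by (simp add: mpol.span_zero)
    qed
    then have "(\<Sum>i<s. g i * y i) \<in> mpol.span (spanning n \<union> I)" by (intro mpol.span_sum) auto
    then show ?thesis unfolding p by (rule mpol.span_add) (use h in \<open>auto intro: mpol.span_base\<close>)
  qed
qed

lemma deg_le_in_span: "deg_le n \<subseteq> mpol.span (spanning n \<union> I)"
proof
  fix p assume p: "p \<in> deg_le n"
  from sum_hc[of p] obtain N where N: "\<forall>M\<ge>N. p = (\<Sum>j\<le>M. hc j p)" ..
  have "p = (\<Sum>j\<le>max N n. hc j p)" by (rule N[rule_format]) simp
  also have "\<dots> = (\<Sum>j\<le>n. hc j p)"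
  proof (rule sum.mono_neutral_right)
    show "\<forall>j\<in>{..max N n} - {..n}. hc j p = 0"
    proof
      fix j assume j: "j \<in> {..max N n} - {..n}"
      show "hc j p = 0"
      proof (rule poly_mapping_eqI)
        fix e
        have "e \<notin> keys p" if "total_deg e = j" using p j that by (auto simp: deg_le_def)
        then show "lookup (hc j p) e = lookup 0 e" by (auto simp: lookup_hc when_def in_keys_iff)
      qed
    qed
  qed auto
  finally have eq: "p = (\<Sum>j\<le>n. hc j p)" .
  have "(\<Sum>j\<le>n. hc j p) \<in> mpol.span (spanning n \<union> I)"
  proof (rule mpol.span_sum)
    fix j assume j: "j \<in> {..n}"
    have "hc j p \<in> lforms j" using p by (intro hc_in_forms) (auto simp: deg_le_def)
    then have "hc j p \<in> mpol.span (spanning j \<union> I)" by (rule lform_in_span)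
    then show "hc j p \<in> mpol.span (spanning n \<union> I)"
      using mpol.span_mono[of "spanning j \<union> I" "spanning n \<union> I"] spanning_mono[of j n] j by auto
  qed
  then show "p \<in> mpol.span (spanning n \<union> I)" using eq by simp
qed

theorem prime_chain_length_le:
  assumes P: "\<And>i. i \<le> l \<Longrightarrow> R.is_prime (P i)" "\<And>i. i < l \<Longrightarrow> P i \<subset> P (Suc i)" "I \<subseteq> P 0"
  shows "l \<le> s"
proof (rule ccontr)
  assume "\<not> l \<le> s"
  then have ls: "s < l" by simp
  have "\<forall>i\<in>{..<l}. \<exists>x. x \<in> P (Suc i) \<and> x \<notin> P i" using P(2) by blast
  from bchoice[OF this] obtain f where f: "\<forall>i\<in>{..<l}. f i \<in> P (Suc i) \<and> f i \<notin> P i" ..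
  have fR: "f i \<in> RR" if "i < l" for i
    using f that P(1)[of "Suc i"] R.ideal_sub[of "P (Suc i)"] by (auto simp: R.primeideal_iff)
  define D where "D = (\<Sum>i<l. \<Sum>e\<in>keys (f i). total_deg e)"
  have fD: "f i \<in> deg_le D" if i: "i < l" for i
  proof -
    have "total_deg e \<le> D" if "e \<in> keys (f i)" for e
    proof -
      have "total_deg e \<le> (\<Sum>e\<in>keys (f i). total_deg e)" using that by (intro member_le_sum) auto
      also have "\<dots> \<le> D" unfolding D_def using i by (intro member_le_sum[of i "{..<l}"]) auto
      finally show ?thesis .
    qed
    then show ?thesis using fR[OF i] by (simp add: deg_le_def)
  qed
  define K where "K = card (\<Union>j<n0. mons {..<m} j)"
  \<comment> \<open>The left side counts products of the \<open>f i\<close>, independent modulo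
    \<open>I\<close> because \<open>I \<subseteq> P 0\<close>. All of them have degree at most
    \<open>l * (N * D)\<close>, and the right side bounds a spanning set for that degree.\<close>
  have bound: "Suc N ^ l \<le> Suc (l * (N * D)) ^ s * K" for N
  proof -
    have "card (box l N) \<le> card (spanning (l * (N * D)))"
    proof (rule mpol.family_card_le_mod[OF ideal_subspace[OF I(1)] finite_box finite_spanning])
      fix \<alpha> assume "\<alpha> \<in> box l N"
      then have "monval f \<alpha> \<in> deg_le (l * (N * D))"
        using monval_deg_le[of \<alpha> f D N] fD by (auto simp: box_def)
      then show "monval f \<alpha> \<in> mpol.span (spanning (l * (N * D)) \<union> I)" using deg_le_in_span by blast
    next
      fix c assume "(\<Sum>\<alpha>\<in>box l N. single 0 (c \<alpha>) * monval f \<alpha>) \<in> I"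
      then have "(\<Sum>\<alpha>\<in>box l N. single 0 (c \<alpha>) * monval f \<alpha>) \<in> P 0" using P(3) by blast
      then show "\<forall>\<alpha>\<in>box l N. c \<alpha> = 0"
        by (intro chain_monomials_independent[of l P f]) (use P f in auto)
    qed
    also have "\<dots> \<le> Suc (l * (N * D)) ^ s * K" unfolding K_def by (rule card_spanning)
    finally show ?thesis by (simp add: card_box)
  qed
  \<comment> \<open>With this \<open>N\<close> the bound is at most \<open>N * Suc N ^ s\<close>,
    which is less than \<open>Suc N ^ Suc s\<close> and hence less than
    \<open>Suc N ^ l\<close>.\<close>
  define N where "N = K * Suc (l * D) ^ s"
  have "Suc (l * (N * D)) \<le> Suc (l * D) * Suc N" by (simp add: algebra_simps)
  then have "Suc (l * (N * D)) ^ s \<le> (Suc (l * D) * Suc N) ^ s" by (rule power_mono) simp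
  then have "Suc N ^ l \<le> (Suc (l * D) * Suc N) ^ s * K"
    using bound[of N] by (meson mult_le_mono1 order.trans)
  also have "\<dots> = N * Suc N ^ s" by (simp only: N_def power_mult_distrib mult_ac)
  also have "\<dots> < Suc N * Suc N ^ s" by simp
  also have "\<dots> \<le> Suc N ^ l" using ls by (metis Suc_leI le_add1 plus_1_eq_Suc power_Suc power_increasing)
  finally show False by simp
qed

end

end

section \<open>Quotient rings\<close>

context csubring begin

context
  fixes I assumes I: "is_ideal I"
begin

interpretation cring "ring_on C" by (rule cring)
interpretation I: ideal I "ring_on C" by (rule I)

abbreviation coset :: "'a \<Rightarrow> 'a set" where
  "coset p \<equiv> I +>\<^bsub>ring_on C\<^esub> p"

lemma coset_eq: "coset p = (\<lambda>i. i + p) ` I"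
  by (auto simp: a_r_coset_def' ring_on_def)

lemma coset_eq_iff:
  assumes "p \<in> C" "q \<in> C"
  shows "coset p = coset q \<longleftrightarrow> p - q \<in> I"
proof
  assume "coset p = coset q"
  then have "0 + p \<in> coset q" unfolding coset_eq using ideal_zero[OF I] by auto
  then obtain i where "i \<in> I" "p = i + q" unfolding coset_eq by auto
  then show "p - q \<in> I" by simp
next
  assume pq: "p - q \<in> I"
  show "coset p = coset q"
    unfolding coset_eq
  proof (intro subset_antisym subsetI)
    fix x assume "x \<in> (\<lambda>i. i + p) ` I"
    then obtain i where "i \<in> I" "x = i + p" by auto
    then have "x = (i + (p - q)) + q" "i + (p - q) \<in> I" using ideal_add[OF I _ pq] by auto
    then show "x \<in> (\<lambda>i. i + q) ` I" by blast
  next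
    fix x assume "x \<in> (\<lambda>i. i + q) ` I"
    then obtain i where "i \<in> I" "x = i + q" by auto
    then have "x = (i - (p - q)) + p" "i - (p - q) \<in> I" using ideal_minus[OF I _ pq] by auto
    then show "x \<in> (\<lambda>i. i + p) ` I" by blast
  qed
qed

text \<open>Because \<open>I \<subseteq> J\<close>, the ideal \<open>J\<close> is a union of cosets,
  so its image determines it.\<close>

lemma coset_mem_image_iff:
  assumes "is_ideal J" "I \<subseteq> J" "p \<in> C"
  shows "coset p \<in> coset ` J \<longleftrightarrow> p \<in> J"
proof
  assume "coset p \<in> coset ` J"
  then obtain q where q: "q \<in> J" "coset p = coset q" by auto
  then have "p - q \<in> J" using coset_eq_iff[of p q] assms ideal_sub[OF assms(1)] by auto
  then have "(p - q) + q \<in> J" by (rule ideal_add[OF assms(1) _ q(1)])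
  then show "p \<in> J" by simp
qed auto

lemma carrier_Quot: "carrier (ring_on C Quot I) = coset ` C"
  by (auto simp: FactRing_def A_RCOSETS_def' ring_on_def)

lemma coset_mult: "p \<in> C \<Longrightarrow> q \<in> C \<Longrightarrow> coset p \<otimes>\<^bsub>ring_on C Quot I\<^esub> coset q = coset (p * q)"
  using ring_hom_mult[OF I.rcos_ring_hom, of p q] by (simp add: ring_on_def)

lemma ideal_coset_image: "is_ideal J \<Longrightarrow> ideal (coset ` J) (ring_on C Quot I)"
  by (rule ring_ideal_imp_quot_ideal[OF I])

lemma ideal_coset_vimage: "ideal J (ring_on C Quot I) \<Longrightarrow> ideal {r \<in> C. coset r \<in> J} (ring_on C)"
  using ring_hom_ring.ideal_vimage[OF I.rcos_ring_hom_ring, of J] by (simp add: ring_on_def)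

lemma I_sub_coset_vimage:
  assumes J: "ideal J (ring_on C Quot I)"
  shows "I \<subseteq> {r \<in> C. coset r \<in> J}"
proof
  fix i assume i: "i \<in> I"
  have "0 \<in> {r \<in> C. coset r \<in> J}" by (rule ideal_zero[OF ideal_coset_vimage[OF J]])
  moreover have "coset i = coset 0" using i ideal_sub[OF I] by (subst coset_eq_iff) auto
  ultimately show "i \<in> {r \<in> C. coset r \<in> J}" using i ideal_sub[OF I] by auto
qed

lemma coset_image_vimage:
  assumes J: "ideal J (ring_on C Quot I)"
  shows "coset ` {r \<in> C. coset r \<in> J} = J"
proof -
  have "J \<subseteq> coset ` C"
    using ideal.Icarr[OF J] unfolding carrier_Quot by blast
  then show ?thesis by auto
qed

text \<open>Minimality is used twice: in the quotient, and in the ring itself for the preimage of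
  the generated ideal.\<close>

lemma Quot_genideal:
  assumes S: "S \<subseteq> C"
  shows "Idl\<^bsub>ring_on C Quot I\<^esub> (coset ` S) = coset ` Gen (S \<union> I)"
proof
  interpret Q: ring "ring_on C Quot I" by (rule I.quotient_is_ring)
  have SI: "S \<union> I \<subseteq> C" using S ideal_sub[OF I] by auto
  have SG: "S \<union> I \<subseteq> Gen (S \<union> I)" by (rule Gen_self[OF SI])
  have sub: "coset ` S \<subseteq> carrier (ring_on C Quot I)" using S unfolding carrier_Quot by auto
  show "Idl\<^bsub>ring_on C Quot I\<^esub> (coset ` S) \<subseteq> coset ` Gen (S \<union> I)"
    by (rule Q.genideal_minimal[OF ideal_coset_image[OF Gen_ideal[OF SI]]]) (use SG in auto)
  let ?J = "Idl\<^bsub>ring_on C Quot I\<^esub> (coset ` S)"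
  have J: "ideal ?J (ring_on C Quot I)" by (rule Q.genideal_ideal[OF sub])
  have "Gen (S \<union> I) \<subseteq> {r \<in> C. coset r \<in> ?J}"
  proof (rule Gen_minimal[OF ideal_coset_vimage[OF J]])
    show "S \<union> I \<subseteq> {r \<in> C. coset r \<in> ?J}"
      using I_sub_coset_vimage[OF J] Q.genideal_self[OF sub] S by auto
  qed
  then show "coset ` Gen (S \<union> I) \<subseteq> ?J" by auto
qed

lemma primeideal_coset_vimage:
  assumes "primeideal P (ring_on C Quot I)"
  shows "primeideal {r \<in> C. coset r \<in> P} (ring_on C)"
  using ring_hom_ring.primeideal_vimage[OF I.rcos_ring_hom_ring cring assms] by (simp add: ring_on_def)

lemma primeideal_coset_image:
  assumes P: "is_prime P" "I \<subseteq> P"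
  shows "primeideal (coset ` P) (ring_on C Quot I)"
proof -
  have P': "is_ideal P" "P \<noteq> C" "\<forall>a\<in>C. \<forall>b\<in>C. a * b \<in> P \<longrightarrow> a \<in> P \<or> b \<in> P"
    using P(1) unfolding primeideal_iff by auto
  have mem: "coset p \<in> coset ` P \<longleftrightarrow> p \<in> P" if "p \<in> C" for p
    by (rule coset_mem_image_iff[OF P'(1) P(2) that])
  show ?thesis
  proof (rule primeidealI[OF ideal_coset_image[OF P'(1)] I.quotient_is_cring[OF cring]])
    show "carrier (ring_on C Quot I) \<noteq> coset ` P"
    proof
      assume "carrier (ring_on C Quot I) = coset ` P"
      then have eq: "coset ` C = coset ` P" unfolding carrier_Quot .
      have "C \<subseteq> P"
      proof
        fix x assume x: "x \<in> C"
        then have "coset x \<in> coset ` P" unfolding eq[symmetric] by (rule imageI)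
        then show "x \<in> P" using mem[OF x] by simp
      qed
      then show False using P'(2) ideal_sub[OF P'(1)] by auto
    qed
    fix a b assume "a \<in> carrier (ring_on C Quot I)" "b \<in> carrier (ring_on C Quot I)"
      and ab: "a \<otimes>\<^bsub>ring_on C Quot I\<^esub> b \<in> coset ` P"
    then obtain p q where pq: "p \<in> C" "q \<in> C" "a = coset p" "b = coset q" unfolding carrier_Quot by auto
    then have "p * q \<in> P" using ab mem[of "p * q"] coset_mult[of p q] by auto
    then show "a \<in> coset ` P \<or> b \<in> coset ` P" using P'(3) pq by blast
  qed
qed

lemma chain_le_krull_dim:
  assumes "\<forall>i\<le>n. is_prime (P i)" "\<forall>i<n. P i \<subset> P (Suc i)" "I \<subseteq> P 0"
  shows "enat n \<le> krull_dim (ring_on C Quot I)"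
proof -
  have IP: "I \<subseteq> P i" if "i \<le> n" for i
    using that
  proof (induction i)
    case (Suc i)
    have "P i \<subset> P (Suc i)" using assms(2) Suc.prems by auto
    then show ?case using Suc by auto
  qed (use assms(3) in simp)
  have id: "is_ideal (P i)" if "i \<le> n" for i
    using assms(1) that by (simp add: primeideal_iff)
  have "coset ` P i \<subset> coset ` P (Suc i)" if i: "i < n" for i
  proof
    show "coset ` P i \<subseteq> coset ` P (Suc i)" using assms(2) i by blast
    obtain x where x: "x \<in> P (Suc i)" "x \<notin> P i" using assms(2) i by blast
    then have "coset x \<notin> coset ` P i"
      using coset_mem_image_iff[OF id[of i] IP[of i], of x] ideal_sub[OF id[of "Suc i"]] i by auto
    then show "coset ` P i \<noteq> coset ` P (Suc i)" using x(1) by blast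
  qed
  moreover have "primeideal (coset ` P i) (ring_on C Quot I)" if "i \<le> n" for i
    using assms(1) that IP by (intro primeideal_coset_image) auto
  ultimately have "(\<forall>i\<le>n. primeideal (coset ` P i) (ring_on C Quot I)) \<and>
      (\<forall>i<n. coset ` P i \<subset> coset ` P (Suc i))" by blast
  then have "\<exists>P. (\<forall>i\<le>n. primeideal (P i) (ring_on C Quot I)) \<and> (\<forall>i<n. P i \<subset> P (Suc i))"
    by (rule exI[of _ "\<lambda>i. coset ` P i"])
  then show ?thesis unfolding krull_dim_def by (intro Sup_upper) blast
qed

text \<open>Preimages of a chain of primes of the quotient form a chain above \<open>I\<close>. The
  inclusions stay strict because taking images of the preimages recovers the original
  primes.\<close>

lemma krull_dim_le:
  assumes "\<And>n P. \<forall>i\<le>n. is_prime (P i) \<Longrightarrow> \<forall>i<n. P i \<subset> P (Suc i) \<Longrightarrow> I \<subseteq> P 0 \<Longrightarrow> n \<le> s"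
  shows "krull_dim (ring_on C Quot I) \<le> enat s"
  unfolding krull_dim_def
proof (rule Sup_least, clarify)
  fix n P assume P: "\<forall>i\<le>n. primeideal (P i) (ring_on C Quot I)" "\<forall>i<n. P i \<subset> P (Suc i)"
  let ?Q = "\<lambda>i. {r \<in> C. coset r \<in> P i}"
  have id: "ideal (P i) (ring_on C Quot I)" if "i \<le> n" for i
    using P(1) that by (auto simp: primeideal_def)
  have "n \<le> s"
  proof (rule assms[of n ?Q])
    show "\<forall>i\<le>n. is_prime (?Q i)" using P(1) primeideal_coset_vimage by blast
    show "\<forall>i<n. ?Q i \<subset> ?Q (Suc i)"
    proof (intro allI impI psubsetI)
      fix i assume i: "i < n"
      show "?Q i \<subseteq> ?Q (Suc i)" using P(2) i by blast
      show "?Q i \<noteq> ?Q (Suc i)"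
      proof
        assume "?Q i = ?Q (Suc i)"
        then have "coset ` ?Q i = coset ` ?Q (Suc i)" by (rule arg_cong)
        moreover have "coset ` ?Q i = P i" using i by (intro coset_image_vimage id) simp
        moreover have "coset ` ?Q (Suc i) = P (Suc i)" using i by (intro coset_image_vimage id) simp
        ultimately have "P i = P (Suc i)" by (simp only:)
        then show False using P(2) i by blast
      qed
    qed
    show "I \<subseteq> ?Q 0" by (rule I_sub_coset_vimage[OF id]) simp
  qed
  then show "enat n \<le> enat s" by simp
qed

end

end

section \<open>Reductions of graded quotients\<close>

context poly_csubring begin

context
  fixes I assumes I: "R.is_ideal I"
begin

abbreviation Qgr :: "nat \<Rightarrow> 'a mpol set set" where
  "Qgr \<equiv> quot_grading (ring_on (polys C V)) (forms C V) I"

abbreviation qcl :: "'a mpol \<Rightarrow> 'a mpol set" where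
  "qcl p \<equiv> I +>\<^bsub>ring_on (polys C V)\<^esub> p"

text \<open>Turns the condition that defines reductions and reduction numbers into an inclusion in
  the polynomial ring.\<close>

lemma coset_image_Int_grading_iff:
  assumes J: "R.is_ideal J" "I \<subseteq> J"
  shows "qcl ` J \<inter> Qgr n = Qgr n \<longleftrightarrow> forms C V n \<subseteq> J"
proof -
  have "qcl ` J \<inter> Qgr n = Qgr n \<longleftrightarrow> (\<forall>p\<in>forms C V n. qcl p \<in> qcl ` J)"
    unfolding quot_grading_def Int_absorb1 Int_commute[of "qcl ` J"] inf.absorb_iff1[symmetric] image_subset_iff ..
  also have "\<dots> \<longleftrightarrow> (\<forall>p\<in>forms C V n. p \<in> J)"
    by (intro ball_cong refl R.coset_mem_image_iff[OF I J form_poly])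
  finally show ?thesis by blast
qed

lemma reduction_number_wrt_coset_image:
  assumes J: "R.is_ideal J" "I \<subseteq> J"
  shows "reduction_number_wrt B Qgr (qcl ` J) = (LEAST n. forms C V (Suc n) \<subseteq> J)"
  unfolding reduction_number_wrt_def coset_image_Int_grading_iff[OF J] ..

text \<open>Linear forms of the quotient are lifted to linear forms of the polynomial ring, and "all
  large degrees" shrinks to one degree by \<open>forms_subset_add\<close>.\<close>

lemma is_reduction_iff:
  "is_reduction (ring_on (polys C V) Quot I) Qgr Q \<longleftrightarrow>
     (\<exists>L\<subseteq>forms C V 1. Q = qcl ` R.Gen (L \<union> I) \<and> (\<exists>n. forms C V n \<subseteq> R.Gen (L \<union> I)))"
proof -
  have LI: "R.is_ideal (R.Gen (L \<union> I))" "I \<subseteq> R.Gen (L \<union> I)"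
    and LG: "Idl\<^bsub>ring_on (polys C V) Quot I\<^esub> (qcl ` L) = qcl ` R.Gen (L \<union> I)"
    if L: "L \<subseteq> forms C V 1" for L
  proof -
    have L': "L \<subseteq> polys C V" using L forms_polys[of C V 1] by blast
    then have s: "L \<union> I \<subseteq> polys C V" using R.ideal_sub[OF I] by blast
    show "R.is_ideal (R.Gen (L \<union> I))" by (rule R.Gen_ideal[OF s])
    show "I \<subseteq> R.Gen (L \<union> I)" using R.Gen_self[OF s] by blast
    show "Idl\<^bsub>ring_on (polys C V) Quot I\<^esub> (qcl ` L) = qcl ` R.Gen (L \<union> I)" by (rule R.Quot_genideal[OF I L'])
  qed
  have pow: "(\<exists>N. \<forall>n\<ge>N. qcl ` R.Gen (L \<union> I) \<inter> Qgr n = Qgr n) \<longleftrightarrow> (\<exists>n. forms C V n \<subseteq> R.Gen (L \<union> I))"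
    if L: "L \<subseteq> forms C V 1" for L
    unfolding coset_image_Int_grading_iff[OF LI[OF L]] using forms_subset_add[OF LI(1)[OF L]] by blast
  show ?thesis
  proof
    assume "is_reduction (ring_on (polys C V) Quot I) Qgr Q"
    then obtain M N where M: "M \<subseteq> Qgr 1" "Q = Idl\<^bsub>ring_on (polys C V) Quot I\<^esub> M" "\<forall>n\<ge>N. Q \<inter> Qgr n = Qgr n"
      unfolding is_reduction_def by blast
    define L where "L = {p \<in> forms C V 1. qcl p \<in> M}"
    have L: "L \<subseteq> forms C V 1" by (auto simp: L_def)
    have "M = qcl ` L" using M(1) by (auto simp: L_def quot_grading_def)
    then have Q: "Q = qcl ` R.Gen (L \<union> I)" using M(2) LG[OF L] by simp
    then have "\<exists>n. forms C V n \<subseteq> R.Gen (L \<union> I)" using M(3) pow[OF L] by blast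
    then show "\<exists>L\<subseteq>forms C V 1. Q = qcl ` R.Gen (L \<union> I) \<and> (\<exists>n. forms C V n \<subseteq> R.Gen (L \<union> I))"
      using L Q by blast
  next
    assume "\<exists>L\<subseteq>forms C V 1. Q = qcl ` R.Gen (L \<union> I) \<and> (\<exists>n. forms C V n \<subseteq> R.Gen (L \<union> I))"
    then obtain L where L: "L \<subseteq> forms C V 1" "Q = qcl ` R.Gen (L \<union> I)" "\<exists>n. forms C V n \<subseteq> R.Gen (L \<union> I)" by blast
    have "qcl ` L \<subseteq> Qgr 1" using L(1) unfolding quot_grading_def by blast
    moreover have "Q = Idl\<^bsub>ring_on (polys C V) Quot I\<^esub> (qcl ` L)" using LG[OF L(1)] L(2) by simp
    moreover have "\<exists>N. \<forall>n\<ge>N. Q \<inter> Qgr n = Qgr n" using pow[OF L(1)] L(2,3) by simp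
    ultimately show "is_reduction (ring_on (polys C V) Quot I) Qgr Q"
      unfolding is_reduction_def by blast
  qed
qed

end

end

section \<open>Minimal reductions\<close>

context inf_field_poly begin

context
  fixes I :: "'k mpol set" and d :: nat
  assumes I: "R.is_ideal I" "hc_closed I"
    and dim: "krull_dim (ring_on RR Quot I) = enat d"
begin

lemma dim_le_family:
  assumes "\<And>i. i < s \<Longrightarrow> y i \<in> lforms 1" "lforms n \<subseteq> R.Gen (y ` {..<s} \<union> I)"
  shows "d \<le> s"
proof -
  have "krull_dim (ring_on RR Quot I) \<le> enat s"
  proof (rule R.krull_dim_le[OF I(1)])
    fix l and P :: "nat \<Rightarrow> 'k mpol set"
    assume P: "\<forall>i\<le>l. R.is_prime (P i)" "\<forall>i<l. P i \<subset> P (Suc i)" "I \<subseteq> P 0"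
    show "l \<le> s"
      by (rule prime_chain_length_le[OF I assms, where P = P]) (use P in auto)
  qed
  then show ?thesis using dim by simp
qed

lemma ex_reduction_in_subspace:
  assumes L: "L \<subseteq> lforms 1" "0 \<in> L" "\<And>y b \<tau>. y \<in> L \<Longrightarrow> b \<in> L \<Longrightarrow> y + single 0 \<tau> * b \<in> L"
    and N: "lforms N \<subseteq> R.Gen (L \<union> I)"
  shows "\<exists>y n. (\<forall>i<d. y i \<in> L) \<and> lforms n \<subseteq> R.Gen (y ` {..<d} \<union> I)"
proof (rule ex_generic_reduction[OF L I N])
  fix P :: "nat \<Rightarrow> 'k mpol set"
  assume P: "\<forall>i\<le>Suc d. R.is_prime (P i)" "\<forall>i<Suc d. P i \<subset> P (Suc i)"
  show "\<not> I \<subseteq> P 0"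
  proof
    assume "I \<subseteq> P 0"
    from R.chain_le_krull_dim[OF I(1) P this] show False using dim by simp
  qed
qed

lemma ex_reduction:
  assumes L: "L \<subseteq> lforms 1" and N: "lforms N \<subseteq> R.Gen (L \<union> I)"
  shows "\<exists>y n. (\<forall>i<d. y i \<in> lforms 1) \<and> y ` {..<d} \<subseteq> R.Gen (L \<union> I) \<and> lforms n \<subseteq> R.Gen (y ` {..<d} \<union> I)"
proof -
  have LI: "L \<union> I \<subseteq> RR" using L forms_polys[of UNIV "{..<m}" 1] R.ideal_sub[OF I(1)] by blast
  let ?J = "R.Gen (L \<union> I)"
  have J: "R.is_ideal ?J" by (rule R.Gen_ideal[OF LI])
  \<comment> \<open>All linear forms of the reduction, and not just its generators: the pencil
    argument needs a linear space, and the family found has to stay inside the reduction.\<close>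
  let ?L = "lforms 1 \<inter> ?J"
  have "L \<subseteq> ?L" using L R.Gen_self[OF LI] by blast
  have LI': "?L \<union> I \<subseteq> RR" using forms_polys[of UNIV "{..<m}" 1] R.ideal_sub[OF I(1)] by blast
  have "?J \<subseteq> R.Gen (?L \<union> I)"
    by (rule R.Gen_mono[OF LI']) (use \<open>L \<subseteq> ?L\<close> R.Gen_self[OF LI'] in blast)
  then have "lforms N \<subseteq> R.Gen (?L \<union> I)" using N by blast
  moreover have "0 \<in> ?L" using R.ideal_zero[OF J] by simp
  moreover have "y + single 0 \<tau> * b \<in> ?L" if "y \<in> ?L" "b \<in> ?L" for y b \<tau>
    using that by (auto intro!: forms_add forms_scale R.ideal_add[OF J] R.ideal_mult[OF J] const_poly)
  ultimately have "\<exists>y n. (\<forall>i<d. y i \<in> ?L) \<and> lforms n \<subseteq> R.Gen (y ` {..<d} \<union> I)"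
    by (intro ex_reduction_in_subspace) auto
  then show ?thesis by blast
qed

lemma lforms_0_const: "p \<in> lforms 0 \<Longrightarrow> p = single 0 (lookup p 0)"
  by (intro poly_mapping_eqI)
    (auto simp: forms_lookup lookup_single when_def mons_def total_deg_eq_0_iff in_keys_iff subset_iff)

text \<open>Modulo \<open>I\<close>, the set \<open>L\<close> lies in the span of the
  \<open>d\<close> forms \<open>y i\<close>. A basis \<open>B\<close> of it modulo \<open>I\<close>
  still generates a reduction and so has at least \<open>d\<close> elements. Hence it has as many
  elements as the family \<open>y\<close>, and it spans the \<open>y i\<close> too.\<close>

lemma reduction_eq_of_le:
  assumes y: "\<And>i. i < d \<Longrightarrow> y i \<in> lforms 1"
    and L: "L \<subseteq> lforms 1" "L \<subseteq> R.Gen (y ` {..<d} \<union> I)" and n: "lforms n \<subseteq> R.Gen (L \<union> I)"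
  shows "R.Gen (L \<union> I) = R.Gen (y ` {..<d} \<union> I)"
proof
  have yI: "y ` {..<d} \<union> I \<subseteq> RR"
    by (rule Un_least[OF lforms_family_poly[OF y] R.ideal_sub[OF I(1)]])
  have LI: "L \<union> I \<subseteq> RR" using L(1) forms_polys[of UNIV "{..<m}" 1] R.ideal_sub[OF I(1)] by blast
  show "R.Gen (L \<union> I) \<subseteq> R.Gen (y ` {..<d} \<union> I)"
    by (rule R.Gen_mono[OF yI]) (use L(2) R.Gen_self[OF yI] in blast)
  have "L \<subseteq> mpol.span (y ` {..<d} \<union> I)"
  proof
    fix l assume l: "l \<in> L"
    have "l \<in> R.Gen (y ` {..<d} \<union> I)" "l \<in> lforms 1" using L l by auto
    \<comment> \<open>In degree 1 the coefficients have degree 0, so membership in the ideal becomes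
      membership in a linear span.\<close>
    from Gen_linear_decomp[OF y I this] obtain g h
      where g: "\<forall>i<d. g i \<in> lforms 0" and h: "h \<in> I" and eq: "l = (\<Sum>i<d. g i * y i) + h" by auto
    have "g i * y i \<in> mpol.span (y ` {..<d} \<union> I)" if i: "i < d" for i
    proof -
      have "single 0 (lookup (g i) 0) * y i \<in> mpol.span (y ` {..<d} \<union> I)"
        by (rule mpol.span_scale, rule mpol.span_base) (use i in blast)
      then show ?thesis using lforms_0_const g i by metis
    qed
    then have "(\<Sum>i<d. g i * y i) \<in> mpol.span (y ` {..<d} \<union> I)" by (intro mpol.span_sum) auto
    then show "l \<in> mpol.span (y ` {..<d} \<union> I)"
      unfolding eq by (rule mpol.span_add) (use h in \<open>auto intro: mpol.span_base\<close>)
  qed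
  from mpol.ex_basis_mod[OF ideal_subspace[OF I(1)] _ this] obtain B
    where B: "B \<subseteq> L" "finite B" "card B \<le> card (y ` {..<d})" "L \<subseteq> mpol.span (B \<union> I)"
      "card B = card (y ` {..<d}) \<longrightarrow> y ` {..<d} \<subseteq> mpol.span (B \<union> I)" by blast
  have BI: "B \<union> I \<subseteq> RR" using B(1) LI by blast
  have spB: "mpol.span (B \<union> I) \<subseteq> R.Gen (B \<union> I)"
    by (rule ideal_span[OF R.Gen_ideal[OF BI] R.Gen_self[OF BI]])
  obtain f where "bij_betw f {0..<card B} B" using ex_bij_betw_nat_finite[OF B(2)] by blast
  then have f: "f ` {..<card B} = B" by (simp add: bij_betw_def atLeast0LessThan)
  have "R.Gen (L \<union> I) \<subseteq> R.Gen (B \<union> I)"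
    by (rule R.Gen_mono[OF BI]) (use B(4) spB R.Gen_self[OF BI] in blast)
  then have "lforms n \<subseteq> R.Gen (f ` {..<card B} \<union> I)" using n unfolding f by blast
  then have "d \<le> card B"
    by (intro dim_le_family[of "card B" f n]) (use f B(1) L(1) in blast)
  \<comment> \<open>The family may have repetitions a priori; together with
    \<open>d \<le> card B\<close> this forces all three cardinalities to be
    \<open>d\<close>.\<close>
  moreover have "card (y ` {..<d}) \<le> d" using card_image_le[of "{..<d}" y] by simp
  ultimately have "y ` {..<d} \<subseteq> mpol.span (B \<union> I)" using B(3,5) by simp
  moreover have "B \<union> I \<subseteq> R.Gen (L \<union> I)" using B(1) R.Gen_self[OF LI] by blast
  then have "mpol.span (B \<union> I) \<subseteq> R.Gen (L \<union> I)" by (rule ideal_span[OF R.Gen_ideal[OF LI]])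
  ultimately show "R.Gen (y ` {..<d} \<union> I) \<subseteq> R.Gen (L \<union> I)"
    by (intro R.Gen_mono[OF LI]) (use R.Gen_self[OF LI] in blast)
qed

text \<open>Every reduction contains one with \<open>d\<close> generators by
  \<open>ex_reduction\<close>, and one with \<open>d\<close> generators contains no smaller one by
  \<open>reduction_eq_of_le\<close>.\<close>

lemma is_minimal_reduction_iff:
  "is_minimal_reduction (ring_on RR Quot I) (quot_grading (ring_on RR) lforms I) Q \<longleftrightarrow>
     (\<exists>y. (\<forall>i<d. y i \<in> lforms 1) \<and> Q = (\<lambda>p. I +>\<^bsub>ring_on RR\<^esub> p) ` R.Gen (y ` {..<d} \<union> I) \<and>
        (\<exists>n. lforms n \<subseteq> R.Gen (y ` {..<d} \<union> I)))" (is "?A \<longleftrightarrow> ?B")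
proof
  assume A: ?A
  then have Q: "is_reduction (ring_on RR Quot I) (quot_grading (ring_on RR) lforms I) Q"
    and min: "\<And>Q'. is_reduction (ring_on RR Quot I) (quot_grading (ring_on RR) lforms I) Q' \<Longrightarrow> Q' \<subseteq> Q \<Longrightarrow> Q' = Q"
    unfolding is_minimal_reduction_def by blast+
  from Q obtain L n where L: "L \<subseteq> lforms 1" "Q = qcl I ` R.Gen (L \<union> I)" "lforms n \<subseteq> R.Gen (L \<union> I)"
    unfolding is_reduction_iff[OF I(1)] by blast
  have LI: "L \<union> I \<subseteq> RR" using L(1) forms_polys[of UNIV "{..<m}" 1] R.ideal_sub[OF I(1)] by blast
  from ex_reduction[OF L(1,3)] obtain y n' where y: "\<forall>i<d. y i \<in> lforms 1"
    "y ` {..<d} \<subseteq> R.Gen (L \<union> I)" "lforms n' \<subseteq> R.Gen (y ` {..<d} \<union> I)" by blast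
  have "R.Gen (y ` {..<d} \<union> I) \<subseteq> R.Gen (L \<union> I)"
    by (rule R.Gen_mono[OF LI]) (use y(2) R.Gen_self[OF LI] in blast)
  then have "qcl I ` R.Gen (y ` {..<d} \<union> I) \<subseteq> Q" unfolding L(2) by (rule image_mono)
  moreover have "is_reduction (ring_on RR Quot I) (quot_grading (ring_on RR) lforms I) (qcl I ` R.Gen (y ` {..<d} \<union> I))"
    unfolding is_reduction_iff[OF I(1)] using y by (intro exI[of _ "y ` {..<d}"]) blast
  ultimately have "qcl I ` R.Gen (y ` {..<d} \<union> I) = Q" using min by blast
  then show ?B using y by blast
next
  assume ?B
  then obtain y n where y: "\<forall>i<d. y i \<in> lforms 1" "Q = qcl I ` R.Gen (y ` {..<d} \<union> I)"
    "lforms n \<subseteq> R.Gen (y ` {..<d} \<union> I)" by blast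
  have yI: "y ` {..<d} \<union> I \<subseteq> RR"
    using lforms_family_poly[of d y 1] y(1) R.ideal_sub[OF I(1)] by blast
  have G: "R.is_ideal (R.Gen (y ` {..<d} \<union> I))" "I \<subseteq> R.Gen (y ` {..<d} \<union> I)"
    using R.Gen_ideal[OF yI] R.Gen_self[OF yI] by blast+
  have "Q' = Q" if Q': "is_reduction (ring_on RR Quot I) (quot_grading (ring_on RR) lforms I) Q'" "Q' \<subseteq> Q" for Q'
  proof -
    from Q'(1) obtain L n' where L: "L \<subseteq> lforms 1" "Q' = qcl I ` R.Gen (L \<union> I)" "lforms n' \<subseteq> R.Gen (L \<union> I)"
      unfolding is_reduction_iff[OF I(1)] by blast
    have LI: "L \<union> I \<subseteq> RR" using L(1) forms_polys[of UNIV "{..<m}" 1] R.ideal_sub[OF I(1)] by blast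
    have "L \<subseteq> R.Gen (y ` {..<d} \<union> I)"
    proof
      fix l assume l: "l \<in> L"
      then have "qcl I l \<in> Q'" unfolding L(2) using R.Gen_self[OF LI] by blast
      then have "qcl I l \<in> qcl I ` R.Gen (y ` {..<d} \<union> I)" using Q'(2) y(2) by blast
      then show "l \<in> R.Gen (y ` {..<d} \<union> I)"
        using R.coset_mem_image_iff[OF I(1) G] l LI by blast
    qed
    then show ?thesis using reduction_eq_of_le[of y L n'] y L by simp
  qed
  moreover have "is_reduction (ring_on RR Quot I) (quot_grading (ring_on RR) lforms I) Q"
    unfolding is_reduction_iff[OF I(1)] y(2) using y by (intro exI[of _ "y ` {..<d}"]) blast
  ultimately show ?A unfolding is_minimal_reduction_def by blast
qed

end

end

section \<open>Non-vanishing of polynomials over an infinite field\<close>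

text \<open>Induction on the variables: a value \<open>c\<close> for \<open>x\<close> is chosen such
  that substituting it leaves a nonzero polynomial \<open>q\<close> in the remaining
  variables.\<close>

lemma ex_eval_mpol_nonzero:
  fixes p :: "'k::field mpol"
  assumes inf: "infinite (UNIV :: 'k set)" and "finite V" "p \<in> polys UNIV V" "p \<noteq> 0"
  shows "\<exists>a. eval_mpol a p \<noteq> 0"
  using assms(2-)
proof (induction V arbitrary: p rule: finite_induct)
  case (empty p)
  have k: "keys p \<subseteq> {0}"
  proof
    fix e assume "e \<in> keys p"
    then have "keys e = {}" using empty by (auto simp: polys_def)
    then show "e \<in> {0}" by simp
  qed
  have "p = single 0 (lookup p 0)"
    by (rule poly_mapping_eqI) (use k in \<open>auto simp: lookup_single when_def in_keys_iff subset_iff\<close>)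
  then obtain c where "p = single 0 c" by blast
  then show ?case using empty by (auto simp: eval_mpol_single)
next
  case (insert x V p)
  define rm where "rm e = e - single x (lookup e x)" for e :: "nat \<Rightarrow>\<^sub>0 nat"
  have lrm: "lookup (rm e) z = (if z = x then 0 else lookup e z)" for e z
    by (simp add: rm_def lookup_minus lookup_single when_def)
  have krm: "keys (rm e) = keys e - {x}" for e
    by (auto simp: in_keys_iff lrm split: if_splits)
  obtain e0 where e0: "e0 \<in> keys p" using insert.prems(2) by (metis Poly_Mapping.keys_eq_empty ex_in_conv)
  \<comment> \<open>The terms that agree with \<open>e0\<close> outside \<open>x\<close>. They
    differ in the exponent of \<open>x\<close>, so nothing cancels in \<open>P\<close>, and the
    coefficient of \<open>q\<close> at \<open>rm e0\<close> is the value of \<open>P\<close> at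
    \<open>c\<close>.\<close>
  define E where "E = {e \<in> keys p. rm e = rm e0}"
  have fE: "finite E" "e0 \<in> E" using e0 by (auto simp: E_def)
  define P where "P = (\<Sum>e\<in>E. monom (lookup p e) (lookup e x))"
  have inj: "e = e0" if "e \<in> E" "lookup e x = lookup e0 x" for e
  proof (rule poly_mapping_eqI)
    fix z
    have "lookup (rm e) z = lookup (rm e0) z" using that(1) by (simp add: E_def)
    then show "lookup e z = lookup e0 z" using that(2) by (cases "z = x") (simp_all add: lrm)
  qed
  have "coeff P (lookup e0 x) = (\<Sum>e\<in>E. if e = e0 then lookup p e0 else 0)"
    unfolding P_def coeff_sum using inj by (intro sum.cong) auto
  also have "\<dots> = lookup p e0" using fE by simp
  finally have "P \<noteq> 0" using e0 by (auto simp: in_keys_iff)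
  then have "finite {c. poly P c = 0}" by (rule poly_roots_finite)
  then obtain c where c: "poly P c \<noteq> 0" using ex_new_if_finite[OF inf] by blast
  define q where "q = linext (\<lambda>e b. single (rm e) (b * c ^ lookup e x)) p"
  have q: "q = (\<Sum>e\<in>keys p. single (rm e) (lookup p e * c ^ lookup e x))"
    by (simp add: q_def linext_def)
  have "lookup q (rm e0) = (\<Sum>e\<in>keys p. if rm e = rm e0 then lookup p e * c ^ lookup e x else 0)"
    unfolding q lookup_sum by (intro sum.cong) (auto simp: lookup_single when_def)
  also have "\<dots> = (\<Sum>e\<in>E. lookup p e * c ^ lookup e x)"
    unfolding E_def by (simp add: sum.inter_filter)
  also have "\<dots> = poly P c" by (simp add: P_def poly_sum poly_monom)
  finally have "q \<noteq> 0" using c by auto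
  moreover have "q \<in> polys UNIV V"
    unfolding q
  proof (intro csubring.sum csubring.polys_csubring UNIV_csubring)
    fix e assume "e \<in> keys p"
    then have "keys (rm e) \<subseteq> V" using insert.prems(1) by (auto simp: polys_def krm)
    then show "single (rm e) (lookup p e * c ^ lookup e x) \<in> polys UNIV V" by (simp add: polys_def)
  qed
  ultimately obtain a where a: "eval_mpol a q \<noteq> 0" using insert.IH by blast
  interpret ea: comm_ring_hom "eval_mpol a" by (rule eval_mpol_hom)
  define a' where "a' z = (if z = x then c else a z)" for z
  have "eval_mpol a' p = (\<Sum>e\<in>keys p. lookup p e * (\<Prod>z\<in>keys e. a' z ^ lookup e z))"
    by (simp add: eval_mpol_def linext_def)
  also have "\<dots> = (\<Sum>e\<in>keys p. eval_mpol a (single (rm e) (lookup p e * c ^ lookup e x)))"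
  proof (rule sum.cong)
    fix e
    have "(\<Prod>z\<in>keys e. a' z ^ lookup e z) = (\<Prod>z\<in>insert x (keys e). a' z ^ lookup e z)"
      by (rule prod_power_superset[symmetric]) auto
    also have "\<dots> = c ^ lookup e x * (\<Prod>z\<in>keys e - {x}. a' z ^ lookup e z)"
      by (subst prod.insert_remove) (auto simp: a'_def)
    also have "(\<Prod>z\<in>keys e - {x}. a' z ^ lookup e z) = (\<Prod>z\<in>keys (rm e). a z ^ lookup (rm e) z)"
      unfolding krm by (intro prod.cong) (auto simp: lrm a'_def)
    finally show "lookup p e * (\<Prod>z\<in>keys e. a' z ^ lookup e z)
        = eval_mpol a (single (rm e) (lookup p e * c ^ lookup e x))"
      by (simp add: eval_mpol_single mult.assoc)
  qed simp
  also have "\<dots> = eval_mpol a q" by (simp add: q ea.hom_sum)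
  finally have "eval_mpol a' p \<noteq> 0" using a by simp
  then show ?case by blast
qed

section \<open>Specialising the generic forms\<close>

lemma mapcoeff_polys:
  assumes "\<phi> 0 = 0" "\<And>c. c \<in> C \<Longrightarrow> \<phi> c \<in> C'" "p \<in> polys C V"
  shows "mapcoeff \<phi> p \<in> polys C' V"
proof -
  have "keys (mapcoeff \<phi> p) \<subseteq> keys p" by (auto simp: in_keys_iff lookup_mapcoeff[of \<phi>, OF assms(1)] assms(1))
  then show ?thesis using assms by (auto simp: polys_def lookup_mapcoeff[of \<phi>, OF assms(1)])
qed

lemma mapcoeff_forms:
  assumes "\<phi> 0 = 0" "\<And>c. c \<in> C \<Longrightarrow> \<phi> c \<in> C'" "p \<in> forms C V n"
  shows "mapcoeff \<phi> p \<in> forms C' V n"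
proof -
  have "keys (mapcoeff \<phi> p) \<subseteq> keys p" by (auto simp: in_keys_iff lookup_mapcoeff[of \<phi>, OF assms(1)] assms(1))
  then show ?thesis using assms by (auto simp: forms_lookup lookup_mapcoeff[of \<phi>, OF assms(1)])
qed

lemma mapcoeff_mapcoeff:
  "\<phi> 0 = 0 \<Longrightarrow> \<psi> 0 = 0 \<Longrightarrow> mapcoeff \<psi> (mapcoeff \<phi> p) = mapcoeff (\<lambda>c. \<psi> (\<phi> c)) p"
  by (rule poly_mapping_eqI) (simp add: lookup_mapcoeff)

lemma mapcoeff_monomial: "\<phi> 0 = 0 \<Longrightarrow> \<phi> 1 = 1 \<Longrightarrow> mapcoeff \<phi> (monomial e) = monomial e"
  by (simp add: monomial_def mapcoeff_single)

lemma to_fract_hom: "comm_ring_hom to_fract"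
  by unfold_locales simp_all

lemma single_0_hom: "comm_ring_hom (single 0 :: 'a::comm_ring_1 \<Rightarrow> 'a mpol)"
  by unfold_locales (simp_all add: single_add mult_single)

interpretation lift_const: comm_ring_hom "mapcoeff (single 0) :: 'k::field mpol \<Rightarrow> 'k mpol mpol"
  by (rule mapcoeff_hom[OF single_0_hom])

interpretation coeff_fract: comm_ring_hom "mapcoeff to_fract :: 'k::field mpol mpol \<Rightarrow> 'k mpol fract mpol"
  by (rule mapcoeff_hom[OF to_fract_hom])

lemma eval_coeff_hom: "comm_ring_hom (mapcoeff (eval_mpol a) :: 'k::field mpol mpol \<Rightarrow> 'k mpol)"
  by (rule mapcoeff_hom[OF eval_mpol_hom])

text \<open>The generic linear form with coefficients in k[u]. It maps to \<open>z_form\<close> over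
  k(u) and to \<open>special_form\<close> at a point \<open>a\<close>.\<close>

definition gen_form :: "nat \<Rightarrow> nat \<Rightarrow> 'k::field mpol mpol" where
  "gen_form m i = (\<Sum>j<m. single 0 (var (prod_encode (i, j))) * var j)"

definition special_form :: "nat \<Rightarrow> (nat \<Rightarrow> 'k) \<Rightarrow> nat \<Rightarrow> 'k::field mpol" where
  "special_form m a i = (\<Sum>j<m. single 0 (a (prod_encode (i, j))) * var j)"

lemma coeff_fract_gen_form: "mapcoeff to_fract (gen_form m i) = z_form m i"
  by (simp add: gen_form_def z_form_def coeff_fract.hom_sum coeff_fract.hom_mult mapcoeff_single
      var_def mapcoeff_monomial u_ind_def)

lemma eval_coeff_gen_form:
  fixes a :: "nat \<Rightarrow> 'k::field"
  shows "mapcoeff (eval_mpol a) (gen_form m i) = special_form m a i"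
proof -
  interpret e: comm_ring_hom "eval_mpol a" by (rule eval_mpol_hom)
  interpret ec: comm_ring_hom "mapcoeff (eval_mpol a) :: 'k mpol mpol \<Rightarrow> 'k mpol" by (rule eval_coeff_hom)
  show ?thesis
    by (simp add: gen_form_def special_form_def ec.hom_sum ec.hom_mult mapcoeff_single eval_mpol_var)
      (simp add: var_def mapcoeff_monomial)
qed

lemma coeff_fract_lift_const: "mapcoeff to_fract (mapcoeff (single 0) p) = extend_scalars p"
  by (simp add: mapcoeff_mapcoeff extend_scalars_eq)

lemma eval_coeff_lift_const: "mapcoeff (eval_mpol a) (mapcoeff (single 0) p) = p"
proof -
  interpret e: comm_ring_hom "eval_mpol a" by (rule eval_mpol_hom)
  show ?thesis by (rule poly_mapping_eqI) (simp add: lookup_mapcoeff eval_mpol_single)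
qed

lemma inj_coeff_fract: "mapcoeff to_fract p = mapcoeff to_fract q \<Longrightarrow> p = q"
  by (metis lookup_mapcoeff poly_mapping_eqI to_fract_0 to_fract_eq_iff)

locale generic_forms = inf_field_poly ty m for ty :: "'k::field itself" and m :: nat +
  fixes d :: nat
begin

text \<open>\<open>TT\<close> is \<open>k[u]\<close>, \<open>CC\<close> is \<open>k(u)\<close> and \<open>UU\<close> is \<open>R\<^sub>u\<close>.\<close>

abbreviation "TT \<equiv> polys (UNIV :: 'k set) (uvars d m)"
abbreviation "CC \<equiv> ratfuns d m :: 'k mpol fract set"
abbreviation "UU \<equiv> polys CC {..<m}"
abbreviation "uforms \<equiv> forms CC {..<m}"

lemma TT_csubring: "csubring TT"
  using polys_csubring .

sublocale T: poly_csubring TT "{..<m}"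
  by (rule poly_csubring.intro[OF TT_csubring])

lemma CC_memD: "x \<in> CC \<Longrightarrow> \<exists>p\<in>TT. \<exists>q\<in>TT. q \<noteq> 0 \<and> x = Fract p q"
  by (auto simp: ratfuns_def)

lemma CC_memI: "p \<in> TT \<Longrightarrow> q \<in> TT \<Longrightarrow> q \<noteq> 0 \<Longrightarrow> Fract p q \<in> CC"
  by (auto simp: ratfuns_def)

lemma to_fract_mem: "p \<in> TT \<Longrightarrow> to_fract p \<in> CC"
  unfolding to_fract_def by (rule CC_memI) auto

lemma CC_csubring: "csubring CC"
proof
  show "0 \<in> CC" using to_fract_mem[of 0] by simp
  show "1 \<in> CC" using to_fract_mem[of 1] by simp
  fix x assume "x \<in> CC"
  from CC_memD[OF this] obtain p q where x: "p \<in> TT" "q \<in> TT" "q \<noteq> 0" "x = Fract p q" by blast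
  show "- x \<in> CC" unfolding x(4) minus_fract by (rule CC_memI) (use x T.uminus in auto)
  fix y assume "y \<in> CC"
  from CC_memD[OF this] obtain r s where y: "r \<in> TT" "s \<in> TT" "s \<noteq> 0" "y = Fract r s" by blast
  show "x + y \<in> CC" unfolding x(4) y(4) add_fract[OF x(3) y(3)]
    by (rule CC_memI) (use x y T.add T.mult in auto)
  show "x * y \<in> CC" unfolding x(4) y(4) mult_fract
    by (rule CC_memI) (use x y T.mult in auto)
qed

lemma inverse_mem:
  assumes "x \<in> CC"
  shows "inverse x \<in> CC"
proof -
  from CC_memD[OF assms] obtain p q where x: "p \<in> TT" "q \<in> TT" "q \<noteq> 0" "x = Fract p q" by blast
  show ?thesis
  proof (cases "p = 0")
    case True
    then have "x = 0" using x(4) by (simp add: fract_collapse)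
    then show ?thesis using assms by simp
  next
    case False
    then show ?thesis unfolding x(4) inverse_fract using x by (intro CC_memI)
  qed
qed

sublocale U: poly_csubring CC "{..<m}"
  by (rule poly_csubring.intro[OF CC_csubring])

lemma const_mem_TT: "single 0 c \<in> TT"
  by (rule const_poly) simp

lemma uvar_mem_TT: "i < d \<Longrightarrow> j < m \<Longrightarrow> var (prod_encode (i, j)) \<in> TT"
  by (auto simp: polys_def var_def monomial_def lookup_single when_def uvars_def)

lemma gen_form_form: "i < d \<Longrightarrow> gen_form m i \<in> forms TT {..<m} 1"
  unfolding gen_form_def using uvar_mem_TT[of i]
  by (intro T.forms_sum T.forms_scale var_form) auto

lemma z_form_form: "i < d \<Longrightarrow> z_form m i \<in> uforms 1"
  unfolding coeff_fract_gen_form[symmetric] by (rule mapcoeff_forms[OF _ to_fract_mem gen_form_form]) auto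

lemma special_form_form: "special_form m a i \<in> lforms 1"
  unfolding special_form_def by (intro forms_sum forms_scale var_form) auto

text \<open>The point \<open>a\<close> lists the coefficients of the \<open>y i\<close>, so
  specialisations of the generic family are exactly the families of \<open>d\<close> linear
  forms.\<close>

lemma ex_special_form:
  assumes y: "\<And>i. i < d \<Longrightarrow> y i \<in> lforms 1"
  shows "\<exists>a. \<forall>i<d. special_form m a i = y i"
proof -
  define a where "a n = (case prod_decode n of (i, j) \<Rightarrow> lookup (y i) (single j 1))" for n
  have "special_form m a i = y i" if i: "i < d" for i
  proof (rule poly_mapping_eqI)
    fix e
    have "lookup (special_form m a i) e = (\<Sum>j<m. lookup (y i) (single j 1) * (if single j 1 = e then 1 else 0))"
      by (simp add: special_form_def lookup_sum lookup_const_mult a_def var_def monomial_def lookup_single when_def)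
    also have "\<dots> = lookup (y i) e"
    proof (cases "e \<in> mons {..<m} 1")
      case True
      then obtain x e' where x: "x \<in> {..<m}" "e' \<in> mons {..<m} 0" "e = single x 1 + e'"
        using mons_Suc[of e "{..<m}" 0] by auto
      have e: "e = single x 1" using x by (simp add: mons_def total_deg_eq_0_iff)
      have "single j (1::nat) = single x 1 \<longleftrightarrow> j = x" for j
        by (metis lookup_single_eq lookup_single_not_eq one_neq_zero)
      then have "(\<Sum>j<m. lookup (y i) (single j 1) * (if single j 1 = e then 1 else 0))
          = (\<Sum>j\<in>{..<m}. if j = x then lookup (y i) (single j 1) else 0)"
        unfolding e by (intro sum.cong) auto
      also have "\<dots> = lookup (y i) e" unfolding e using x(1) by (subst sum.delta) auto
      finally show ?thesis .
    next
      case False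
      then have "lookup (y i) e = 0" using y[OF i] by (auto simp: forms_lookup in_keys_iff)
      moreover have "single j (1::nat) \<noteq> e" if "j < m" for j
        using False mons_single[of j "{..<m}"] that by auto
      ultimately show ?thesis by simp
    qed
    finally show "lookup (special_form m a i) e = lookup (y i) e" .
  qed
  then show ?thesis by blast
qed

lemma extend_scalars_form: "p \<in> lforms n \<Longrightarrow> extend_scalars p \<in> uforms n"
  unfolding extend_scalars_eq by (rule mapcoeff_forms[of _ UNIV]) (auto intro: to_fract_mem const_mem_TT)

lemma extend_scalars_poly: "p \<in> RR \<Longrightarrow> extend_scalars p \<in> UU"
  unfolding extend_scalars_eq by (rule mapcoeff_polys[of _ UNIV]) (auto intro: to_fract_mem const_mem_TT)

lemma lift_const_form: "p \<in> lforms n \<Longrightarrow> mapcoeff (single 0) p \<in> forms TT {..<m} n"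
  by (rule mapcoeff_forms[of _ UNIV]) (auto intro: const_mem_TT)

context
  fixes I :: "'k mpol set"
  assumes I: "R.is_ideal I" "hc_closed I"
begin

lemma extend_I_sub: "extend_scalars ` I \<subseteq> UU"
  using extend_scalars_poly R.ideal_sub[OF I(1)] by blast

lemma IRu_ideal: "ideal (IRu d m I) (ring_on (UU))"
  unfolding IRu_def by (rule U.R.Gen_ideal[OF extend_I_sub])

lemma extend_sub_IRu: "extend_scalars ` I \<subseteq> IRu d m I"
  unfolding IRu_def by (rule U.R.Gen_self[OF extend_I_sub])

lemma hc_extend_scalars: "hc n (extend_scalars p) = extend_scalars (hc n p)"
  by (rule poly_mapping_eqI) (simp add: lookup_hc lookup_extend_scalars when_def)

lemma IRu_hc_closed: "hc_closed (IRu d m I)"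
  unfolding IRu_def
proof (rule U.hc_closed_Gen[OF extend_I_sub])
  fix t n assume "t \<in> extend_scalars ` I"
  then have "hc n t \<in> extend_scalars ` I" using I(2) by (auto simp: hc_closed_def hc_extend_scalars)
  then show "hc n t \<in> U.R.Gen (extend_scalars ` I)" using U.R.Gen_self[OF extend_I_sub] by blast
qed

lemma generic_family_sub: "z_form m ` {..<d} \<union> IRu d m I \<subseteq> UU"
  using U.form_poly[OF z_form_form] U.R.ideal_sub[OF IRu_ideal] by blast

lemma generic_family_ideal:
  "ideal (U.R.Gen (z_form m ` {..<d} \<union> IRu d m I)) (ring_on (UU))"
  by (rule U.R.Gen_ideal[OF generic_family_sub])

lemma generic_of_special:
  assumes n: "lforms n \<subseteq> R.Gen (special_form m a ` {..<d} \<union> I)"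
  shows "uforms n \<subseteq> U.R.Gen (z_form m ` {..<d} \<union> IRu d m I)"
proof -
  let ?E = "mons {..<m} n"
  let ?y = "special_form m a"
  have y: "?y i \<in> lforms 1" for i by (rule special_form_form)
  obtain g h where gh: "\<forall>e\<in>?E. (\<forall>i<d. g e i \<in> (if 1 \<le> n then lforms (n - 1) else {0})) \<and>
      h e \<in> I \<and> h e \<in> lforms n \<and> monomial e = (\<Sum>i<d. g e i * ?y i) + h e"
    by (rule Gen_linear_choice[OF y I n])
  have g: "g e i \<in> (if 1 \<le> n then lforms (n - 1) else {0})" if "e \<in> ?E" "i < d" for e i
    using gh that by blast
  have h: "h e \<in> I" "h e \<in> lforms n" and eq: "monomial e = (\<Sum>i<d. g e i * ?y i) + h e" if "e \<in> ?E" for e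
    using gh that by blast+
  let ?\<kappa> = "mapcoeff (single 0) :: 'k mpol \<Rightarrow> 'k mpol mpol"
  let ?\<tau> = "mapcoeff to_fract :: 'k mpol mpol \<Rightarrow> 'k mpol fract mpol"
  let ?\<eta> = "mapcoeff (eval_mpol a) :: 'k mpol mpol \<Rightarrow> 'k mpol"
  interpret e: comm_ring_hom "eval_mpol a" by (rule eval_mpol_hom)
  interpret ec: comm_ring_hom ?\<eta> by (rule eval_coeff_hom)
  define W where "W e = (\<Sum>i<d. ?\<kappa> (g e i) * gen_form m i) + ?\<kappa> (h e)" for e
  have W: "W e \<in> forms TT {..<m} n" if e: "e \<in> ?E" for e
    unfolding W_def
  proof (intro T.forms_add T.forms_sum)
    show "?\<kappa> (h e) \<in> forms TT {..<m} n" by (rule lift_const_form[OF h(2)[OF e]])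
    fix i assume "i \<in> {..<d}"
    then have i: "i < d" by simp
    show "?\<kappa> (g e i) * gen_form m i \<in> forms TT {..<m} n"
    proof (cases "1 \<le> n")
      case True
      then have "?\<kappa> (g e i) \<in> forms TT {..<m} (n - 1)" using g[OF e i] by (intro lift_const_form) simp
      from T.forms_mult[OF this gen_form_form[OF i]] show ?thesis using True by simp
    next
      case False
      then show ?thesis using g[OF e i] by simp
    qed
  qed
  have \<eta>W: "?\<eta> (W e) = monomial e" if e: "e \<in> ?E" for e
    unfolding W_def eq[OF e]
    by (simp add: ec.hom_add ec.hom_sum ec.hom_mult eval_coeff_gen_form eval_coeff_lift_const)
  have \<tau>W: "?\<tau> (W e) = (\<Sum>i<d. extend_scalars (g e i) * z_form m i) + extend_scalars (h e)" for e
    unfolding W_def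
    by (simp add: coeff_fract.hom_add coeff_fract.hom_sum coeff_fract.hom_mult coeff_fract_gen_form coeff_fract_lift_const)
  \<comment> \<open>The coefficient matrix of the deformed relations \<open>W\<close> has entries in
    k[u] and becomes the identity at \<open>a\<close>, so its determinant \<open>q\<close> has value
    1 there.\<close>
  have \<phi>N: "eval_mpol a (lookup (W i) j) = (if i = j then 1 else 0)" if "i \<in> ?E" "j \<in> ?E" for i j
  proof -
    have "eval_mpol a (lookup (W i) j) = lookup (?\<eta> (W i)) j" by (simp add: lookup_mapcoeff)
    then show ?thesis by (simp add: \<eta>W[OF that(1)] monomial_def lookup_single when_def)
  qed
  have NT: "lookup (W i) j \<in> TT" if "i \<in> ?E" for i j using W[OF that] by (simp add: forms_lookup)
  obtain q Y where q: "q \<in> TT" "eval_mpol a q = 1" and Y: "\<And>i j. i \<in> ?E \<Longrightarrow> j \<in> ?E \<Longrightarrow> Y i j \<in> TT"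
    and YN: "\<And>i k. i \<in> ?E \<Longrightarrow> k \<in> ?E \<Longrightarrow> (\<Sum>j\<in>?E. Y i j * lookup (W j) k) = (if i = k then q else 0)"
    by (rule T.cramer_specialization[OF eval_mpol_hom card_mons(1)[OF m1, of n] NT \<phi>N]) auto
  have q0: "q \<noteq> 0" using q(2) by auto
  show ?thesis
  proof (rule U.monomial_mem_of_inverse[OF generic_family_ideal, where w = "\<lambda>e. ?\<tau> (W e)"
        and q = "to_fract q" and r = "inverse (to_fract q)" and Y = "\<lambda>i j. to_fract (Y i j)"])
    fix e assume e: "e \<in> ?E"
    show "?\<tau> (W e) \<in> uforms n" by (rule mapcoeff_forms[OF _ to_fract_mem W[OF e]]) auto
    show "?\<tau> (W e) \<in> U.R.Gen (z_form m ` {..<d} \<union> IRu d m I)"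
      unfolding \<tau>W
    proof (rule U.R.Gen_familyI[OF U.form_poly[OF z_form_form] IRu_ideal])
      fix i assume "i < d"
      then have "g e i \<in> RR" using g[OF e, of i] form_poly by (auto split: if_splits)
      then show "extend_scalars (g e i) \<in> UU" by (rule extend_scalars_poly)
    next
      show "extend_scalars (h e) \<in> IRu d m I" using extend_sub_IRu h(1)[OF e] by blast
    qed
  next
    fix i k assume ik: "i \<in> ?E" "k \<in> ?E"
    have "(\<Sum>j\<in>?E. to_fract (Y i j) * lookup (?\<tau> (W j)) k) = to_fract (\<Sum>j\<in>?E. Y i j * lookup (W j) k)"
      by (simp add: lookup_mapcoeff)
    then show "(\<Sum>j\<in>?E. to_fract (Y i j) * lookup (?\<tau> (W j)) k) = (if i = k then to_fract q else 0)"
      using YN[OF ik] by simp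
  next
    show "inverse (to_fract q) \<in> CC" by (intro inverse_mem to_fract_mem q(1))
    show "inverse (to_fract q) * to_fract q = 1" using q0 by simp
  qed (use Y to_fract_mem in blast)
qed

end

section \<open>Clearing denominators in k(u)\<close>

lemma ex_common_denominator:
  assumes "finite X" "X \<subseteq> CC"
  shows "\<exists>q\<in>TT. q \<noteq> 0 \<and> (\<forall>x\<in>X. to_fract q * x \<in> to_fract ` TT)"
  using assms
proof (induction X rule: finite_induct)
  case empty
  show ?case by (rule bexI[of _ 1]) auto
next
  case (insert x X)
  then obtain q where q: "q \<in> TT" "q \<noteq> 0" "\<forall>x\<in>X. to_fract q * x \<in> to_fract ` TT" by auto
  have "x \<in> CC" using insert.prems by simp
  from CC_memD[OF this] obtain p r where x: "p \<in> TT" "r \<in> TT" "r \<noteq> 0" "x = Fract p r" by blast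
  have x': "to_fract r * x = to_fract p" using x(3) by (simp add: x(4) Fract_conv_to_fract)
  have "to_fract (r * q) * z \<in> to_fract ` TT" if z: "z \<in> insert x X" for z
  proof (cases "z = x")
    case True
    have "to_fract (r * q) * z = to_fract q * (to_fract r * x)" unfolding True by (simp add: mult_ac)
    also have "\<dots> = to_fract (q * p)" by (simp add: x')
    finally have "to_fract (r * q) * z = to_fract (q * p)" .
    then show ?thesis using imageI[OF T.mult[OF q(1) x(1)], of to_fract] by (simp only:)
  next
    case False
    then obtain t where t: "t \<in> TT" "to_fract q * z = to_fract t" using q(3) z by auto
    have "to_fract (r * q) * z = to_fract r * (to_fract q * z)" by (simp add: mult_ac)
    also have "\<dots> = to_fract (r * t)" by (simp add: t(2))
    finally have "to_fract (r * q) * z = to_fract (r * t)" .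
    then show ?thesis using imageI[OF T.mult[OF x(2) t(1)], of to_fract] by (simp only:)
  qed
  moreover have "r * q \<in> TT" "r * q \<noteq> 0" using T.mult[OF x(2) q(1)] x(3) q(2) by auto
  ultimately show ?case by blast
qed

lemma ex_coeff_fract_preimage:
  assumes p: "p \<in> UU" and q: "\<forall>e\<in>keys p. to_fract q * lookup p e \<in> to_fract ` TT"
  shows "\<exists>P\<in>polys TT {..<m}. mapcoeff to_fract P = single 0 (to_fract q) * p"
proof -
  \<comment> \<open>A section of the embedding of k[u]; the value at 0 is fixed explicitly, since a
    coefficientwise map has to preserve 0.\<close>
  define g where "g x = (if x = 0 then 0 else inv_into TT to_fract x)" for x :: "'k mpol fract"
  have g: "to_fract (g x) = x" "g x \<in> TT" if "x \<in> to_fract ` TT" for x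
    using that f_inv_into_f[of x to_fract TT] inv_into_into[of x to_fract TT] by (auto simp: g_def)
  let ?p = "single 0 (to_fract q) * p"
  have lk: "lookup ?p e \<in> to_fract ` TT" for e
  proof (cases "e \<in> keys p")
    case False
    then have "lookup ?p e = to_fract 0" by (simp add: lookup_const_mult in_keys_iff)
    then show ?thesis by (rule image_eqI) simp
  qed (use q in \<open>simp add: lookup_const_mult\<close>)
  have g0: "g 0 = 0" by (simp add: g_def)
  have "mapcoeff g ?p \<in> polys TT {..<m}"
  proof (rule mapcoeff_polys[of g, OF g0, of "to_fract ` TT"])
    have "keys ?p \<subseteq> keys p" by (auto simp: in_keys_iff lookup_const_mult)
    then show "?p \<in> polys (to_fract ` TT) {..<m}" using p lk by (auto simp: polys_def)
  qed (rule g(2))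
  moreover have "mapcoeff to_fract (mapcoeff g ?p) = ?p"
    by (rule poly_mapping_eqI) (use g(1)[OF lk] in \<open>simp add: lookup_mapcoeff g0\<close>)
  ultimately show ?thesis by blast
qed

end

context generic_forms begin

lemma zero_ideal_U: "ideal {0} (ring_on (UU))"
  unfolding U.R.ideal_iff by simp

lemma zero_ideal_R: "R.is_ideal {0}"
  unfolding R.ideal_iff by simp

context
  fixes I :: "'k mpol set" and f :: "nat \<Rightarrow> 'k mpol" and v :: nat
  assumes I: "R.is_ideal I" "hc_closed I"
    and f: "\<And>j. j < v \<Longrightarrow> f j \<in> RR" and If: "I = R.Gen (f ` {..<v})"
begin

text \<open>Replaces the extended ideal by finitely many generators, so that a relation has finitely
  many denominators and the columns of the matrix suffice.\<close>

lemma IRu_subset_Gen: "IRu d m I \<subseteq> U.R.Gen ((\<lambda>j. extend_scalars (f j)) ` {..<v} \<union> {0})"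
  unfolding IRu_def
proof (rule U.R.Gen_mono)
  show "(\<lambda>j. extend_scalars (f j)) ` {..<v} \<union> {0} \<subseteq> UU"
    using extend_scalars_poly[OF f] by auto
  show "extend_scalars ` I \<subseteq> U.R.Gen ((\<lambda>j. extend_scalars (f j)) ` {..<v} \<union> {0})"
  proof
    fix x assume "x \<in> extend_scalars ` I"
    then obtain p where p: "p \<in> I" "x = extend_scalars p" by blast
    have s: "f ` {..<v} \<union> {0} \<subseteq> RR" using f by auto
    have "R.Gen (f ` {..<v}) \<subseteq> R.Gen (f ` {..<v} \<union> {0})"
      by (rule R.Gen_mono[OF s]) (use R.Gen_self[OF s] in blast)
    then have pG: "p \<in> R.Gen (f ` {..<v} \<union> {0})" using p(1) If by blast
    have "\<exists>h\<in>{0}. \<exists>g. (\<forall>i<v. g i \<in> RR) \<and> p = (\<Sum>i<v. g i * f i) + h"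
      by (rule R.Gen_familyD[OF f zero_ideal_R pG])
    then obtain g where g: "\<forall>i<v. g i \<in> RR" "p = (\<Sum>i<v. g i * f i)" by auto
    have "x = (\<Sum>j<v. extend_scalars (g j) * extend_scalars (f j)) + 0"
      unfolding p(2) g(2) by (simp add: extend_scalars.hom_sum extend_scalars.hom_mult)
    also have "\<dots> \<in> U.R.Gen ((\<lambda>j. extend_scalars (f j)) ` {..<v} \<union> {0})"
      by (rule U.R.Gen_familyI[OF extend_scalars_poly[OF f] zero_ideal_U]) (use g(1) extend_scalars_poly in auto)
    finally show "x \<in> U.R.Gen ((\<lambda>j. extend_scalars (f j)) ` {..<v} \<union> {0})" .
  qed
qed

text \<open>One point has to serve all monomials of degree \<open>n\<close> at once, hence a single
  denominator \<open>q\<close> for all relations and a point where \<open>q\<close> does not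
  vanish.\<close>

lemma special_of_generic:
  assumes n: "uforms n \<subseteq> U.R.Gen (z_form m ` {..<d} \<union> IRu d m I)"
  shows "\<exists>a. lforms n \<subseteq> R.Gen (special_form m a ` {..<d} \<union> I)"
proof -
  let ?E = "mons {..<m} n"
  have fI: "f j \<in> I" if "j < v" for j
    unfolding If using R.Gen_self[of "f ` {..<v}"] f that by blast
  have ex: "\<forall>e\<in>?E. \<exists>g h. (\<forall>i<d. g i \<in> UU) \<and> (\<forall>j<v. h j \<in> UU) \<and>
      monomial e = (\<Sum>i<d. g i * z_form m i) + (\<Sum>j<v. h j * extend_scalars (f j))"
  proof
    fix e assume e: "e \<in> ?E"
    have eG: "monomial e \<in> U.R.Gen (z_form m ` {..<d} \<union> IRu d m I)"
      using n monomial_form[of CC e "{..<m}" n] e by auto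
    have "\<exists>h\<in>IRu d m I. \<exists>g. (\<forall>i<d. g i \<in> UU) \<and> monomial e = (\<Sum>i<d. g i * z_form m i) + h"
      by (rule U.R.Gen_familyD[OF U.form_poly[OF z_form_form] IRu_ideal[OF I] eG])
    then obtain h0 g where h0: "h0 \<in> IRu d m I" and g: "\<forall>i<d. g i \<in> UU"
      "monomial e = (\<Sum>i<d. g i * z_form m i) + h0" by blast
    have "\<exists>h\<in>{0}. \<exists>g. (\<forall>j<v. g j \<in> UU) \<and> h0 = (\<Sum>j<v. g j * extend_scalars (f j)) + h"
      by (rule U.R.Gen_familyD[OF extend_scalars_poly[OF f] zero_ideal_U subsetD[OF IRu_subset_Gen h0]])
    then obtain h where h: "\<forall>j<v. h j \<in> UU" "h0 = (\<Sum>j<v. h j * extend_scalars (f j))" by auto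
    show "\<exists>g h. (\<forall>i<d. g i \<in> UU) \<and> (\<forall>j<v. h j \<in> UU) \<and>
      monomial e = (\<Sum>i<d. g i * z_form m i) + (\<Sum>j<v. h j * extend_scalars (f j))"
      by (rule exI[of _ g], rule exI[of _ h]) (use g h in simp)
  qed
  from bchoice[OF ex] obtain g where "\<forall>e\<in>?E. \<exists>h. (\<forall>i<d. g e i \<in> UU) \<and> (\<forall>j<v. h j \<in> UU) \<and>
      monomial e = (\<Sum>i<d. g e i * z_form m i) + (\<Sum>j<v. h j * extend_scalars (f j))" ..
  from bchoice[OF this] obtain h where gh: "\<forall>e\<in>?E. (\<forall>i<d. g e i \<in> UU) \<and> (\<forall>j<v. h e j \<in> UU) \<and>
      monomial e = (\<Sum>i<d. g e i * z_form m i) + (\<Sum>j<v. h e j * extend_scalars (f j))" ..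
  \<comment> \<open>All coefficients in k(u) that occur in the chosen relations.\<close>
  define X where "X = (\<Union>e\<in>?E. \<Union>i\<in>{..<d}. lookup (g e i) ` keys (g e i)) \<union>
    (\<Union>e\<in>?E. \<Union>j\<in>{..<v}. lookup (h e j) ` keys (h e j))"
  have "finite X" unfolding X_def using card_mons(1)[OF m1, of n] by auto
  moreover have "X \<subseteq> CC" unfolding X_def using gh by (auto simp: polys_def)
  ultimately obtain q where q: "q \<in> TT" "q \<noteq> 0" "\<forall>x\<in>X. to_fract q * x \<in> to_fract ` TT"
    using ex_common_denominator by blast
  obtain a where a: "eval_mpol a q \<noteq> 0"
    using ex_eval_mpol_nonzero[OF inf _ q(1,2)] by (auto simp: uvars_def)
  let ?y = "special_form m a"
  let ?\<tau> = "mapcoeff to_fract :: 'k mpol mpol \<Rightarrow> 'k mpol fract mpol"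
  let ?\<kappa> = "mapcoeff (single 0) :: 'k mpol \<Rightarrow> 'k mpol mpol"
  let ?\<eta> = "mapcoeff (eval_mpol a) :: 'k mpol mpol \<Rightarrow> 'k mpol"
  interpret e: comm_ring_hom "eval_mpol a" by (rule eval_mpol_hom)
  interpret ec: comm_ring_hom ?\<eta> by (rule eval_coeff_hom)
  have J: "R.is_ideal (R.Gen (?y ` {..<d} \<union> I))"
    by (rule Gen_family_ideal[OF special_form_form I(1)])
  have "monomial e \<in> R.Gen (?y ` {..<d} \<union> I)" if e: "e \<in> ?E" for e
  proof -
    have "\<forall>i\<in>{..<d}. \<exists>P. P \<in> polys TT {..<m} \<and> ?\<tau> P = single 0 (to_fract q) * g e i"
    proof
      fix i assume i: "i \<in> {..<d}"
      have "\<forall>x\<in>keys (g e i). to_fract q * lookup (g e i) x \<in> to_fract ` TT"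
        using q(3) e i unfolding X_def by blast
      then show "\<exists>P. P \<in> polys TT {..<m} \<and> ?\<tau> P = single 0 (to_fract q) * g e i"
        using ex_coeff_fract_preimage[of "g e i" q] gh e i by blast
    qed
    from bchoice[OF this] obtain G where G: "\<forall>i\<in>{..<d}. G i \<in> polys TT {..<m} \<and> ?\<tau> (G i) = single 0 (to_fract q) * g e i" ..
    have "\<forall>j\<in>{..<v}. \<exists>P. P \<in> polys TT {..<m} \<and> ?\<tau> P = single 0 (to_fract q) * h e j"
    proof
      fix j assume j: "j \<in> {..<v}"
      have "\<forall>x\<in>keys (h e j). to_fract q * lookup (h e j) x \<in> to_fract ` TT"
        using q(3) e j unfolding X_def by blast
      then show "\<exists>P. P \<in> polys TT {..<m} \<and> ?\<tau> P = single 0 (to_fract q) * h e j"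
        using ex_coeff_fract_preimage[of "h e j" q] gh e j by blast
    qed
    from bchoice[OF this] obtain H where H: "\<forall>j\<in>{..<v}. H j \<in> polys TT {..<m} \<and> ?\<tau> (H j) = single 0 (to_fract q) * h e j" ..
    have "?\<tau> ((\<Sum>i<d. G i * gen_form m i) + (\<Sum>j<v. H j * ?\<kappa> (f j)))
        = (\<Sum>i<d. ?\<tau> (G i) * z_form m i) + (\<Sum>j<v. ?\<tau> (H j) * extend_scalars (f j))"
      by (simp add: coeff_fract.hom_add coeff_fract.hom_sum coeff_fract.hom_mult coeff_fract_gen_form coeff_fract_lift_const)
    also have "\<dots> = (\<Sum>i<d. single 0 (to_fract q) * (g e i * z_form m i))
        + (\<Sum>j<v. single 0 (to_fract q) * (h e j * extend_scalars (f j)))"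
      using G H by (intro arg_cong2[of _ _ _ _ "(+)"] sum.cong) (auto simp: mult.assoc)
    also have "\<dots> = single 0 (to_fract q) * monomial e"
    proof -
      have "monomial e = (\<Sum>i<d. g e i * z_form m i) + (\<Sum>j<v. h e j * extend_scalars (f j))" using gh e by blast
      then show ?thesis by (simp only: distrib_left sum_distrib_left)
    qed
    also have "\<dots> = ?\<tau> (single 0 q * monomial e)"
      by (simp add: coeff_fract.hom_mult mapcoeff_single mapcoeff_monomial)
    \<comment> \<open>Injectivity brings the relation, multiplied by \<open>q\<close>, down to
      k[u][x], where it can be evaluated at \<open>a\<close>.\<close>
    finally have "(\<Sum>i<d. G i * gen_form m i) + (\<Sum>j<v. H j * ?\<kappa> (f j)) = single 0 q * monomial e"
      by (rule inj_coeff_fract)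
    then have "?\<eta> (single 0 q * monomial e) = ?\<eta> ((\<Sum>i<d. G i * gen_form m i) + (\<Sum>j<v. H j * ?\<kappa> (f j)))"
      by (rule arg_cong[OF sym])
    also have "\<dots> = (\<Sum>i<d. ?\<eta> (G i) * ?y i) + (\<Sum>j<v. ?\<eta> (H j) * f j)"
      by (simp add: ec.hom_add ec.hom_sum ec.hom_mult eval_coeff_gen_form eval_coeff_lift_const)
    also have "\<dots> \<in> R.Gen (?y ` {..<d} \<union> I)"
    proof (rule R.Gen_familyI[OF form_poly[OF special_form_form] I(1)])
      have \<eta>: "?\<eta> P \<in> RR" if "P \<in> polys TT {..<m}" for P
        by (rule mapcoeff_polys[OF _ _ that]) auto
      show "?\<eta> (G i) \<in> RR" if "i < d" for i using \<eta> G that by blast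
      show "(\<Sum>j<v. ?\<eta> (H j) * f j) \<in> I"
      proof (rule R.ideal_sum[OF I(1)])
        fix j assume j: "j \<in> {..<v}"
        then have "?\<eta> (H j) \<in> RR" using \<eta> H by blast
        then show "?\<eta> (H j) * f j \<in> I" using fI j by (intro R.ideal_mult[OF I(1)]) auto
      qed
    qed
    also have "?\<eta> (single 0 q * monomial e) = single 0 (eval_mpol a q) * monomial e"
      by (simp add: ec.hom_mult mapcoeff_single mapcoeff_monomial)
    finally have "single 0 (eval_mpol a q) * monomial e \<in> R.Gen (?y ` {..<d} \<union> I)" .
    then have "single 0 (inverse (eval_mpol a q)) * (single 0 (eval_mpol a q) * monomial e) \<in> R.Gen (?y ` {..<d} \<union> I)"
      by (rule R.ideal_mult[OF J const_poly[OF UNIV_I]])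
    moreover have "single 0 (inverse (eval_mpol a q)) * (single 0 (eval_mpol a q) * monomial e) = monomial e"
      using a by (simp add: monomial_def mult_single)
    ultimately show ?thesis by (simp only:)
  qed
  then have "lforms n \<subseteq> R.Gen (?y ` {..<d} \<union> I)" unfolding forms_subset_iff[OF J] by blast
  then show ?thesis by blast
qed

end

end

section \<open>Full rank over a subfield\<close>

text \<open>A basis of the span is independent in \<open>V\<close> as well; if it has
  \<open>dim\<close> elements, it is already a basis of \<open>V\<close>.\<close>

lemma (in vectorspace) dim_span_eq_dim_iff:
  assumes fd: "fin_dim" and S: "finite S" "S \<subseteq> carrier V"
  shows "vectorspace.dim K (vs (span S)) = dim \<longleftrightarrow> span S = carrier V"
proof
  let ?W = "span S"
  have sub: "subspace K ?W V" by (rule span_is_subspace[OF S(2)])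
  then have sm: "LinearCombinations.submodule K ?W V" by (simp add: subspace_def)
  interpret W: vectorspace K "vs ?W" by (rule subspace_is_vs[OF sub])
  have SW: "S \<subseteq> ?W" by (rule in_own_span[OF S(2)])
  have "W.span S = carrier (vs ?W)" using span_li_not_depend(1)[OF SW sm] by simp
  then have "W.fin_dim" unfolding W.fin_dim_def using S(1) SW by (intro exI[of _ S]) simp
  then obtain \<beta> where \<beta>: "finite \<beta>" "W.basis \<beta>" using W.finite_basis_exists by blast
  have \<beta>W: "\<beta> \<subseteq> ?W" using \<beta>(2) by (simp add: W.basis_def)
  have \<beta>V: "\<beta> \<subseteq> carrier V" using \<beta>W LinearCombinations.submodule.subset[OF sm] by blast
  assume "W.dim = dim"
  then have card: "card \<beta> = dim" using W.dim_basis[OF \<beta>] by simp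
  have "lin_indpt \<beta>" using \<beta>(2) span_li_not_depend(2)[OF \<beta>W sm] by (simp add: W.basis_def)
  then have "basis \<beta>" by (intro dim_li_is_basis[OF fd \<beta>(1) \<beta>V]) (simp_all add: card)
  then have "span \<beta> = carrier V" by (simp add: basis_def)
  moreover have "span \<beta> \<subseteq> ?W" by (rule span_is_subset[OF \<beta>W sm])
  ultimately show "?W = carrier V" using LinearCombinations.submodule.subset[OF sm] by blast
qed simp

locale csubfield = csubring C for C :: "'a::field set" +
  assumes inverse: "x \<in> C \<Longrightarrow> inverse x \<in> C"
begin

lemma field: "field (ring_on C)"
proof -
  interpret cring "ring_on C" by (rule cring)
  have "Units (ring_on C) = carrier (ring_on C) - {\<zero>\<^bsub>ring_on C\<^esub>}"
  proof (intro subset_antisym subsetI)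
    fix x assume "x \<in> Units (ring_on C)"
    then obtain y where "x \<in> C" "x * y = 1" by (auto simp: Units_def ring_on_def)
    then show "x \<in> carrier (ring_on C) - {\<zero>\<^bsub>ring_on C\<^esub>}" by (auto simp: ring_on_def)
  next
    fix x assume "x \<in> carrier (ring_on C) - {\<zero>\<^bsub>ring_on C\<^esub>}"
    then have "x \<in> C" "x \<noteq> 0" by (auto simp: ring_on_def)
    then show "x \<in> Units (ring_on C)"
      unfolding Units_def by (auto simp: ring_on_def intro!: bexI[of _ "inverse x"] inverse)
  qed
  then show ?thesis by (rule cring_fieldI)
qed

lemma vec_vectorspace: "vectorspace (ring_on C) (vec_module_on C n)"
proof -
  interpret field "ring_on C" by (rule field)
  have "abelian_group (vec_module_on C n)"
  proof (rule abelian_groupI)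
    fix x assume x: "x \<in> carrier (vec_module_on C n)"
    show "\<exists>y\<in>carrier (vec_module_on C n). y \<oplus>\<^bsub>vec_module_on C n\<^esub> x = \<zero>\<^bsub>vec_module_on C n\<^esub>"
      by (rule bexI[of _ "- x"]) (use x uminus in \<open>auto simp: vec_module_on_def\<close>)
  next
    fix x y assume xy: "x \<in> carrier (vec_module_on C n)" "y \<in> carrier (vec_module_on C n)"
    have "x $ i + y $ i \<in> C" if "i < n" for i
      by (rule csubring.add[OF csubring_axioms]) (use xy that in \<open>auto simp: vec_module_on_def\<close>)
    then show "x \<oplus>\<^bsub>vec_module_on C n\<^esub> y \<in> carrier (vec_module_on C n)"
      using xy by (auto simp: vec_module_on_def)
  qed (auto simp: vec_module_on_def assoc_add_vec comm_add_vec)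
  moreover have "c * x $ i \<in> C" if "c \<in> C" "x \<in> carrier (vec_module_on C n)" "i < n" for c x i
    by (rule csubring.mult[OF csubring_axioms]) (use that in \<open>auto simp: vec_module_on_def\<close>)
  ultimately have "module (ring_on C) (vec_module_on C n)"
    by (intro moduleI cring)
      (auto simp: vec_module_on_def ring_on_def add_smult_distrib_vec smult_add_distrib_vec smult_smult_assoc
        intro: csubring.mult[OF csubring_axioms])
  then show ?thesis
    by (intro vectorspace.intro field)
qed

context
  fixes n :: nat
begin

interpretation V: vectorspace "ring_on C" "vec_module_on C n" by (rule vec_vectorspace)

lemma finsum_vec_index:
  assumes "finite A" "g \<in> A \<rightarrow> carrier (vec_module_on C n)" "i < n"
  shows "finsum (vec_module_on C n) g A $ i = (\<Sum>x\<in>A. g x $ i)"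
  using assms(1,2)
proof (induction A rule: finite_induct)
  case empty
  have "finsum (vec_module_on C n) g {} = 0\<^sub>v n"
    using V.finsum_empty[of g] by (simp add: vec_module_on_def)
  then show ?case using assms(3) by simp
next
  case (insert x A)
  have "finsum (vec_module_on C n) g A \<in> carrier (vec_module_on C n)"
    using insert.prems by (intro V.finsum_closed) auto
  then show ?case using insert assms(3)
    by (subst V.finsum_insert) (auto simp: vec_module_on_def Pi_iff)
qed

lemma lincomb_vec_index:
  assumes "finite A" "A \<subseteq> carrier (vec_module_on C n)" "a \<in> A \<rightarrow> C" "i < n"
  shows "V.lincomb a A $ i = (\<Sum>x\<in>A. a x * x $ i)"
proof -
  have "V.lincomb a A $ i = (\<Sum>x\<in>A. (a x \<odot>\<^bsub>vec_module_on C n\<^esub> x) $ i)"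
    unfolding V.lincomb_def
    by (rule finsum_vec_index[OF assms(1) _ assms(4)])
      (use assms(2,3) mult in \<open>auto simp: vec_module_on_def Pi_iff subset_iff\<close>)
  also have "\<dots> = (\<Sum>x\<in>A. a x * x $ i)"
    using assms(2,4) by (intro sum.cong) (auto simp: vec_module_on_def subset_iff)
  finally show ?thesis .
qed

lemma unit_vecs_basis: "V.basis (unit_vec n ` {..<n})"
proof -
  let ?A = "unit_vec n ` {..<n} :: 'a vec set"
  have A: "finite ?A" "?A \<subseteq> carrier (vec_module_on C n)"
    by (auto simp: vec_module_on_def unit_vec_def)
  have inj: "inj_on (unit_vec n :: nat \<Rightarrow> 'a vec) {..<n}"
    by (auto simp: inj_on_def unit_vec_eq)
  have idx: "V.lincomb a ?A $ i = a (unit_vec n i)" if "a \<in> ?A \<rightarrow> C" "i < n" for a i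
  proof -
    have "V.lincomb a ?A $ i = (\<Sum>x\<in>?A. a x * x $ i)"
      by (rule lincomb_vec_index[OF A that])
    also have "\<dots> = (\<Sum>k\<in>{..<n}. a (unit_vec n k) * unit_vec n k $ i)"
      by (simp add: sum.reindex[OF inj])
    also have "\<dots> = (\<Sum>k\<in>{..<n}. if k = i then a (unit_vec n k) else 0)"
      using that(2) by (intro sum.cong) (auto simp: unit_vec_def)
    also have "\<dots> = a (unit_vec n i)" using that(2) by (subst sum.delta) auto
    finally show ?thesis .
  qed
  show ?thesis
    unfolding V.basis_criterion[OF A]
  proof (intro allI impI)
    fix w assume w: "w \<in> carrier (vec_module_on C n)"
    \<comment> \<open>The coordinates of \<open>w\<close>, made \<open>undefined\<close> elsewhere
      because the basis criterion asks for uniqueness among extensional functions.\<close>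
    define a where "a x = (if x \<in> ?A then w $ (the_inv_into {..<n} (unit_vec n :: nat \<Rightarrow> 'a vec) x) else undefined)" for x
    have a: "a (unit_vec n i) = w $ i" if "i < n" for i
      using that the_inv_into_f_f[OF inj, of i] by (simp add: a_def)
    have aE: "a \<in> ?A \<rightarrow>\<^sub>E C"
    proof (rule PiE_I)
      fix x assume "x \<in> ?A"
      then show "a x \<in> C" using a w by (auto simp: vec_module_on_def)
    qed (simp add: a_def)
    then have aP: "a \<in> ?A \<rightarrow> C" by (auto simp: PiE_def)
    have dim_w: "dim_vec w = n" using w by (auto simp: vec_module_on_def)
    have dim_l: "dim_vec (V.lincomb b ?A) = n" if "b \<in> ?A \<rightarrow> C" for b
    proof -
      have "V.lincomb b ?A \<in> carrier (vec_module_on C n)"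
        using that by (intro V.lincomb_closed A(2)) (simp add: ring_on_def)
      then show ?thesis by (auto simp: vec_module_on_def)
    qed
    show "\<exists>!a. a \<in> ?A \<rightarrow>\<^sub>E carrier (ring_on C) \<and> V.lincomb a ?A = w"
    proof (rule ex1I[of _ a])
      have "V.lincomb a ?A = w"
        by (rule eq_vecI) (use idx[OF aP] a dim_l[OF aP] dim_w in auto)
      then show "a \<in> ?A \<rightarrow>\<^sub>E carrier (ring_on C) \<and> V.lincomb a ?A = w"
        using aE by (simp add: ring_on_def)
      fix b assume b: "b \<in> ?A \<rightarrow>\<^sub>E carrier (ring_on C) \<and> V.lincomb b ?A = w"
      then have bE: "b \<in> ?A \<rightarrow>\<^sub>E C" by (simp add: ring_on_def)
      then have bP: "b \<in> ?A \<rightarrow> C" by (auto simp: PiE_def)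
      show "b = a"
      proof (rule PiE_ext[OF bE aE])
        fix x assume "x \<in> ?A"
        then obtain i where i: "i < n" "x = unit_vec n i" by auto
        have "b x = V.lincomb b ?A $ i" using idx[OF bP i(1)] i(2) by simp
        also have "V.lincomb b ?A = w" using b by blast
        also have "w $ i = a x" using a[OF i(1)] i(2) by simp
        finally show "b x = a x" .
      qed
    qed
  qed
qed

lemma dim_vec_module_on: "V.fin_dim" "V.dim = n"
proof -
  let ?A = "unit_vec n ` {..<n} :: 'a vec set"
  have inj: "inj_on (unit_vec n :: nat \<Rightarrow> 'a vec) {..<n}"
    by (auto simp: inj_on_def unit_vec_eq)
  have "V.gen_set ?A" "?A \<subseteq> carrier (vec_module_on C n)" using unit_vecs_basis by (simp_all add: V.basis_def)
  then show "V.fin_dim" unfolding V.fin_dim_def by blast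
  show "V.dim = n" using V.dim_basis[OF _ unit_vecs_basis] card_image[OF inj] by simp
qed

lemma rank_over_full_iff:
  assumes "dim_row X = n" "set (cols X) \<subseteq> carrier (vec_module_on C n)"
  shows "rank_over C X = n \<longleftrightarrow> V.span (set (cols X)) = carrier (vec_module_on C n)"
  using V.dim_span_eq_dim_iff[OF dim_vec_module_on(1) _ assms(2)] dim_vec_module_on(2)
  by (simp add: rank_over_def assms(1) Let_def)

lemma span_induct_vec:
  assumes S: "S \<subseteq> carrier (vec_module_on C n)" and W: "S \<subseteq> W" "W \<subseteq> carrier (vec_module_on C n)"
    and "0\<^sub>v n \<in> W" "\<And>x y. x \<in> W \<Longrightarrow> y \<in> W \<Longrightarrow> x + y \<in> W" "\<And>c x. c \<in> C \<Longrightarrow> x \<in> W \<Longrightarrow> c \<cdot>\<^sub>v x \<in> W"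
  shows "V.span S \<subseteq> W"
proof (rule V.span_is_subset[OF W(1)])
  show "LinearCombinations.submodule (ring_on C) W (vec_module_on C n)"
    by (rule LinearCombinations.submodule.intro[OF V.module_axioms])
      (use assms(3-) in \<open>auto simp: vec_module_on_def ring_on_def\<close>)
qed

lemma span_vec_closed:
  assumes S: "S \<subseteq> carrier (vec_module_on C n)"
  shows "S \<subseteq> V.span S" "0\<^sub>v n \<in> V.span S"
    "x \<in> V.span S \<Longrightarrow> y \<in> V.span S \<Longrightarrow> x + y \<in> V.span S"
    "c \<in> C \<Longrightarrow> x \<in> V.span S \<Longrightarrow> c \<cdot>\<^sub>v x \<in> V.span S"
proof -
  have sm: "LinearCombinations.submodule (ring_on C) (V.span S) (vec_module_on C n)" by (rule V.span_is_submodule[OF S])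
  show "S \<subseteq> V.span S" by (rule V.in_own_span[OF S])
  show "0\<^sub>v n \<in> V.span S" using V.span_zero[of S] by (simp add: vec_module_on_def)
  show "x \<in> V.span S \<Longrightarrow> y \<in> V.span S \<Longrightarrow> x + y \<in> V.span S"
    using LinearCombinations.submodule.m_closed[OF sm, of x y] by (simp add: vec_module_on_def)
  show "c \<in> C \<Longrightarrow> x \<in> V.span S \<Longrightarrow> c \<cdot>\<^sub>v x \<in> V.span S"
    using LinearCombinations.submodule.smult_closed[OF sm, of c x] by (simp add: vec_module_on_def ring_on_def)
qed

end

end

section \<open>The matrix of the generic reduction\<close>

lemma set_monomials:
  assumes "1 \<le> m"
  shows "set (monomials m k) = {e. keys e \<subseteq> {..<m} \<and> int (total_deg e) = k}" "distinct (monomials m k)"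
proof -
  have "finite {e. keys e \<subseteq> {..<m} \<and> int (total_deg e) = k}"
    by (rule finite_subset[OF _ card_mons(1)[OF assms, of "nat k"]]) (auto simp: mons_def)
  then show "set (monomials m k) = {e. keys e \<subseteq> {..<m} \<and> int (total_deg e) = k}"
    unfolding monomials_def by (rule set_sorted_list_of_set)
  show "distinct (monomials m k)" by (simp add: monomials_def)
qed

lemma set_monomials_nat: "1 \<le> m \<Longrightarrow> set (monomials m (int n)) = mons {..<m} n"
  by (auto simp: set_monomials mons_def)

lemma length_monomials: "1 \<le> m \<Longrightarrow> length (monomials m (int n)) = (n + m - 1) choose n"
  by (metis card_mons(2) distinct_card set_monomials(2) set_monomials_nat)

context generic_forms begin

lemma CC_csubfield: "csubfield CC"
  by (rule csubfield.intro[OF CC_csubring]) (unfold_locales, rule inverse_mem)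

interpretation CF: csubfield CC by (rule CC_csubfield)

context
  fixes n :: nat
begin

definition coeff_vec :: "'k mpol fract mpol \<Rightarrow> 'k mpol fract vec" where
  "coeff_vec p = vec (length (monomials m (int n))) (\<lambda>r. lookup p (monomials m (int n) ! r))"

abbreviation "NN \<equiv> length (monomials m (int n))"

lemma coeff_vec_carrier: "p \<in> uforms k \<Longrightarrow> coeff_vec p \<in> carrier (vec_module_on CC NN)"
  by (simp add: coeff_vec_def vec_module_on_def forms_lookup)

lemma coeff_vec_zero: "coeff_vec 0 = 0\<^sub>v NN"
  by (rule eq_vecI) (simp_all add: coeff_vec_def)

lemma coeff_vec_add: "coeff_vec (p + q) = coeff_vec p + coeff_vec q"
  by (rule eq_vecI) (simp_all add: coeff_vec_def lookup_add)

lemma coeff_vec_scale: "coeff_vec (single 0 c * p) = c \<cdot>\<^sub>v coeff_vec p"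
  by (rule eq_vecI) (simp_all add: coeff_vec_def lookup_const_mult)

lemma coeff_vec_inj:
  assumes "p \<in> uforms n" "q \<in> uforms n" "coeff_vec p = coeff_vec q"
  shows "p = q"
proof (rule poly_mapping_eqI)
  fix e
  show "lookup p e = lookup q e"
  proof (cases "e \<in> mons {..<m} n")
    case True
    then obtain r where r: "r < NN" "monomials m (int n) ! r = e"
      using set_monomials_nat[OF m1, of n] by (metis in_set_conv_nth)
    have "coeff_vec p $ r = coeff_vec q $ r" using assms(3) by simp
    then show ?thesis using r by (simp add: coeff_vec_def)
  next
    case False
    then have "lookup p e = 0" "lookup q e = 0"
      using assms(1,2) by (auto simp: forms_lookup in_keys_iff)
    then show ?thesis by simp
  qed
qed

lemma coeff_vec_surj:
  assumes w: "w \<in> carrier (vec_module_on CC NN)"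
  shows "\<exists>p\<in>uforms n. coeff_vec p = w"
proof -
  let ?es = "monomials m (int n)"
  let ?p = "\<Sum>r<NN. single (?es ! r) (w $ r)"
  have w': "dim_vec w = NN" "\<And>r. r < NN \<Longrightarrow> w $ r \<in> CC" using w by (auto simp: vec_module_on_def)
  have "?p \<in> uforms n"
  proof (rule U.forms_sum)
    fix r assume "r \<in> {..<NN}"
    then have r: "r < NN" by simp
    then have "?es ! r \<in> mons {..<m} n" using set_monomials_nat[OF m1, of n] nth_mem by blast
    then show "single (?es ! r) (w $ r) \<in> uforms n"
      using w'(2)[OF r] by (auto simp: forms_lookup lookup_single when_def)
  qed
  moreover have "coeff_vec ?p = w"
  proof (rule eq_vecI)
    fix s assume "s < dim_vec w"
    then have s: "s < NN" using w'(1) by simp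
    have "lookup ?p (?es ! s) = (\<Sum>r\<in>{..<NN}. if r = s then w $ r else 0)"
      unfolding lookup_sum lookup_single when_def using s set_monomials(2)[OF m1]
      by (intro sum.cong) (auto simp: nth_eq_iff_index_eq)
    also have "\<dots> = w $ s" using s by (subst sum.delta) auto
    finally show "coeff_vec ?p $ s = w $ s" using s by (simp add: coeff_vec_def)
  qed (simp add: w'(1) coeff_vec_def)
  ultimately show ?thesis by blast
qed

section \<open>Columns of the matrix and the degree \<open>n\<close> part of the ideal\<close>

context
  fixes I :: "'k mpol set" and f :: "nat \<Rightarrow> 'k mpol" and dg :: "nat \<Rightarrow> nat" and v :: nat
  assumes I: "R.is_ideal I" "hc_closed I"
    and f: "\<And>j. j < v \<Longrightarrow> f j \<in> lforms (dg j)" and If: "I = R.Gen (f ` {..<v})"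
begin

abbreviation "JJ \<equiv> U.R.Gen (z_form m ` {..<d} \<union> IRu d m I)"
abbreviation "gens \<equiv> set (M_gens d m v f dg n)"

text \<open>The integer differences become sums of natural numbers, so a generator of degree above
  \<open>n\<close> yields no column.\<close>

lemma gens_eq:
  "gens = {z_form m i * monomial g | i g. i < d \<and> keys g \<subseteq> {..<m} \<and> total_deg g + 1 = n} \<union>
     {extend_scalars (f j) * monomial h | j h. j < v \<and> keys h \<subseteq> {..<m} \<and> total_deg h + dg j = n}"
proof -
  have 1: "int (total_deg g) = int n - 1 \<longleftrightarrow> total_deg g + 1 = n" for g by linarith
  have 2: "int (total_deg h) = int n - int k \<longleftrightarrow> total_deg h + k = n" for h k by linarith
  have "gens = (\<Union>i<d. (\<lambda>g. z_form m i * monomial g) ` set (monomials m (int n - 1))) \<union>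
     (\<Union>j<v. (\<lambda>h. extend_scalars (f j) * monomial h) ` set (monomials m (int n - int (dg j))))"
    by (simp add: M_gens_def atLeast0LessThan)
  also have "\<dots> = {z_form m i * monomial g | i g. i < d \<and> keys g \<subseteq> {..<m} \<and> total_deg g + 1 = n} \<union>
     {extend_scalars (f j) * monomial h | j h. j < v \<and> keys h \<subseteq> {..<m} \<and> total_deg h + dg j = n}"
    unfolding set_monomials(1)[OF m1] 1 2 by (intro arg_cong2[of _ _ _ _ "(\<union>)"]) blast+
  finally show ?thesis .
qed

lemma JJ_ideal: "ideal JJ (ring_on (UU))"
  by (rule generic_family_ideal[OF I])

lemma JJ_self: "z_form m ` {..<d} \<union> IRu d m I \<subseteq> JJ"
  by (rule U.R.Gen_self[OF generic_family_sub[OF I]])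

lemma f_mem_I: "j < v \<Longrightarrow> f j \<in> I"
proof -
  have "f ` {..<v} \<subseteq> RR" using f form_poly by blast
  then show "j < v \<Longrightarrow> f j \<in> I" unfolding If using R.Gen_self by blast
qed

lemma monomial_U: "keys e \<subseteq> {..<m} \<Longrightarrow> monomial e \<in> uforms (total_deg e)"
  by (rule monomial_form) (auto simp: mons_def)

lemma gens_sub: "gens \<subseteq> uforms n \<inter> JJ"
proof
  fix x assume "x \<in> gens"
  then consider i g where "x = z_form m i * monomial g" "i < d" "keys g \<subseteq> {..<m}" "total_deg g + 1 = n"
    | j h where "x = extend_scalars (f j) * monomial h" "j < v" "keys h \<subseteq> {..<m}" "total_deg h + dg j = n"
    unfolding gens_eq by blast
  then show "x \<in> uforms n \<inter> JJ"
  proof cases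
    case 1
    have "x \<in> uforms (1 + total_deg g)"
      unfolding 1(1) by (rule U.forms_mult[OF z_form_form[OF 1(2)] monomial_U[OF 1(3)]])
    moreover have "monomial g * z_form m i \<in> JJ"
      by (rule U.R.ideal_mult[OF JJ_ideal U.form_poly[OF monomial_U[OF 1(3)]]]) (use JJ_self 1(2) in blast)
    ultimately show ?thesis using 1(4) by (simp add: 1(1) mult.commute)
  next
    case 2
    have "x \<in> uforms (dg j + total_deg h)"
      unfolding 2(1) by (rule U.forms_mult[OF extend_scalars_form[OF f[OF 2(2)]] monomial_U[OF 2(3)]])
    moreover have "extend_scalars (f j) \<in> JJ"
      using extend_sub_IRu[OF I] f_mem_I[OF 2(2)] JJ_self by blast
    then have "monomial h * extend_scalars (f j) \<in> JJ"
      by (rule U.R.ideal_mult[OF JJ_ideal U.form_poly[OF monomial_U[OF 2(3)]]])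
    ultimately show ?thesis using 2(4) by (simp add: 2(1) mult.commute add.commute)
  qed
qed

lemma set_cols: "set (cols (M_mat d m v f dg n)) = coeff_vec ` gens"
proof -
  have "cols (M_mat d m v f dg n) = map coeff_vec (M_gens d m v f dg n)"
    by (rule nth_equalityI) (auto simp: M_mat_def coeff_vec_def intro!: eq_vecI)
  then show ?thesis by simp
qed

abbreviation "SP \<equiv> LinearCombinations.module.span (ring_on CC) (vec_module_on CC NN) (coeff_vec ` gens)"

lemma coeff_vec_gens_carrier: "coeff_vec ` gens \<subseteq> carrier (vec_module_on CC NN)"
  using gens_sub coeff_vec_carrier by blast

lemma rank_iff: "rank_over CC (M_mat d m v f dg n) = NN \<longleftrightarrow> SP = carrier (vec_module_on CC NN)"
proof -
  have "dim_row (M_mat d m v f dg n) = NN" by (simp add: M_mat_def)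
  moreover have "set (cols (M_mat d m v f dg n)) \<subseteq> carrier (vec_module_on CC NN)"
    unfolding set_cols by (rule coeff_vec_gens_carrier)
  ultimately show ?thesis using CF.rank_over_full_iff[of "M_mat d m v f dg n" NN] by (simp only: set_cols)
qed

lemma z_mem_gens: "i < d \<Longrightarrow> 1 \<le> n \<Longrightarrow> e \<in> mons {..<m} (n - 1) \<Longrightarrow> z_form m i * monomial e \<in> gens"
  unfolding gens_eq
  by (rule UnI1, rule CollectI, rule exI[of _ i], rule exI[of _ e]) (auto simp: mons_def)

lemma f_mem_gens:
  "j < v \<Longrightarrow> dg j \<le> n \<Longrightarrow> e \<in> mons {..<m} (n - dg j) \<Longrightarrow> extend_scalars (f j) * monomial e \<in> gens"
  unfolding gens_eq
  by (rule UnI2, rule CollectI, rule exI[of _ j], rule exI[of _ e]) (auto simp: mons_def)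

text \<open>The coefficient vectors of forms of degree \<open>n\<close> in the ideal make up a
  subspace over k(u), and it contains the columns.\<close>

lemma span_sub: "SP \<subseteq> coeff_vec ` (uforms n \<inter> JJ)"
proof (rule CF.span_induct_vec[OF coeff_vec_gens_carrier])
  show "coeff_vec ` gens \<subseteq> coeff_vec ` (uforms n \<inter> JJ)" using gens_sub by (rule image_mono)
  show "coeff_vec ` (uforms n \<inter> JJ) \<subseteq> carrier (vec_module_on CC NN)" using coeff_vec_carrier by blast
  show "0\<^sub>v NN \<in> coeff_vec ` (uforms n \<inter> JJ)"
    by (rule image_eqI[of _ _ 0]) (simp_all add: coeff_vec_zero U.R.ideal_zero[OF JJ_ideal])
next
  fix x y assume "x \<in> coeff_vec ` (uforms n \<inter> JJ)" "y \<in> coeff_vec ` (uforms n \<inter> JJ)"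
  then obtain p q where "p \<in> uforms n" "p \<in> JJ" "x = coeff_vec p"
    "q \<in> uforms n" "q \<in> JJ" "y = coeff_vec q" by blast
  then show "x + y \<in> coeff_vec ` (uforms n \<inter> JJ)"
    by (intro image_eqI[of _ _ "p + q"]) (auto simp: coeff_vec_add intro: U.forms_add U.R.ideal_add[OF JJ_ideal])
next
  fix c x assume c: "c \<in> CC" and "x \<in> coeff_vec ` (uforms n \<inter> JJ)"
  then obtain p where "p \<in> uforms n" "p \<in> JJ" "x = coeff_vec p" by blast
  then show "c \<cdot>\<^sub>v x \<in> coeff_vec ` (uforms n \<inter> JJ)"
    using c by (intro image_eqI[of _ _ "single 0 c * p"])
      (auto simp: coeff_vec_scale intro: U.forms_scale U.R.ideal_mult[OF JJ_ideal] U.const_poly)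
qed

lemma coeff_vec_sum_span:
  assumes "\<And>i. i \<in> A \<Longrightarrow> coeff_vec (p i) \<in> SP"
  shows "coeff_vec (sum p A) \<in> SP"
  using assms
  by (induction A rule: infinite_finite_induct)
    (simp_all add: coeff_vec_zero coeff_vec_add CF.span_vec_closed[OF coeff_vec_gens_carrier])

lemma coeff_vec_mult_span:
  assumes g: "g \<in> uforms k" and y: "\<And>e. e \<in> mons {..<m} k \<Longrightarrow> y * monomial e \<in> gens"
  shows "coeff_vec (g * y) \<in> SP"
proof -
  have "g * y = (\<Sum>e\<in>keys g. single 0 (lookup g e) * (y * monomial e))"
  proof -
    have "g * y = (\<Sum>e\<in>keys g. single 0 (lookup g e) * monomial e) * y"
      by (rule arg_cong[OF form_eq_sum_monomials])
    also have "\<dots> = (\<Sum>e\<in>keys g. single 0 (lookup g e) * monomial e * y)" by (rule sum_distrib_right)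
    finally show ?thesis by (simp only: mult_ac)
  qed
  also have "coeff_vec \<dots> \<in> SP"
  proof (rule coeff_vec_sum_span)
    fix e assume "e \<in> keys g"
    then have e: "e \<in> mons {..<m} k" "lookup g e \<in> CC" using g by (auto simp: forms_lookup)
    have "coeff_vec (y * monomial e) \<in> SP"
      using y[OF e(1)] CF.span_vec_closed(1)[OF coeff_vec_gens_carrier] by blast
    then show "coeff_vec (single 0 (lookup g e) * (y * monomial e)) \<in> SP"
      unfolding coeff_vec_scale by (rule CF.span_vec_closed(4)[OF coeff_vec_gens_carrier e(2)])
  qed
  finally show ?thesis .
qed

text \<open>Converse of \<open>span_sub\<close>, by two decompositions in degree \<open>n\<close>:
  over the \<open>z_form m i\<close> modulo the extended ideal, then over the \<open>f j\<close>
  modulo \<open>{0}\<close>. Expanding the coefficients into monomials leaves only columns.\<close>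

lemma coeff_vec_JJ_span:
  assumes p: "p \<in> uforms n" "p \<in> JJ"
  shows "coeff_vec p \<in> SP"
proof (rule U.Gen_form_decomp[where \<delta> = "\<lambda>_. 1", OF z_form_form IRu_ideal[OF I] IRu_hc_closed[OF I] p(2,1)])
  fix g h
  assume g: "\<And>i. i < d \<Longrightarrow> g i \<in> (if 1 \<le> n then uforms (n - 1) else {0})"
    and h: "h \<in> IRu d m I" "h \<in> uforms n" and eq: "p = (\<Sum>i<d. g i * z_form m i) + h"
  have 0: "coeff_vec 0 \<in> SP"
    unfolding coeff_vec_zero by (rule CF.span_vec_closed(2)[OF coeff_vec_gens_carrier])
  have gz: "coeff_vec (g i * z_form m i) \<in> SP" if i: "i < d" for i
  proof (cases "1 \<le> n")
    case True
    show ?thesis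
      by (rule coeff_vec_mult_span[of _ "n - 1"]) (use g[OF i] True i z_mem_gens in auto)
  next
    case False
    then have "g i = 0" using g[OF i] by simp
    then show ?thesis using 0 by simp
  qed
  have fR: "f j \<in> RR" if "j < v" for j using f[OF that] by (rule form_poly)
  have hG: "h \<in> U.R.Gen ((\<lambda>j. extend_scalars (f j)) ` {..<v} \<union> {0})"
    by (rule subsetD[OF IRu_subset_Gen[OF I fR If] h(1)])
  have hc0: "hc_closed {0}" by (simp add: hc_closed_def)
  have hS: "coeff_vec h \<in> SP"
  proof (rule U.Gen_form_decomp[where \<delta> = dg, OF extend_scalars_form[OF f] zero_ideal_U hc0 hG h(2)])
    fix k z
    assume k: "\<And>j. j < v \<Longrightarrow> k j \<in> (if dg j \<le> n then uforms (n - dg j) else {0})"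
      and z: "z \<in> {0}" and eqh: "h = (\<Sum>j<v. k j * extend_scalars (f j)) + z"
    have "coeff_vec (k j * extend_scalars (f j)) \<in> SP" if j: "j < v" for j
    proof (cases "dg j \<le> n")
      case True
      show ?thesis
        by (rule coeff_vec_mult_span[of _ "n - dg j"]) (use k[OF j] True j f_mem_gens in auto)
    next
      case False
      then have "k j = 0" using k[OF j] by simp
      then show ?thesis using 0 by simp
    qed
    then have "coeff_vec (\<Sum>j<v. k j * extend_scalars (f j)) \<in> SP" by (intro coeff_vec_sum_span) auto
    then show "coeff_vec h \<in> SP" using z eqh by simp
  qed
  have "coeff_vec (\<Sum>i<d. g i * z_form m i) \<in> SP" using gz by (intro coeff_vec_sum_span) auto
  then show ?thesis unfolding eq coeff_vec_add
    using hS by (rule CF.span_vec_closed(3)[OF coeff_vec_gens_carrier])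
qed

text \<open>The rows are indexed by all monomials of degree \<open>n\<close>, so the binomial
  coefficient is the full row rank, and \<open>coeff_vec\<close> identifies forms of degree
  \<open>n\<close> with column vectors.\<close>

lemma rank_full_iff:
  "rank_over CC (M_mat d m v f dg n) = (n + m - 1) choose n \<longleftrightarrow> uforms n \<subseteq> JJ"
proof -
  have "rank_over CC (M_mat d m v f dg n) = (n + m - 1) choose n \<longleftrightarrow> SP = carrier (vec_module_on CC NN)"
    unfolding length_monomials[OF m1, symmetric] by (rule rank_iff)
  also have "\<dots> \<longleftrightarrow> uforms n \<subseteq> JJ"
  proof
    assume S: "SP = carrier (vec_module_on CC NN)"
    show "uforms n \<subseteq> JJ"
    proof
      fix p assume p: "p \<in> uforms n"
      then have "coeff_vec p \<in> coeff_vec ` (uforms n \<inter> JJ)"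
        using coeff_vec_carrier S span_sub by blast
      then obtain q where "q \<in> uforms n" "q \<in> JJ" "coeff_vec p = coeff_vec q" by blast
      then show "p \<in> JJ" using coeff_vec_inj[OF p] by blast
    qed
  next
    assume le: "uforms n \<subseteq> JJ"
    show "SP = carrier (vec_module_on CC NN)"
    proof
      show "SP \<subseteq> carrier (vec_module_on CC NN)" using span_sub coeff_vec_carrier by blast
      show "carrier (vec_module_on CC NN) \<subseteq> SP"
      proof
        fix w assume "w \<in> carrier (vec_module_on CC NN)"
        then obtain p where "p \<in> uforms n" "coeff_vec p = w" using coeff_vec_surj by blast
        then show "w \<in> SP" using coeff_vec_JJ_span le by blast
      qed
    qed
  qed
  finally show ?thesis .
qed

end

end

end

section \<open>Reduction numbers\<close>

text \<open>Every minimal reduction of \<open>A\<close> is a specialisation of the generic one, so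
  the generic number is no larger; a suitable specialisation attains it. The nonemptiness clause
  ensures that \<open>Inf\<close> is a true minimum and not the default value of the empty
  set.\<close>

theorem theorem1p2:
  fixes I :: "'k::field mpol set" and m d v :: nat
    and f :: "nat \<Rightarrow> 'k mpol" and dg :: "nat \<Rightarrow> nat"
  assumes "infinite (UNIV :: 'k set)"
    and "1 \<le> m"
    and "homogeneous_ideal (poly_ring UNIV {..<m}) (forms UNIV {..<m}) I"
    and "I \<noteq> carrier (poly_ring UNIV {..<m})"
    and "krull_dim (A_ring m I) = enat d"
    and "\<And>j. j < v \<Longrightarrow> f j \<in> forms UNIV {..<m} (dg j)"
    and "I = Idl\<^bsub>poly_ring UNIV {..<m}\<^esub> (f ` {..<v})"
  shows "reduction_number (A_ring m I) (A_grading m I)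
           = reduction_number_wrt (Au_ring d m I) (Au_grading d m I) (Qu d m I)
       \<and> {n. rank_over (ratfuns d m) (M_mat d m v f dg (n + 1)) = (n + m) choose (m - 1)} \<noteq> {}
       \<and> reduction_number_wrt (Au_ring d m I) (Au_grading d m I) (Qu d m I)
           = Inf {n. rank_over (ratfuns d m) (M_mat d m v f dg (n + 1)) = (n + m) choose (m - 1)}"
proof -
  interpret generic_forms "TYPE('k)" m d
    by unfold_locales (fact assms(1,2))+
  have I: "R.is_ideal I" "hc_closed I"
    using assms(3) homogeneous_ideal_hc_closed by (auto simp: homogeneous_ideal_def)
  have dim: "krull_dim (ring_on RR Quot I) = enat d" using assms(5) by (simp add: A_ring_def)
  note f = assms(6) and If = assms(7)
  have fR: "f j \<in> RR" if "j < v" for j using f[OF that] by (rule form_poly)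
  let ?J = "U.R.Gen (z_form m ` {..<d} \<union> IRu d m I)"
  let ?P = "\<lambda>n. uforms (Suc n) \<subseteq> ?J"
  have J: "ideal ?J (ring_on (UU))" by (rule generic_family_ideal[OF I])
  have IJ: "IRu d m I \<subseteq> ?J" using U.R.Gen_self[OF generic_family_sub[OF I]] by blast
  \<comment> \<open>The definition adjoins only the image of \<open>I\<close>, but the ideal
    generated together with the \<open>z_form m i\<close> is the same.\<close>
  have Qu: "Qu d m I = (\<lambda>p. IRu d m I +>\<^bsub>Ru d m\<^esub> p) ` ?J"
  proof -
    have s1: "z_form m ` {..<d} \<union> extend_scalars ` I \<subseteq> UU"
      using generic_family_sub[OF I] extend_I_sub[OF I] by blast
    have z: "z_form m ` {..<d} \<subseteq> U.R.Gen (z_form m ` {..<d} \<union> extend_scalars ` I)"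
      and e: "extend_scalars ` I \<subseteq> U.R.Gen (z_form m ` {..<d} \<union> extend_scalars ` I)"
      using U.R.Gen_self[OF s1] by blast+
    have "IRu d m I \<subseteq> U.R.Gen (z_form m ` {..<d} \<union> extend_scalars ` I)"
      unfolding IRu_def by (rule U.R.Gen_mono[OF s1 e])
    then have "?J \<subseteq> U.R.Gen (z_form m ` {..<d} \<union> extend_scalars ` I)"
      using z by (intro U.R.Gen_mono[OF s1] Un_least)
    moreover have "U.R.Gen (z_form m ` {..<d} \<union> extend_scalars ` I) \<subseteq> ?J"
      using U.R.Gen_self[OF generic_family_sub[OF I]] extend_sub_IRu[OF I]
      by (intro U.R.Gen_mono[OF generic_family_sub[OF I]]) blast
    ultimately have "U.R.Gen (z_form m ` {..<d} \<union> extend_scalars ` I) = ?J" by blast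
    then show ?thesis by (simp add: Qu_def)
  qed
  have ru: "reduction_number_wrt (Au_ring d m I) (Au_grading d m I) (Qu d m I) = (LEAST n. ?P n)"
    unfolding Au_grading_def Qu by (rule U.reduction_number_wrt_coset_image[OF IRu_ideal[OF I] J IJ])
  have rank: "rank_over (ratfuns d m) (M_mat d m v f dg (n + 1)) = (n + m) choose (m - 1) \<longleftrightarrow> ?P n" for n
  proof -
    \<comment> \<open>Symmetry of binomial coefficients; \<open>1 \<le> m\<close> gives
      \<open>n + m - (m - 1) = n + 1\<close>.\<close>
    have "(n + m) choose (m - 1) = (n + 1 + m - 1) choose (n + 1)"
      using binomial_symmetric[of "m - 1" "n + m"] assms(2) by simp
    then show ?thesis using rank_full_iff[OF I f If, of "n + 1"] by simp
  qed
  \<comment> \<open>All linear forms together trivially contain degree 1. This yields a reduction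
    with \<open>d\<close> generators over k, which is a specialisation and so lifts to the generic
    family.\<close>
  have ex: "\<exists>n. ?P n"
  proof -
    have "lforms 1 \<union> I \<subseteq> RR" using forms_polys[of UNIV "{..<m}" 1] R.ideal_sub[OF I(1)] by blast
    then have "lforms 1 \<subseteq> R.Gen (lforms 1 \<union> I)" using R.Gen_self by blast
    from ex_reduction[OF I dim subset_refl this] obtain y n
      where y: "\<forall>i<d. y i \<in> lforms 1" "lforms n \<subseteq> R.Gen (y ` {..<d} \<union> I)" by blast
    obtain a where "\<forall>i<d. special_form m a i = y i" using ex_special_form[of y] y(1) by blast
    then have "special_form m a ` {..<d} = y ` {..<d}" by (intro image_cong) auto
    then have "lforms n \<subseteq> R.Gen (special_form m a ` {..<d} \<union> I)" using y(2) by simp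
    then have "uforms n \<subseteq> ?J" by (rule generic_of_special[OF I])
    then have "?P n" by (rule U.forms_subset_add[OF J]) simp
    then show ?thesis by blast
  qed
  let ?R = "{reduction_number_wrt (A_ring m I) (A_grading m I) Q | Q. is_minimal_reduction (A_ring m I) (A_grading m I) Q}"
  have min: "is_minimal_reduction (A_ring m I) (A_grading m I) Q \<longleftrightarrow>
     (\<exists>y. (\<forall>i<d. y i \<in> lforms 1) \<and> Q = (\<lambda>p. I +>\<^bsub>ring_on RR\<^esub> p) ` R.Gen (y ` {..<d} \<union> I) \<and>
        (\<exists>n. lforms n \<subseteq> R.Gen (y ` {..<d} \<union> I)))" for Q
    unfolding A_ring_def A_grading_def by (rule is_minimal_reduction_iff[OF I dim])
  have Jy: "R.is_ideal (R.Gen (y ` {..<d} \<union> I))" "I \<subseteq> R.Gen (y ` {..<d} \<union> I)"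
    if y: "\<forall>i<d. y i \<in> lforms 1" for y
  proof -
    have s: "y ` {..<d} \<union> I \<subseteq> RR"
      by (rule Un_least[OF lforms_family_poly[of d y 1] R.ideal_sub[OF I(1)]]) (use y in blast)
    show "R.is_ideal (R.Gen (y ` {..<d} \<union> I))" by (rule R.Gen_ideal[OF s])
    show "I \<subseteq> R.Gen (y ` {..<d} \<union> I)" using R.Gen_self[OF s] by blast
  qed
  have r: "reduction_number_wrt (A_ring m I) (A_grading m I) ((\<lambda>p. I +>\<^bsub>ring_on RR\<^esub> p) ` R.Gen (y ` {..<d} \<union> I))
      = (LEAST n. lforms (Suc n) \<subseteq> R.Gen (y ` {..<d} \<union> I))" if y: "\<forall>i<d. y i \<in> lforms 1" for y
    unfolding A_grading_def by (rule reduction_number_wrt_coset_image[OF I(1) Jy[OF y]])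
  \<comment> \<open>A point at which the least generic degree survives; it shows that the minimum
    over the reductions is attained.\<close>
  obtain a where a: "lforms (Suc (LEAST n. ?P n)) \<subseteq> R.Gen (special_form m a ` {..<d} \<union> I)"
    using special_of_generic[OF I fR If LeastI_ex[OF ex]] by blast
  have sa: "\<forall>i<d. special_form m a i \<in> lforms 1" using special_form_form by blast
  have mem: "(LEAST n. lforms (Suc n) \<subseteq> R.Gen (special_form m a ` {..<d} \<union> I)) \<in> ?R"
    unfolding r[OF sa, symmetric]
  proof (intro CollectI exI conjI refl)
    show "is_minimal_reduction (A_ring m I) (A_grading m I)
        ((\<lambda>p. I +>\<^bsub>ring_on RR\<^esub> p) ` R.Gen (special_form m a ` {..<d} \<union> I))"
      unfolding min using sa a by blast
  qed (rule refl)
  have "Inf ?R = (LEAST n. ?P n)"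
  proof (rule antisym)
    have "Inf ?R \<le> (LEAST n. lforms (Suc n) \<subseteq> R.Gen (special_form m a ` {..<d} \<union> I))"
      using mem by (intro cInf_lower) auto
    also have "\<dots> \<le> (LEAST n. ?P n)" using a by (rule Least_le)
    finally show "Inf ?R \<le> (LEAST n. ?P n)" .
    show "(LEAST n. ?P n) \<le> Inf ?R"
    proof (rule cInf_greatest)
      show "?R \<noteq> {}" using mem by blast
      fix x assume "x \<in> ?R"
      then obtain Q where Q: "x = reduction_number_wrt (A_ring m I) (A_grading m I) Q"
        "is_minimal_reduction (A_ring m I) (A_grading m I) Q" by blast
      from Q(2) obtain y n where y: "\<forall>i<d. y i \<in> lforms 1" "lforms n \<subseteq> R.Gen (y ` {..<d} \<union> I)"
        and Qy: "Q = (\<lambda>p. I +>\<^bsub>ring_on RR\<^esub> p) ` R.Gen (y ` {..<d} \<union> I)" unfolding min by blast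
      have x: "x = (LEAST n. lforms (Suc n) \<subseteq> R.Gen (y ` {..<d} \<union> I))"
        unfolding Q(1) Qy by (rule r[OF y(1)])
      \<comment> \<open>The reduction number counts degrees shifted by one, so a witness of the form
        \<open>Suc n\<close> is needed before \<open>LEAST\<close> can be unfolded.\<close>
      have "lforms (Suc n) \<subseteq> R.Gen (y ` {..<d} \<union> I)"
        by (rule forms_subset_add[OF Jy(1)[OF y(1)] y(2)]) simp
      then have xP: "lforms (Suc x) \<subseteq> R.Gen (y ` {..<d} \<union> I)"
        unfolding x by (rule LeastI)
      obtain b where "\<forall>i<d. special_form m b i = y i" using ex_special_form[of y] y(1) by blast
      then have "special_form m b ` {..<d} = y ` {..<d}" by (intro image_cong) auto
      then have "lforms (Suc x) \<subseteq> R.Gen (special_form m b ` {..<d} \<union> I)" using xP by simp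
      then have "?P x" by (rule generic_of_special[OF I])
      then show "(LEAST n. ?P n) \<le> x" by (rule Least_le)
    qed
  qed
  then have "reduction_number (A_ring m I) (A_grading m I) = (LEAST n. ?P n)"
    by (simp add: reduction_number_def)
  moreover have "{n. rank_over (ratfuns d m) (M_mat d m v f dg (n + 1)) = (n + m) choose (m - 1)} = {n. ?P n}"
    unfolding rank ..
  moreover have "Inf {n. ?P n} = (LEAST n. ?P n)" by (simp add: Inf_nat_def)
  ultimately show ?thesis using ru ex by simp
qed

end
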